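(* Let $(f,X,\mu)$ and $\phi\colon X\to[0,\infty)$, with $\int\phi\,d\mu=\infty$, satisfy assumptions (A1)–(A6), with $\beta\in(0,1)$ as in (A6). Let $S_n(x)=\sum_{k=0}^{n-1}\phi(f^k(x))$ and $M_n(x)=\max_{0\le k\le n-1}\phi(f^k(x))$. Then for each $\varepsilon>0$ and $\mu$-almost all $x\in X$ there is an $n_0$ such that for all $n>n_0$, $$n^{\frac1\beta}(\log n)^{-\frac1\beta-\varepsilon}\le M_n(x)<S_n(x)\le n^{\frac1\beta}(\log n)^{\frac1\beta+\varepsilon}.$$
   Context: Notation: $|\cdot|$ applied to a set is Lebesgue measure (length); $v(n)\sim u(n)$ as $n\to\infty$ means there is a constant $c>0$ with $c^{-1}\le v(n)/u(n)\le c$ for all large enough $n$. The transformation $f\colon X\to X$ preserves the probability measure $\mu$. The assumptions are: (A1) $X$ is an interval and there is a countable Markov partition $\mathcal{P}=\{X_i:i\in\mathbb{N}\}$ such that $f(X_i)$ contains a union of elements of $\mathcal{P}$, and there exists $c_0>0$ such that $|f(X_i)|>c_0$. Let $\mathcal{P}_n=\bigvee_{i=0}^{n}f^{-i}\mathcal{P}$. (A2) There exist $\lambda>1$, $C>0$ such that for all $x\in X$ we have $|(f^n)'(x)|\ge C\lambda^n$ for $n\ge1$. (A3) Uniform bounded distortion estimates hold on $\omega\in\mathcal{P}_n$: there exist $0<\tau<1$, $C>0$ such that for all $\omega\in\mathcal{P}_n$ and all $x,y\in\omega$, $\left|\log\left(\frac{|f'(x)|}{|f'(y)|}\right)\right|\le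 C\tau^n$. (A4) The measure $\mu$ is the unique invariant probability measure which is absolutely continuous with respect to Lebesgue measure. (A5) For any $X_i\in\mathcal{P}$ the restriction $\phi|_{X_i}$ of $\phi$ to $X_i$ is constant. (A6) There exists $\beta\in(0,1)$ such that $\mu\{x\in X:\phi(x)=n\}\sim n^{-\beta-1}$.
   Formalization: The interval X is assumed bounded, and φ is assumed to take values in the natural numbers μ-almost everywhere, so that (A6) describes its whole distribution; without either assumption the claim as stated has counterexamples. *)

theory Defs
  imports "HOL-Probability.Probability"
begin

(* v(n) ~ u(n) in the sense of two-sided bounds on the quotient, which is weaker than
   asymptotic equivalence. *)
definition comparable :: "(nat \<Rightarrow> real) \<Rightarrow> (nat \<Rightarrow> real) \<Rightarrow> bool" where
  "comparable v u \<longleftrightarrow>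
     (\<exists>c>0. \<forall>\<^sub>F n in sequentially. inverse c \<le> v n / u n \<and> v n / u n \<le> c)"

(* The join of the partitions f^{-i} P for 0 <= i <= n, empty intersections discarded. *)
definition refined_partition :: "(real \<Rightarrow> real) \<Rightarrow> real set set \<Rightarrow> nat \<Rightarrow> real set set" where
  "refined_partition f P n =
     {\<omega>. \<omega> \<noteq> {} \<and> (\<exists>Y. (\<forall>i\<le>n. Y i \<in> P) \<and> \<omega> = {x. \<forall>i\<le>n. (f ^^ i) x \<in> Y i})}"

(* The elements of P are open intervals and partition X up to a Lebesgue null set, so that
   derivatives at the points of an element are ordinary two-sided ones. In the same sense,
   the image of an element contains a union of elements and exceeds it only by a null set.
   Injectivity of f on the elements is a consequence of uniformly_expanding below: by
   Darboux's theorem a derivative without zeros on an interval has constant sign. *)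
definition markov_partition :: "(real \<Rightarrow> real) \<Rightarrow> real set \<Rightarrow> real set set \<Rightarrow> bool" where
  "markov_partition f X P \<longleftrightarrow>
     countable P \<and> disjoint P \<and>
     (\<forall>I\<in>P. I \<noteq> {} \<and> open I \<and> is_interval I \<and> f differentiable_on I) \<and>
     \<Union>P \<subseteq> X \<and> X - \<Union>P \<in> null_sets lborel \<and>
     (\<forall>I\<in>P. \<exists>Q\<subseteq>P. \<Union>Q \<subseteq> f ` I \<and> f ` I - \<Union>Q \<in> null_sets lborel)"

definition big_images :: "(real \<Rightarrow> real) \<Rightarrow> real set set \<Rightarrow> bool" where
  "big_images f P \<longleftrightarrow> (\<exists>c\<^sub>0>0. \<forall>I\<in>P. measure lborel (f ` I) > c\<^sub>0)"

(* The bound is required at the points whose first n iterates (from 0 to n - 1) avoid the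
   exceptional null set; there f ^^ n is differentiable by the chain rule. *)
definition uniformly_expanding :: "(real \<Rightarrow> real) \<Rightarrow> real set set \<Rightarrow> bool" where
  "uniformly_expanding f P \<longleftrightarrow>
     (\<exists>\<rho>>1. \<exists>C>0. \<forall>n\<ge>1. \<forall>x\<in>\<Union>(refined_partition f P (n - 1)).
        \<bar>deriv (f ^^ n) x\<bar> \<ge> C * \<rho> ^ n)"

definition bounded_distortion :: "(real \<Rightarrow> real) \<Rightarrow> real set set \<Rightarrow> bool" where
  "bounded_distortion f P \<longleftrightarrow>
     (\<exists>\<tau> C. 0 < \<tau> \<and> \<tau> < 1 \<and> C > 0 \<and>
        (\<forall>n. \<forall>\<omega>\<in>refined_partition f P n. \<forall>x\<in>\<omega>. \<forall>y\<in>\<omega>.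
           \<bar>ln (\<bar>deriv f x\<bar> / \<bar>deriv f y\<bar>)\<bar> \<le> C * \<tau> ^ n))"

(* mu is a Borel measure with underlying space X. *)
definition invariant_prob :: "(real \<Rightarrow> real) \<Rightarrow> real set \<Rightarrow> real measure \<Rightarrow> bool" where
  "invariant_prob f X \<mu> \<longleftrightarrow>
     sets \<mu> = sets (restrict_space borel X) \<and> prob_space \<mu> \<and>
     f \<in> measurable \<mu> \<mu> \<and> distr \<mu> \<mu> f = \<mu>"

definition acip :: "(real \<Rightarrow> real) \<Rightarrow> real set \<Rightarrow> real measure \<Rightarrow> bool" where
  "acip f X \<mu> \<longleftrightarrow>
     invariant_prob f X \<mu> \<and> absolutely_continuous (restrict_space lborel X) \<mu>"

definition unique_acip :: "(real \<Rightarrow> real) \<Rightarrow> real set \<Rightarrow> real measure \<Rightarrow> bool" where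
  "unique_acip f X \<mu> \<longleftrightarrow> acip f X \<mu> \<and> (\<forall>\<nu>. acip f X \<nu> \<longrightarrow> \<nu> = \<mu>)"

(* The point masses at the integers are meant to describe the whole distribution of phi,
   hence the first conjunct: mass at non-integer values would otherwise be unconstrained and
   could have an arbitrarily heavy tail. *)
definition regular_tail :: "real set \<Rightarrow> real measure \<Rightarrow> (real \<Rightarrow> real) \<Rightarrow> real \<Rightarrow> bool" where
  "regular_tail X \<mu> \<phi> \<beta> \<longleftrightarrow>
     (AE x in \<mu>. \<phi> x \<in> \<nat>) \<and>
     comparable (\<lambda>n. measure \<mu> {x\<in>X. \<phi> x = real n}) (\<lambda>n. real n powr (- \<beta> - 1))"

definition birkhoff_sum :: "(real \<Rightarrow> real) \<Rightarrow> (real \<Rightarrow> real) \<Rightarrow> nat \<Rightarrow> real \<Rightarrow> real" where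
  "birkhoff_sum f \<phi> n x = (\<Sum>k<n. \<phi> ((f ^^ k) x))"

(* Only meaningful for n >= 1. *)
definition birkhoff_max :: "(real \<Rightarrow> real) \<Rightarrow> (real \<Rightarrow> real) \<Rightarrow> nat \<Rightarrow> real \<Rightarrow> real" where
  "birkhoff_max f \<phi> n x = Max ((\<lambda>k. \<phi> ((f ^^ k) x)) ` {..<n})"

end

theory Submission
  imports Defs "HOL-Real_Asymp.Real_Asymp"
begin

text \<open>The upper bound is a first-moment estimate. The tail \<open>\<mu> {\<phi> > t}\<close> is of order
\<open>t\<^sup>-\<^sup>\<beta>\<close>, so the truncated observable \<open>min \<phi> a\<close> has mean of order \<open>a\<^sup>1\<^sup>-\<^sup>\<beta>\<close>, and Markov's
inequality for the sum of \<open>n\<close> truncated terms gives \<open>\<mu> {S\<^sub>n \<ge> a} \<le> C n a\<^sup>-\<^sup>\<beta>\<close>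
(\<open>birkhoff_sum_tail\<close>). Along \<open>n = 2^k\<close> with \<open>a\<^sup>\<beta> = 2^k k^(1+\<delta>)\<close> this is summable, and
Borel-Cantelli with monotonicity in \<open>n\<close> finishes.

The lower bound needs some independence. For \<open>n = 2^k\<close> the level \<open>t\<close> is chosen with
\<open>t\<^sup>\<beta> = 2^k / k^(1+\<delta>)\<close>, so that the expected number of visits to \<open>A = {\<phi> > t}\<close> before time \<open>n\<close>
is of order \<open>k^(1+\<delta>)\<close>. If the orbit is cut into blocks of length proportional to \<open>k\<close>, and if in
every block, whatever happened before, \<open>A\<close> is hit with probability at least a constant times
\<open>\<mu> A\<close>, then the probability that all blocks fail is, up to a constant factor, at most
\<open>exp (- \<kappa> k^\<delta>)\<close>, which is summable. Blocks of logarithmic length are thus affordable, and a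
hitting estimate with an error exponentially small in the block length suffices.

The block estimate (\<open>hit_via_K\<close> together with \<open>invariant_le_hits\<close>) is a renewal argument.
Bounded distortion makes the position of the orbit at time \<open>m\<close>, given its cylinder of order \<open>m\<close>,
comparable with normalised Lebesgue measure on a partition element; this is the approximate Markov
property of the locale \<open>quasi_markov\<close>. Fix a partition element \<open>K\<close> of positive \<open>\<mu>\<close>-measure. From
every other such element, \<open>K\<close> is reached within a fixed time with probability bounded below, so
excursions away from \<open>K\<close> have exponential tails. By invariance \<open>\<mu> A = \<mu> {f^g x \<in> A}\<close>;
decomposing this event according to the last visit to \<open>K\<close> and the first visit to \<open>A\<close> after it
bounds \<open>\<mu> A\<close> by a constant times the probability of hitting \<open>A\<close> from \<open>K\<close> within time \<open>g\<close>, up to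
an error exponentially small in \<open>g\<close>. The error is negligible against \<open>\<mu> A\<close>, which is of order at
least \<open>2^-k\<close>, once \<open>g\<close> is a large multiple of \<open>k\<close>.

Two facts connect \<open>\<mu>\<close> with Lebesgue measure: \<open>\<mu>\<close> has a bounded density (\<open>mu_le_lebesgue\<close>), and it
charges every non-null subset of the image of an element that it charges
(\<open>charged_image_positive\<close>). Both follow from \<open>domination\<close>, which transfers inequalities
between Lebesgue measures inside the cylinders of order \<open>n\<close> to \<open>\<mu>\<close> as \<open>n\<close> tends to infinity.
Uniqueness of \<open>\<mu>\<close> enters through recurrence: almost every orbit visits \<open>K\<close>, because the points
that do so infinitely often form an invariant set, and conditioning \<open>\<mu>\<close> on it gives another
absolutely continuous invariant probability. That the lower bound for reaching \<open>K\<close> is uniform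
comes from the large images: each of them contains one of finitely many fixed cylinders.\<close>

section \<open>Partitions into cells and iterated preimages\<close>

lemma (in finite_measure) measure_le_by_cells:
  assumes countable: "countable \<C>" and disjoint: "disjoint \<C>" and sets_cell: "\<And>w. w \<in> \<C> \<Longrightarrow> w \<in> sets M"
    and cover: "AE x in M. x \<in> \<Union>\<C>"
    and [measurable]: "Measurable.pred M A" "Measurable.pred M B" and "0 \<le> r"
    and le: "\<And>w. w \<in> \<C> \<Longrightarrow> measure M {x\<in>w. A x} \<le> r * measure M {x\<in>w. B x}"
  shows "measure M {x\<in>space M. A x} \<le> r * measure M {x\<in>space M. B x}"
proof -
  have split: "emeasure M {x\<in>space M. S x} = (\<integral>\<^sup>+w. emeasure M {x\<in>w. S x} \<partial>count_space \<C>)"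
    if [measurable]: "Measurable.pred M S" for S
  proof -
    have sub: "{x\<in>w. S x} \<in> sets M" if "w \<in> \<C>" for w
    proof -
      have [measurable]: "w \<in> sets M" using sets_cell that by auto
      have "{x\<in>w. S x} = {x\<in>space M. x \<in> w \<and> S x}"
        using sets.sets_into_space[OF \<open>w \<in> sets M\<close>] by auto
      then show ?thesis by simp
    qed
    have UN: "(\<Union>w\<in>\<C>. {x\<in>w. S x}) \<in> sets M"
      using sub countable by (intro sets.countable_UN') auto
    have "emeasure M {x\<in>space M. S x} = emeasure M (\<Union>w\<in>\<C>. {x\<in>w. S x})"
    proof (rule emeasure_eq_AE)
      show "AE x in M. (x \<in> {x\<in>space M. S x}) = (x \<in> (\<Union>w\<in>\<C>. {x\<in>w. S x}))"
        using cover AE_space by eventually_elim auto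
    qed (use UN in auto)
    also have "\<dots> = (\<integral>\<^sup>+w. emeasure M {x\<in>w. S x} \<partial>count_space \<C>)"
    proof (rule emeasure_UN_countable)
      show "disjoint_family_on (\<lambda>w. {x\<in>w. S x}) \<C>"
        unfolding disjoint_family_on_def
      proof (intro ballI impI)
        fix v w assume "v \<in> \<C>" "w \<in> \<C>" "v \<noteq> w"
        then have "v \<inter> w = {}" using disjoint by (simp add: disjoint_def)
        then show "{x\<in>v. S x} \<inter> {x\<in>w. S x} = {}" by auto
      qed
    qed (use sub countable in auto)
    finally show ?thesis .
  qed
  have "emeasure M {x\<in>space M. A x} = (\<integral>\<^sup>+w. emeasure M {x\<in>w. A x} \<partial>count_space \<C>)"
    by (rule split) simp
  also have "\<dots> \<le> (\<integral>\<^sup>+w. ennreal r * emeasure M {x\<in>w. B x} \<partial>count_space \<C>)"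
    using le \<open>0 \<le> r\<close>
    by (intro nn_integral_mono) (simp add: emeasure_eq_measure ennreal_mult'[symmetric] ennreal_leI)
  also have "\<dots> = ennreal r * emeasure M {x\<in>space M. B x}"
    by (subst nn_integral_cmult) (simp_all add: split[symmetric])
  finally show ?thesis
    using \<open>0 \<le> r\<close> by (simp add: emeasure_eq_measure ennreal_mult'[symmetric])
qed

lemma (in finite_measure) measure_iterate_preimage:
  assumes f: "f \<in> measurable M M" and inv: "distr M M f = M" and B: "B \<in> sets M"
  shows "measure M {x\<in>space M. (f ^^ n) x \<in> B} = measure M B"
proof -
  have it: "(f ^^ n) \<in> measurable M M" for n by (rule measurable_compose_n[OF f])
  have inv_n: "distr M M (f ^^ n) = M" for n
  proof (induction n)
    case (Suc n)
    have "distr M M (f ^^ Suc n) = distr (distr M M (f ^^ n)) M f"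
      using it[of n] f by (subst distr_distr) auto
    then show ?case by (simp only: Suc inv)
  qed (simp add: distr_id2)
  have "measure M B = measure (distr M M (f ^^ n)) B" by (simp add: inv_n)
  also have "\<dots> = measure M ((f ^^ n) -` B \<inter> space M)"
    by (rule measure_distr) (use it B in auto)
  also have "(f ^^ n) -` B \<inter> space M = {x\<in>space M. (f ^^ n) x \<in> B}" by auto
  finally show ?thesis by simp
qed

section \<open>Approximately Markov systems of cylinders\<close>

text \<open>A measure-theoretic substitute for a Markov chain. The set \<open>cyl m\<close> collects the cylinders that fix
the first \<open>m + 1\<close> symbols, and the last axiom says that conditionally on such a cylinder, whose last
symbol is \<open>I\<close>, the law of \<open>f^m\<close> is comparable, up to the factor \<open>D\<close>, with \<open>L\<close> normalised on \<open>I\<close>.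
It is stated without quotients and symmetrically in \<open>E\<close> and \<open>E'\<close>, so that \<open>E' = I\<close> gives the upper
and \<open>E = I\<close> the lower comparison.\<close>
locale quasi_markov = finite_measure L for L :: "'a measure" +
  fixes f :: "'a \<Rightarrow> 'a" and cyl :: "nat \<Rightarrow> 'a set set" and D :: real
  assumes f_measurable [measurable]: "f \<in> measurable L L"
    and countable_cyl: "countable (cyl m)"
    and disjoint_cyl: "disjoint (cyl m)"
    and sets_cyl: "w \<in> cyl m \<Longrightarrow> w \<in> sets L"
    and cyl_cover: "AE x in L. x \<in> \<Union>(cyl m)"
    and cyl_nested: "w \<in> cyl n \<Longrightarrow> m \<le> n \<Longrightarrow> \<exists>w'\<in>cyl m. w \<subseteq> w'"
    and cyl_pos: "w \<in> cyl 0 \<Longrightarrow> 0 < measure L w"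
    and D_pos: "D > 0"
    and full_branch: "w \<in> cyl m \<Longrightarrow> \<exists>I\<in>cyl 0. (f ^^ m) ` w \<subseteq> I \<and>
      (\<forall>E\<in>sets L. \<forall>E'\<in>sets L. E \<subseteq> I \<longrightarrow> E' \<subseteq> I \<longrightarrow>
        measure L {x\<in>w. (f ^^ m) x \<in> E} * measure L E'
          \<le> D * measure L {x\<in>w. (f ^^ m) x \<in> E'} * measure L E)"
begin

lemma iterate_measurable [measurable]: "(f ^^ n) \<in> measurable L L"
  by (rule measurable_compose_n[OF f_measurable])

text \<open>Events that depend only on the first \<open>m + 1\<close> symbols. Points outside all cylinders are ignored,
as they form a null set.\<close>
definition decided :: "nat \<Rightarrow> ('a \<Rightarrow> bool) \<Rightarrow> bool" where
  "decided m S \<longleftrightarrow> (\<forall>w\<in>cyl m. \<forall>x\<in>w. \<forall>y\<in>w. S x \<longrightarrow> S y)"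

lemma decided_mono: "decided m S \<Longrightarrow> m \<le> n \<Longrightarrow> decided n S"
  unfolding decided_def using cyl_nested by (meson subsetD)

lemma decided_conj: "decided m S \<Longrightarrow> decided m T \<Longrightarrow> decided m (\<lambda>x. S x \<and> T x)"
  unfolding decided_def by blast

lemma decided_not: "decided m S \<Longrightarrow> decided m (\<lambda>x. \<not> S x)"
  unfolding decided_def by blast

lemma decided_all: "(\<And>k. k \<in> J \<Longrightarrow> decided m (S k)) \<Longrightarrow> decided m (\<lambda>x. \<forall>k\<in>J. S k x)"
  unfolding decided_def by blast

lemma decided_iterate:
  assumes "decided 0 S" "k \<le> m"
  shows "decided m (\<lambda>x. S ((f ^^ k) x))"
proof -
  have "decided k (\<lambda>x. S ((f ^^ k) x))"
    unfolding decided_def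
  proof (intro ballI impI)
    fix w x y assume w: "w \<in> cyl k" "x \<in> w" "y \<in> w" "S ((f ^^ k) x)"
    then obtain I where "I \<in> cyl 0" "(f ^^ k) ` w \<subseteq> I" using full_branch by meson
    with w assms(1) show "S ((f ^^ k) y)" unfolding decided_def by blast
  qed
  then show ?thesis using assms(2) decided_mono by blast
qed

lemma decided_cyl: "I \<in> cyl 0 \<Longrightarrow> decided 0 (\<lambda>x. x \<in> I)"
  unfolding decided_def using disjoint_cyl[of 0] by (auto simp: disjoint_def)

text \<open>On each cylinder contained in \<open>S\<close> the distortion axiom, with \<open>E\<close> the last symbol and \<open>E'\<close> the part
of it where \<open>F\<close> holds, bounds the conditional probability of \<open>F\<close> after \<open>m\<close> steps from below.
Summation over the cylinders loses nothing. Only symbols that occur after \<open>S\<close> need the lower bound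
for \<open>F\<close>; this allows to condition on being in one particular cell at time \<open>m\<close>.\<close>
lemma markov_lower:
  assumes [measurable]: "Measurable.pred L S" "Measurable.pred L F"
    and S: "decided m S" and "0 < q"
    and F: "\<And>w x I. w \<in> cyl m \<Longrightarrow> x \<in> w \<Longrightarrow> S x \<Longrightarrow> I \<in> cyl 0 \<Longrightarrow> (f ^^ m) x \<in> I \<Longrightarrow>
      q * measure L I \<le> measure L {x\<in>I. F x}"
  shows "q / D * measure L {x\<in>space L. S x} \<le> measure L {x\<in>space L. S x \<and> F ((f ^^ m) x)}"
proof -
  have "measure L {x\<in>space L. S x} \<le> D / q * measure L {x\<in>space L. S x \<and> F ((f ^^ m) x)}"
  proof (rule measure_le_by_cells[OF countable_cyl disjoint_cyl sets_cyl cyl_cover, of m])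
    fix w assume w: "w \<in> cyl m"
    show "measure L {x\<in>w. S x} \<le> D / q * measure L {x\<in>w. S x \<and> F ((f ^^ m) x)}"
    proof (cases "\<exists>x\<in>w. S x")
      case False
      then have "{x\<in>w. S x} = {}" by auto
      then have "measure L {x\<in>w. S x} = 0" by (simp only: measure_empty)
      moreover have "0 \<le> D / q * measure L {x\<in>w. S x \<and> F ((f ^^ m) x)}"
        using D_pos \<open>0 < q\<close> by (intro mult_nonneg_nonneg) auto
      ultimately show ?thesis by linarith
    next
      case True
      then obtain x where x: "x \<in> w" "S x" by auto
      have all: "\<And>y. y \<in> w \<Longrightarrow> S y" using S w x unfolding decided_def by blast
      from full_branch[OF w] obtain I where I: "I \<in> cyl 0" "(f ^^ m) ` w \<subseteq> I" and
        dist: "\<forall>E\<in>sets L. \<forall>E'\<in>sets L. E \<subseteq> I \<longrightarrow> E' \<subseteq> I \<longrightarrow>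
          measure L {x\<in>w. (f ^^ m) x \<in> E} * measure L E'
            \<le> D * measure L {x\<in>w. (f ^^ m) x \<in> E'} * measure L E"
        by (elim bexE conjE) (rule that)
      have Iset[measurable]: "I \<in> sets L" and wset: "w \<in> sets L" using I w sets_cyl by auto
      have "{x\<in>I. F x} = {x\<in>space L. x \<in> I \<and> F x}" using sets.sets_into_space[OF Iset] by auto
      then have Fset: "{x\<in>I. F x} \<in> sets L" by simp
      have "measure L {x\<in>w. (f ^^ m) x \<in> I} * (q * measure L I)
          \<le> measure L {x\<in>w. (f ^^ m) x \<in> I} * measure L {x\<in>I. F x}"
        using F[OF w x I(1)] I(2) x by (intro mult_left_mono) auto
      also have "\<dots> \<le> D * measure L {x\<in>w. (f ^^ m) x \<in> {x\<in>I. F x}} * measure L I"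
        by (rule dist[rule_format]) (use Fset in auto)
      finally have "(measure L {x\<in>w. (f ^^ m) x \<in> I} * q) * measure L I
         \<le> (D * measure L {x\<in>w. (f ^^ m) x \<in> {x\<in>I. F x}}) * measure L I" by (simp add: mult_ac)
      then have "measure L {x\<in>w. (f ^^ m) x \<in> I} * q
         \<le> D * measure L {x\<in>w. (f ^^ m) x \<in> {x\<in>I. F x}}"
        using cyl_pos[OF I(1)] by simp
      moreover have "{x\<in>w. (f ^^ m) x \<in> I} = {x\<in>w. S x}" using I all by auto
      moreover have "{x\<in>w. (f ^^ m) x \<in> {x\<in>I. F x}} = {x\<in>w. S x \<and> F ((f ^^ m) x)}"
        using I all by auto
      ultimately have "measure L {x\<in>w. S x} * q \<le> D * measure L {x\<in>w. S x \<and> F ((f ^^ m) x)}"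
        by (simp only:)
      then show ?thesis using \<open>0 < q\<close> by (simp add: field_simps)
    qed
  qed (use D_pos \<open>0 < q\<close> in auto)
  then show ?thesis using D_pos \<open>0 < q\<close> by (simp add: field_simps)
qed

text \<open>Whatever was observed up to time \<open>m + j N\<close>, the set \<open>B\<close> is hit during the next \<open>N\<close> steps with
conditional probability at least \<open>q / D\<close>, so each block of \<open>N\<close> steps without a hit costs a factor
\<open>1 - q / D\<close>. That this factor is nonnegative is recorded because it is not apparent from the
assumptions.\<close>
lemma avoid_blocks:
  assumes [measurable]: "Measurable.pred L S" "B \<in> sets L"
    and S: "decided m S" and B: "decided 0 (\<lambda>x. x \<in> B)" and "0 < q"
    and hit: "\<And>I. I \<in> cyl 0 \<Longrightarrow>
       q * measure L I \<le> measure L {x\<in>I. \<exists>k\<in>{1..N}. (f ^^ k) x \<in> B}"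
  shows "measure L {x\<in>space L. S x \<and> (\<forall>k\<in>{1..j * N}. (f ^^ (m + k)) x \<notin> B)}
      \<le> (1 - q / D) ^ j * measure L {x\<in>space L. S x}
      \<and> (measure L {x\<in>space L. S x} > 0 \<longrightarrow> q / D \<le> 1)"
proof -
  let ?A = "\<lambda>j x. S x \<and> (\<forall>k\<in>{1..j * N}. (f ^^ (m + k)) x \<notin> B)"
  let ?F = "\<lambda>x. \<exists>k\<in>{1..N}. (f ^^ k) x \<in> B"
  have dec: "decided (m + j * N) (?A j)" for j
    by (intro decided_conj decided_mono[OF S] decided_all decided_not decided_iterate[OF B]) auto
  have low: "q / D * measure L {x\<in>space L. ?A j x}
       \<le> measure L {x\<in>space L. ?A j x \<and> ?F ((f ^^ (m + j * N)) x)}" for j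
    by (rule markov_lower[OF _ _ dec \<open>0 < q\<close>]) (use hit in auto)
  have step: "measure L {x\<in>space L. ?A (Suc j) x} \<le> (1 - q / D) * measure L {x\<in>space L. ?A j x}" for j
  proof -
    have sh: "(f ^^ k) ((f ^^ (m + j * N)) x) = (f ^^ (m + (j * N + k))) x" for k x
      by (metis add.assoc add.commute comp_apply funpow_add)
    have "{x\<in>space L. ?A (Suc j) x} \<subseteq>
       {x\<in>space L. ?A j x} - {x\<in>space L. ?A j x \<and> ?F ((f ^^ (m + j * N)) x)}"
      unfolding sh by auto
    then have "measure L {x\<in>space L. ?A (Suc j) x} \<le>
       measure L ({x\<in>space L. ?A j x} - {x\<in>space L. ?A j x \<and> ?F ((f ^^ (m + j * N)) x)})"
      by (intro finite_measure_mono) auto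
    also have "\<dots> = measure L {x\<in>space L. ?A j x} -
        measure L {x\<in>space L. ?A j x \<and> ?F ((f ^^ (m + j * N)) x)}"
      by (intro finite_measure_Diff) auto
    finally show ?thesis using low[of j] by (simp add: algebra_simps)
  qed
  have le1: "q / D \<le> 1" if "measure L {x\<in>space L. S x} > 0"
  proof -
    have "q / D * measure L {x\<in>space L. S x} \<le> measure L {x\<in>space L. ?A 0 x \<and> ?F ((f ^^ (m + 0)) x)}"
      using low[of 0] by simp
    also have "\<dots> \<le> measure L {x\<in>space L. S x}"
      by (intro finite_measure_mono) auto
    finally have "q / D * measure L {x\<in>space L. S x} \<le> 1 * measure L {x\<in>space L. S x}" by simp
    then show ?thesis using that by (rule mult_right_le_imp_le)
  qed
  show ?thesis
  proof (cases "measure L {x\<in>space L. S x} > 0")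
    case False
    then have z: "measure L {x\<in>space L. S x} = 0" using zero_less_measure_iff by blast
    have "measure L {x\<in>space L. ?A j x} \<le> measure L {x\<in>space L. S x}"
      by (intro finite_measure_mono) auto
    then show ?thesis using z by simp
  next
    case True
    have "measure L {x\<in>space L. ?A j x} \<le> (1 - q / D) ^ j * measure L {x\<in>space L. S x}" for j
    proof (induction j)
      case (Suc j)
      have "measure L {x\<in>space L. ?A (Suc j) x} \<le> (1 - q / D) * measure L {x\<in>space L. ?A j x}"
        by (rule step)
      also have "\<dots> \<le> (1 - q / D) * ((1 - q / D) ^ j * measure L {x\<in>space L. S x})"
        by (intro mult_left_mono Suc) (use le1 True in auto)
      finally show ?case by simp
    qed auto
    then show ?thesis using le1 by blast
  qed
qed

end

text \<open>The core \<open>K\<close> is a cell that is reached from every cell within \<open>N\<close> steps, with a uniform lower bound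
for the probability.\<close>
locale recurrent_core = quasi_markov +
  fixes K :: "'a set" and N :: nat and c :: real
  assumes K: "K \<in> cyl 0" and N_pos: "N \<ge> 1" and c_pos: "c > 0"
    and hit_K: "I \<in> cyl 0 \<Longrightarrow>
       c * measure L I \<le> measure L {x\<in>I. \<exists>k\<in>{1..N}. (f ^^ k) x \<in> K}"
begin

text \<open>A bound for the conditional probability of avoiding \<open>K\<close> during \<open>N\<close> steps.\<close>
definition \<theta> :: real where "\<theta> = 1 - c / D"

lemma K_sets [measurable]: "K \<in> sets L" using K sets_cyl by auto

lemma K_sub: "x \<in> K \<Longrightarrow> x \<in> space L" using sets.sets_into_space[OF K_sets] by auto

lemma \<theta>_bounds: "0 \<le> \<theta>" "\<theta> < 1"
proof -
  have "0 < measure L {x\<in>space L. x \<in> K}"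
    using cyl_pos[OF K] K_sub by (metis (no_types, lifting) Collect_cong Collect_mem_eq)
  then have "c / D \<le> 1"
    using avoid_blocks[of "\<lambda>x. x \<in> K" K 0 c N 0, OF _ _ decided_cyl[OF K] decided_cyl[OF K] c_pos hit_K]
    by auto
  then show "0 \<le> \<theta>" "\<theta> < 1" using c_pos D_pos by (auto simp: \<theta>_def)
qed

text \<open>The exponent is rounded down to whole blocks of \<open>N\<close> steps; keeping it in this form avoids
fractional powers of \<open>\<theta>\<close>.\<close>
lemma avoid_K:
  assumes [measurable]: "Measurable.pred L S" and S: "decided m S"
  shows "measure L {x\<in>space L. S x \<and> (\<forall>k\<in>{1..r}. (f ^^ (m + k)) x \<notin> K)}
      \<le> \<theta> ^ (r div N) * measure L {x\<in>space L. S x}"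
proof -
  have "measure L {x\<in>space L. S x \<and> (\<forall>k\<in>{1..r}. (f ^^ (m + k)) x \<notin> K)}
     \<le> measure L {x\<in>space L. S x \<and> (\<forall>k\<in>{1..(r div N) * N}. (f ^^ (m + k)) x \<notin> K)}"
  proof (rule finite_measure_mono)
    have "{1..(r div N) * N} \<subseteq> {1..r}" using div_times_less_eq_dividend[of r N] by simp
    then show "{x\<in>space L. S x \<and> (\<forall>k\<in>{1..r}. (f ^^ (m + k)) x \<notin> K)}
      \<subseteq> {x\<in>space L. S x \<and> (\<forall>k\<in>{1..(r div N) * N}. (f ^^ (m + k)) x \<notin> K)}"
      by blast
  qed simp
  also have "\<dots> \<le> \<theta> ^ (r div N) * measure L {x\<in>space L. S x}"
    unfolding \<theta>_def using avoid_blocks[OF _ _ S decided_cyl[OF K] c_pos hit_K] by auto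
  finally show ?thesis .
qed

lemma sum_avoidance_le: "(\<Sum>r\<le>g. \<theta> ^ (r div N)) \<le> N / (1 - \<theta>)"
proof -
  have blocks: "(\<Sum>r<j * N. \<theta> ^ (r div N)) = N * (\<Sum>i<j. \<theta> ^ i)" for j
  proof (induction j)
    case (Suc j)
    have U: "{..<Suc j * N} = {..<j * N} \<union> {j * N..<j * N + N}" by auto
    have "(\<Sum>r<Suc j * N. \<theta> ^ (r div N))
       = (\<Sum>r<j * N. \<theta> ^ (r div N)) + (\<Sum>r=j * N..<j * N + N. \<theta> ^ (r div N))"
      unfolding U by (rule sum.union_disjoint) auto
    also have "(\<Sum>r=j * N..<j * N + N. \<theta> ^ (r div N)) = (\<Sum>r=j * N..<j * N + N. \<theta> ^ j)"
    proof (rule sum.cong)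
      fix r assume r: "r \<in> {j * N..<j * N + N}"
      have "r div N = j" by (rule div_nat_eqI) (use r in \<open>auto simp: mult.commute\<close>)
      then show "\<theta> ^ (r div N) = \<theta> ^ j" by simp
    qed simp
    finally show ?case using Suc by (simp add: algebra_simps)
  qed simp
  have "(\<Sum>r\<le>g. \<theta> ^ (r div N)) \<le> (\<Sum>r<Suc g * N. \<theta> ^ (r div N))"
  proof (rule sum_mono2)
    have "Suc g \<le> Suc g * N" using N_pos by (metis mult.right_neutral mult_le_mono2)
    then show "{..g} \<subseteq> {..<Suc g * N}" by (auto simp: less_Suc_eq_le[symmetric] simp del: mult_Suc)
  qed (use \<theta>_bounds in auto)
  also have "\<dots> = N * (\<Sum>i<Suc g. \<theta> ^ i)" by (rule blocks)
  also have "(\<Sum>i<Suc g. \<theta> ^ i) = (1 - \<theta> ^ Suc g) / (1 - \<theta>)"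
    using \<theta>_bounds by (subst sum_gp_strict) auto
  also have "real N * ((1 - \<theta> ^ Suc g) / (1 - \<theta>)) \<le> N * (1 / (1 - \<theta>))"
    using \<theta>_bounds by (intro mult_left_mono divide_right_mono) auto
  finally show ?thesis by simp
qed

text \<open>The renewal estimate. If \<open>f^g x \<in> A\<close> then either the orbit avoids \<open>K\<close> up to time \<open>g\<close>, which is
exponentially unlikely, or there is a last visit to \<open>K\<close>, at time \<open>j\<close> say, and a first visit to \<open>A\<close>
after it, at time \<open>j + i\<close>; then \<open>K\<close> is avoided during the remaining \<open>r = g - j - i\<close> steps. By
invariance the measure of such an event does not depend on \<open>j\<close>. Avoiding \<open>K\<close> for \<open>r\<close> steps costs a
factor that is summable over \<open>r\<close>, and the events that the first visit to \<open>A\<close> from \<open>K\<close> takes place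
at time \<open>i\<close> are disjoint in \<open>i\<close>. Asking for the first visit to \<open>A\<close> prevents a factor \<open>g\<close>, which
would be too much for the application.\<close>
lemma invariant_le_hits:
  fixes M :: "'a measure"
  assumes sets_M: "sets M = sets L" and "finite_measure M" and inv: "distr M M f = M"
    and dens: "\<And>B. B \<in> sets L \<Longrightarrow> measure M B \<le> C * measure L B" and "C \<ge> 0"
    and [measurable]: "A \<in> sets L" and A: "decided 0 (\<lambda>x. x \<in> A)"
  shows "measure M A \<le> C * (\<theta> ^ (g div N) * measure L (space L) +
           N / (1 - \<theta>) * measure L {x\<in>K. \<exists>k\<le>g. (f ^^ k) x \<in> A})"
proof -
  interpret M: finite_measure M by fact
  note sets_M [measurable_cong]
  have sp: "space M = space L" using sets_M by (rule sets_eq_imp_space_eq)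
  have fM [measurable]: "f \<in> measurable M M" by simp
  have pre: "measure M {x\<in>space L. (f ^^ n) x \<in> B} = measure M B" if "B \<in> sets L" for n B
    using M.measure_iterate_preimage[OF fM inv, of B n] that sets_M sp by simp
  define H where "H i = {x\<in>space L. x \<in> K \<and> (f ^^ i) x \<in> A \<and> (\<forall>k\<in>{..<i}. (f ^^ k) x \<notin> A)}" for i
  define E where "E i r = {x\<in>space L. (x \<in> K \<and> (f ^^ i) x \<in> A \<and> (\<forall>k\<in>{..<i}. (f ^^ k) x \<notin> A))
      \<and> (\<forall>k\<in>{1..r}. (f ^^ (i + k)) x \<notin> K)}" for i r
  have E_meas [measurable]: "E i r \<in> sets L" and H_meas [measurable]: "H i \<in> sets L" for i r
    unfolding E_def H_def by auto
  have E_le: "measure L (E i r) \<le> \<theta> ^ (r div N) * measure L (H i)" for i r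
    unfolding E_def H_def
  proof (rule avoid_K)
    have "decided i (\<lambda>x. x \<in> K)" using decided_mono[OF decided_cyl[OF K], of i] by simp
    then show "decided i (\<lambda>x. x \<in> K \<and> (f ^^ i) x \<in> A \<and> (\<forall>k\<in>{..<i}. (f ^^ k) x \<notin> A))"
      by (intro decided_conj decided_all decided_not decided_iterate[OF A]) auto
  qed simp
  \<comment> \<open>The case without a visit to the core; time 0 is left out to match the form of the avoidance estimate.\<close>
  define Ng where "Ng = {x\<in>space L. \<forall>k\<in>{1..g}. (f ^^ k) x \<notin> K}"
  have Ng_meas [measurable]: "Ng \<in> sets L" unfolding Ng_def by auto
  have Ng_le: "measure L Ng \<le> \<theta> ^ (g div N) * measure L (space L)"
    using avoid_K[of "\<lambda>_. True" 0 g] by (simp add: Ng_def decided_def)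
  \<comment> \<open>Indexed by \<open>i\<close> and \<open>r\<close> alone, the time of the last visit being \<open>j = g - i - r\<close>. Pairs with
    \<open>i + r > g\<close> only enlarge the union.\<close>
  let ?pre = "\<lambda>i r. {x\<in>space L. (f ^^ (g - i - r)) x \<in> E i r}"
  have cover: "{x\<in>space L. (f ^^ g) x \<in> A} \<subseteq> Ng \<union> (\<Union>i\<in>{..g}. \<Union>r\<in>{..g}. ?pre i r)"
  proof
    fix x assume x: "x \<in> {x\<in>space L. (f ^^ g) x \<in> A}"
    show "x \<in> Ng \<union> (\<Union>i\<in>{..g}. \<Union>r\<in>{..g}. ?pre i r)"
    proof (cases "x \<in> Ng")
      case False
      then obtain k where k: "k \<in> {1..g}" "(f ^^ k) x \<in> K" using x unfolding Ng_def by auto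
      define j where "j = Max {k. k \<le> g \<and> (f ^^ k) x \<in> K}"
      have fin: "finite {k. k \<le> g \<and> (f ^^ k) x \<in> K}" by simp
      have "j \<in> {k. k \<le> g \<and> (f ^^ k) x \<in> K}"
        unfolding j_def by (rule Max_in[OF fin]) (use k in auto)
      then have j: "j \<le> g" "(f ^^ j) x \<in> K" by auto
      have jmax: "(f ^^ k) x \<notin> K" if "k > j" "k \<le> g" for k
        using Max_ge[OF fin, of k] that unfolding j_def by fastforce
      define i where "i = (LEAST i. (f ^^ (j + i)) x \<in> A)"
      have ex: "(f ^^ (j + (g - j))) x \<in> A" using x j by simp
      have i: "(f ^^ (j + i)) x \<in> A" "i \<le> g - j"
        unfolding i_def using LeastI[of "\<lambda>i. (f ^^ (j + i)) x \<in> A", OF ex]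
          Least_le[of "\<lambda>i. (f ^^ (j + i)) x \<in> A", OF ex] by auto
      have imin: "(f ^^ (j + k)) x \<notin> A" if "k < i" for k
        using not_less_Least that unfolding i_def by blast
      define r where "r = g - j - i"
      have jr: "g - i - r = j" using i j unfolding r_def by auto
      have sh: "(f ^^ k) ((f ^^ j) x) = (f ^^ (j + k)) x" for k
        by (metis add.commute comp_apply funpow_add)
      have "(f ^^ j) x \<in> E i r"
        unfolding E_def using j i imin jmax K_sub by (auto simp: sh r_def)
      then have "x \<in> ?pre i r" using x by (simp only: jr) auto
      moreover have "i \<le> g" "r \<le> g" using i j unfolding r_def by auto
      ultimately show ?thesis by blast
    qed auto
  qed
  have "measure M A = measure M {x\<in>space L. (f ^^ g) x \<in> A}" by (simp add: pre)
  also have "\<dots> \<le> measure M (Ng \<union> (\<Union>i\<in>{..g}. \<Union>r\<in>{..g}. ?pre i r))"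
    using cover by (intro M.finite_measure_mono) (auto simp: sets_M)
  also have "\<dots> \<le> measure M Ng + measure M (\<Union>i\<in>{..g}. \<Union>r\<in>{..g}. ?pre i r)"
    by (rule measure_Un_le) (auto simp: sets_M)
  also have "measure M (\<Union>i\<in>{..g}. \<Union>r\<in>{..g}. ?pre i r) \<le> (\<Sum>i\<le>g. measure M (\<Union>r\<in>{..g}. ?pre i r))"
    by (rule measure_UNION_le) (auto simp: sets_M)
  also have "\<dots> \<le> (\<Sum>i\<le>g. \<Sum>r\<le>g. measure M (?pre i r))"
    by (intro sum_mono measure_UNION_le) (auto simp: sets_M)
  also have "\<dots> = (\<Sum>i\<le>g. \<Sum>r\<le>g. measure M (E i r))" by (simp add: pre)
  also have "\<dots> \<le> (\<Sum>i\<le>g. \<Sum>r\<le>g. C * (\<theta> ^ (r div N) * measure L (H i)))"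
    by (intro sum_mono order_trans[OF dens] mult_left_mono E_le) (use \<open>C \<ge> 0\<close> in auto)
  also have "\<dots> = C * ((\<Sum>r\<le>g. \<theta> ^ (r div N)) * (\<Sum>i\<le>g. measure L (H i)))"
    by (simp add: sum_distrib_left[symmetric] sum_distrib_right[symmetric])
  also have "(\<Sum>i\<le>g. measure L (H i)) = measure L (\<Union>i\<le>g. H i)"
  proof (rule finite_measure_finite_Union[symmetric])
    show "disjoint_family_on H {..g}"
      unfolding disjoint_family_on_def H_def using linorder_neqE_nat by blast
  qed auto
  also have "(\<Union>i\<le>g. H i) = {x\<in>K. \<exists>k\<le>g. (f ^^ k) x \<in> A}"
  proof
    show "{x\<in>K. \<exists>k\<le>g. (f ^^ k) x \<in> A} \<subseteq> (\<Union>i\<le>g. H i)"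
    proof
      fix x assume "x \<in> {x\<in>K. \<exists>k\<le>g. (f ^^ k) x \<in> A}"
      then obtain k where k: "x \<in> K" "k \<le> g" "(f ^^ k) x \<in> A" by auto
      define i where "i = (LEAST i. (f ^^ i) x \<in> A)"
      have "(f ^^ i) x \<in> A" "i \<le> k" unfolding i_def
        using LeastI[of "\<lambda>i. (f ^^ i) x \<in> A", OF k(3)] Least_le[of "\<lambda>i. (f ^^ i) x \<in> A", OF k(3)]
        by auto
      moreover have "\<forall>k<i. (f ^^ k) x \<notin> A" using not_less_Least unfolding i_def by blast
      ultimately show "x \<in> (\<Union>i\<le>g. H i)" using k K_sub unfolding H_def by auto
    qed
  qed (auto simp: H_def)
  also have "measure M Ng + C * ((\<Sum>r\<le>g. \<theta> ^ (r div N)) * measure L {x\<in>K. \<exists>k\<le>g. (f ^^ k) x \<in> A})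
    \<le> C * (\<theta> ^ (g div N) * measure L (space L)) +
       C * (N / (1 - \<theta>) * measure L {x\<in>K. \<exists>k\<le>g. (f ^^ k) x \<in> A})"
    by (intro add_mono order_trans[OF dens] mult_left_mono mult_right_mono Ng_le sum_avoidance_le)
       (use \<open>C \<ge> 0\<close> in auto)
  finally show ?thesis by (simp add: algebra_simps)
qed

text \<open>First reach \<open>K\<close>, then hit \<open>A\<close> from \<open>K\<close>. Splitting according to the first entrance time to \<open>K\<close>
makes the events disjoint, and each of them ends in the cell \<open>K\<close>, so that \<open>markov_lower\<close> needs a
bound in that cell only.\<close>
lemma hit_via_K:
  assumes [measurable]: "A \<in> sets L" and I: "I \<in> cyl 0"
  shows "c / (D * measure L K) * measure L {x\<in>K. \<exists>k\<le>g. (f ^^ k) x \<in> A} * measure L I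
    \<le> measure L {x\<in>I. \<exists>k\<in>{1..N + g}. (f ^^ k) x \<in> A}"
proof (cases "measure L {x\<in>K. \<exists>k\<le>g. (f ^^ k) x \<in> A} = 0")
  case False
  define q where "q = measure L {x\<in>K. \<exists>k\<le>g. (f ^^ k) x \<in> A} / measure L K"
  have Kpos: "measure L K > 0" using cyl_pos[OF K] .
  have q: "q > 0" unfolding q_def using False Kpos
    by (simp add: less_le)
  have Iset [measurable]: "I \<in> sets L" using I sets_cyl by auto
  have Isub: "x \<in> space L" if "x \<in> I" for x using sets.sets_into_space[OF Iset] that by auto
  let ?F = "\<lambda>x. \<exists>k\<le>g. (f ^^ k) x \<in> A"
  let ?S = "\<lambda>s x. x \<in> I \<and> (f ^^ s) x \<in> K \<and> (\<forall>k\<in>{1..<s}. (f ^^ k) x \<notin> K)"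
  have low: "q / D * measure L {x\<in>space L. ?S s x} \<le> measure L {x\<in>space L. ?S s x \<and> ?F ((f ^^ s) x)}"
    for s
  proof (rule markov_lower[OF _ _ _ q])
    have "decided s (\<lambda>x. x \<in> I)" using decided_mono[OF decided_cyl[OF I], of s] by simp
    then show "decided s (?S s)"
      by (intro decided_conj decided_all decided_not decided_iterate[OF decided_cyl[OF K]]) auto
    fix w x J assume "x \<in> w" "w \<in> cyl s" "?S s x" "J \<in> cyl 0" "(f ^^ s) x \<in> J"
    then have "J = K" using disjoint_cyl[of 0] K by (auto simp: disjoint_def)
    then show "q * measure L J \<le> measure L {x\<in>J. ?F x}" using Kpos by (simp add: q_def)
  qed simp_all
  have disj: "disjoint_family_on (\<lambda>s. {x\<in>space L. ?S s x}) {1..N}"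
    unfolding disjoint_family_on_def
  proof (intro ballI impI)
    fix s t assume "s \<in> {1..N}" "t \<in> {1..N}" "s \<noteq> t"
    then have "s \<in> {1..<t} \<or> t \<in> {1..<s}" by auto
    then have "\<not> (?S s x \<and> ?S t x)" for x by meson
    then show "{x\<in>space L. ?S s x} \<inter> {x\<in>space L. ?S t x} = {}" by auto
  qed
  have "c * measure L I \<le> measure L {x\<in>I. \<exists>k\<in>{1..N}. (f ^^ k) x \<in> K}" by (rule hit_K[OF I])
  also have "\<dots> \<le> measure L (\<Union>s\<in>{1..N}. {x\<in>space L. ?S s x})"
  proof (intro finite_measure_mono subsetI)
    fix x assume "x \<in> {x\<in>I. \<exists>k\<in>{1..N}. (f ^^ k) x \<in> K}"
    then obtain k where k: "x \<in> I" "k \<in> {1..N}" "(f ^^ k) x \<in> K" by auto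
    define i where "i = (LEAST i. 1 \<le> i \<and> (f ^^ i) x \<in> K)"
    have k': "1 \<le> k \<and> (f ^^ k) x \<in> K" using k by simp
    have "1 \<le> i \<and> (f ^^ i) x \<in> K" unfolding i_def using k' by (rule LeastI)
    moreover have "i \<le> k" unfolding i_def using k' by (rule Least_le)
    moreover have "(f ^^ k) x \<notin> K" if "1 \<le> k" "k < i" for k
      using not_less_Least[of k "\<lambda>i. 1 \<le> i \<and> (f ^^ i) x \<in> K"] that unfolding i_def by blast
    ultimately show "x \<in> (\<Union>s\<in>{1..N}. {x\<in>space L. ?S s x})" using k Isub by auto
  qed auto
  also have "\<dots> = (\<Sum>s=1..N. measure L {x\<in>space L. ?S s x})"
    by (rule finite_measure_finite_Union[OF _ _ disj]) auto
  finally have "q / D * (c * measure L I) \<le> q / D * (\<Sum>s=1..N. measure L {x\<in>space L. ?S s x})"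
    using q D_pos by (intro mult_left_mono) auto
  also have "\<dots> \<le> (\<Sum>s=1..N. measure L {x\<in>space L. ?S s x \<and> ?F ((f ^^ s) x)})"
    unfolding sum_distrib_left by (intro sum_mono low)
  also have "\<dots> = measure L (\<Union>s\<in>{1..N}. {x\<in>space L. ?S s x \<and> ?F ((f ^^ s) x)})"
  proof (rule finite_measure_finite_Union[symmetric])
    show "disjoint_family_on (\<lambda>s. {x\<in>space L. ?S s x \<and> ?F ((f ^^ s) x)}) {1..N}"
      by (rule disjoint_family_on_bisimulation[OF disj]) auto
  qed auto
  also have "\<dots> \<le> measure L {x\<in>I. \<exists>k\<in>{1..N + g}. (f ^^ k) x \<in> A}"
  proof (rule finite_measure_mono)
    have "{x\<in>I. \<exists>k\<in>{1..N + g}. (f ^^ k) x \<in> A} = {x\<in>space L. x \<in> I \<and> (\<exists>k\<in>{1..N + g}. (f ^^ k) x \<in> A)}"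
      using Isub by auto
    then show "{x\<in>I. \<exists>k\<in>{1..N + g}. (f ^^ k) x \<in> A} \<in> sets L" by simp
    show "(\<Union>s\<in>{1..N}. {x\<in>space L. ?S s x \<and> ?F ((f ^^ s) x)}) \<subseteq> {x\<in>I. \<exists>k\<in>{1..N + g}. (f ^^ k) x \<in> A}"
    proof safe
      fix s k x assume *: "s \<in> {1..N}" "k \<le> g" "(f ^^ k) ((f ^^ s) x) \<in> A"
      then have "(f ^^ (k + s)) x \<in> A" by (simp add: funpow_add)
      moreover have "k + s \<in> {1..N + g}" using * by auto
      ultimately show "\<exists>k\<in>{1..N + g}. (f ^^ k) x \<in> A" by blast
    qed
  qed
  finally show ?thesis by (simp add: q_def mult_ac)
qed simp

text \<open>The condition on \<open>g\<close> makes the error term of the renewal estimate at most half of \<open>M A\<close>; the other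
half then bounds the hitting probability from \<open>K\<close> from below.\<close>
lemma survival:
  fixes M :: "'a measure"
  assumes sets_M: "sets M = sets L" and "finite_measure M" and inv: "distr M M f = M"
    and dens: "\<And>B. B \<in> sets L \<Longrightarrow> measure M B \<le> C * measure L B" and "C > 0"
    and [measurable]: "A \<in> sets L" and A: "decided 0 (\<lambda>x. x \<in> A)"
    and big: "2 * C * \<theta> ^ (g div N) * measure L (space L) \<le> measure M A" "0 < measure M A"
  shows "measure L {x\<in>space L. \<forall>k\<in>{1..j * (N + g)}. (f ^^ k) x \<notin> A}
     \<le> (1 - c * (1 - \<theta>) / (2 * C * N * D\<^sup>2 * measure L K) * measure M A) ^ j * measure L (space L)
     \<and> c * (1 - \<theta>) / (2 * C * N * D\<^sup>2 * measure L K) * measure M A \<le> 1"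
proof -
  have Kpos: "measure L K > 0" using cyl_pos[OF K] .
  define h where "h = measure L {x\<in>K. \<exists>k\<le>g. (f ^^ k) x \<in> A}"
  have "measure M A \<le> C * (\<theta> ^ (g div N) * measure L (space L)) + C * (N / (1 - \<theta>) * h)"
    using invariant_le_hits[OF assms(1-3) dens, of A g] \<open>C > 0\<close> A
    by (simp add: h_def algebra_simps)
  then have "measure M A / 2 \<le> C * (N / (1 - \<theta>) * h)" using big(1) by linarith
  then have h: "(1 - \<theta>) / (2 * C * N) * measure M A \<le> h"
    using \<theta>_bounds \<open>C > 0\<close> N_pos by (simp add: field_simps)
  define q where "q = c / (D * measure L K) * ((1 - \<theta>) / (2 * C * N) * measure M A)"
  have q: "q > 0" unfolding q_def
    using \<theta>_bounds \<open>C > 0\<close> N_pos c_pos D_pos Kpos big by (intro mult_pos_pos divide_pos_pos) auto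
  have hit: "q * measure L I \<le> measure L {x\<in>I. \<exists>k\<in>{1..N + g}. (f ^^ k) x \<in> A}" if "I \<in> cyl 0" for I
  proof -
    have "q * measure L I \<le> c / (D * measure L K) * h * measure L I"
      unfolding q_def by (intro mult_right_mono mult_left_mono h) (use c_pos D_pos in auto)
    also have "\<dots> \<le> measure L {x\<in>I. \<exists>k\<in>{1..N + g}. (f ^^ k) x \<in> A}"
      unfolding h_def by (rule hit_via_K) (use that in auto)
    finally show ?thesis .
  qed
  have qD: "q / D = c * (1 - \<theta>) / (2 * C * N * D\<^sup>2 * measure L K) * measure M A"
    by (simp add: q_def power2_eq_square mult_ac)
  have "measure L K \<le> measure L (space L)" by (rule bounded_measure)
  then have "measure L (space L) > 0" using Kpos by linarith
  then show ?thesis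
    using avoid_blocks[of "\<lambda>_. True" A 0 q "N + g" j, OF _ _ _ A q hit]
    unfolding qD by (simp add: decided_def)
qed

end

section \<open>Bounded distortion in one dimension\<close>

lemma measure_image_bounds:
  fixes g :: "real \<Rightarrow> real"
  assumes E: "E \<in> sets borel" "bounded E" and gE: "g ` E \<in> sets borel" "bounded (g ` E)"
    and der: "\<And>x. x \<in> E \<Longrightarrow> (g has_real_derivative g' x) (at x)" and inj: "inj_on g E"
    and bnd: "\<And>x. x \<in> E \<Longrightarrow> a \<le> \<bar>g' x\<bar>" "\<And>x. x \<in> E \<Longrightarrow> \<bar>g' x\<bar> \<le> b"
  shows "a * measure lborel E \<le> measure lborel (g ` E)"
    and "measure lborel (g ` E) \<le> b * measure lborel E"
proof -
  have lm: "E \<in> lmeasurable" "g ` E \<in> lmeasurable"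
    using E gE by (auto intro!: bounded_set_imp_lmeasurable)
  have ml: "measure lebesgue E = measure lborel E" "measure lebesgue (g ` E) = measure lborel (g ` E)"
    using E gE by (simp_all add: measure_completion)
  have one: "(\<lambda>x. 1 :: real) absolutely_integrable_on (g ` E)"
    using lm(2) by (intro nonnegative_absolutely_integrable_1) (auto simp: lmeasurable_iff_integrable_on)
  have "(\<lambda>x. 1 :: real) absolutely_integrable_on g ` E \<and> integral (g ` E) (\<lambda>x. 1 :: real) = measure lborel (g ` E)"
    using one lm(2) ml(2) by (simp add: lmeasure_integral)
  then have "(\<lambda>x. \<bar>g' x\<bar> * 1) absolutely_integrable_on E \<and>
      integral E (\<lambda>x. \<bar>g' x\<bar> * 1) = measure lborel (g ` E)"
    using has_absolute_integral_change_of_variables_1'[of E g g' "\<lambda>x. 1" "measure lborel (g ` E)"]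
      lm(1) der inj by (auto intro: has_field_derivative_at_within)
  then have int: "(\<lambda>x. \<bar>g' x\<bar>) integrable_on E" "integral E (\<lambda>x. \<bar>g' x\<bar>) = measure lborel (g ` E)"
    by (auto simp: absolutely_integrable_on_def)
  have const: "(\<lambda>x. c) integrable_on E" "integral E (\<lambda>x. c) = c * measure lborel E" for c :: real
  proof -
    have "(\<lambda>x. 1 :: real) integrable_on E" using lm(1) by (simp add: lmeasurable_iff_integrable_on)
    from integrable_on_mult_right[OF this, of c] integral_mult_right[of E c "\<lambda>x. 1"]
    show "(\<lambda>x. c) integrable_on E" "integral E (\<lambda>x. c) = c * measure lborel E"
      using lm(1) ml(1) by (simp_all add: lmeasure_integral)
  qed
  show "a * measure lborel E \<le> measure lborel (g ` E)"
    using integral_le[OF const(1) int(1), of a] bnd(1) const(2) int(2) by simp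
  show "measure lborel (g ` E) \<le> b * measure lborel E"
    using integral_le[OF int(1) const(1), of b] bnd(2) const(2) int(2) by simp
qed

text \<open>The derivative stays within a factor \<open>D\<close> of its value at one point, so \<open>g\<close> distorts lengths by a
constant factor up to \<open>D\<close> in either direction. Relative sizes in \<open>S\<close> and in the image thus differ
by at most \<open>D\<^sup>2\<close>.\<close>
lemma bounded_distortion_cross:
  fixes g :: "real \<Rightarrow> real"
  assumes der: "\<And>x. x \<in> S \<Longrightarrow> (g has_real_derivative g' x) (at x)" and inj: "inj_on g S"
    and nz: "\<And>x. x \<in> S \<Longrightarrow> g' x \<noteq> 0"
    and ratio: "\<And>x y. x \<in> S \<Longrightarrow> y \<in> S \<Longrightarrow> \<bar>g' x\<bar> \<le> D * \<bar>g' y\<bar>"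
    and S: "bounded S" "bounded (g ` S)"
    and E: "E \<in> sets borel" "E \<subseteq> g ` S" "{x\<in>S. g x \<in> E} \<in> sets borel"
    and E': "E' \<in> sets borel" "E' \<subseteq> g ` S" "{x\<in>S. g x \<in> E'} \<in> sets borel"
  shows "measure lborel {x\<in>S. g x \<in> E} * measure lborel E'
      \<le> D\<^sup>2 * measure lborel {x\<in>S. g x \<in> E'} * measure lborel E"
proof (cases "S = {}")
  case True
  then show ?thesis by simp
next
  case False
  then obtain x0 where x0: "x0 \<in> S" by auto
  define d where "d = \<bar>g' x0\<bar>"
  have d: "d > 0" using nz x0 by (simp add: d_def)
  have "d \<le> D * d" using ratio[OF x0 x0] by (simp add: d_def)
  then have D: "D \<ge> 1" using d by simp
  have im: "g ` {x\<in>S. g x \<in> E} = E" "g ` {x\<in>S. g x \<in> E'} = E'" using E E' by auto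
  have bd: "bounded {x\<in>S. g x \<in> E}" "bounded {x\<in>S. g x \<in> E'}" "bounded E" "bounded E'"
    using S E E' by (auto intro: bounded_subset)
  have injs: "inj_on g {x\<in>S. g x \<in> E}" "inj_on g {x\<in>S. g x \<in> E'}"
    using inj by (auto intro: inj_on_subset)
  have lo: "d / D \<le> \<bar>g' x\<bar>" if "x \<in> S" for x
    using ratio[OF x0 that] D by (simp add: d_def field_simps)
  have up: "\<bar>g' x\<bar> \<le> D * d" if "x \<in> S" for x
    using ratio[OF that x0] by (simp add: d_def)
  have 1: "d / D * measure lborel {x\<in>S. g x \<in> E} \<le> measure lborel E"
    using measure_image_bounds(1)[of "{x\<in>S. g x \<in> E}" g g' "d / D" "D * d"] E bd injs im der lo up
    by simp
  have 2: "measure lborel E' \<le> D * d * measure lborel {x\<in>S. g x \<in> E'}"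
    using measure_image_bounds(2)[of "{x\<in>S. g x \<in> E'}" g g' "d / D" "D * d"] E' bd injs im der lo up
    by simp
  have "(d / D * measure lborel {x\<in>S. g x \<in> E}) * measure lborel E'
     \<le> measure lborel E * (D * d * measure lborel {x\<in>S. g x \<in> E'})"
    by (rule mult_mono[OF 1 2]) auto
  then have "d * (measure lborel {x\<in>S. g x \<in> E} * measure lborel E')
     \<le> d * (D\<^sup>2 * measure lborel {x\<in>S. g x \<in> E'} * measure lborel E)"
    using D by (simp add: field_simps power2_eq_square)
  then show ?thesis using d by (simp only: mult_le_cancel_left_pos)
qed

lemma inj_on_deriv_nonzero:
  fixes g :: "real \<Rightarrow> real"
  assumes I: "is_interval I" and der: "\<And>x. x \<in> I \<Longrightarrow> (g has_real_derivative g' x) (at x)"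
    and nz: "\<And>x. x \<in> I \<Longrightarrow> g' x \<noteq> 0"
  shows "inj_on g I"
proof (rule linorder_inj_onI)
  fix x y assume xy: "x < y" "x \<in> I" "y \<in> I"
  have sub: "z \<in> I" if "x \<le> z" "z \<le> y" for z
    using I xy that unfolding is_interval_1 by blast
  obtain z where "x < z" "z < y" "g y - g x = (y - x) * g' z"
    using MVT2[OF xy(1), of g g'] der sub by auto
  then show "g x \<noteq> g y" using nz[of z] sub xy by auto
qed auto

lemma is_interval_preimage:
  fixes g :: "real \<Rightarrow> real"
  assumes I: "is_interval I" and cont: "continuous_on I g" and inj: "inj_on g I"
    and J: "is_interval J"
  shows "is_interval {x\<in>I. g x \<in> J}"
  unfolding is_interval_1
proof (intro ballI allI impI)
  fix a b x assume ab: "a \<in> {x\<in>I. g x \<in> J}" "b \<in> {x\<in>I. g x \<in> J}" "a \<le> x \<and> x \<le> b"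
  show "x \<in> {x\<in>I. g x \<in> J}"
  proof (cases "a = x \<or> x = b")
    case False
    then have lt: "a < x" "x < b" using ab by auto
    have sub: "{a..b} \<subseteq> I"
    proof
      fix z assume "z \<in> {a..b}"
      then show "z \<in> I" using I ab unfolding is_interval_1 by (simp, meson)
    qed
    have "(g a < g x \<and> g x < g b) \<or> (g b < g x \<and> g x < g a)"
      by (rule continuous_inj_imp_mono[OF lt])
         (use cont inj sub in \<open>auto intro: continuous_on_subset inj_on_subset\<close>)
    then have "g x \<in> J" using J ab unfolding is_interval_1 by (metis (no_types, lifting) less_imp_le mem_Collect_eq)
    then show ?thesis using sub lt by auto
  qed (use ab in auto)
qed

text \<open>This bounds the accumulated distortion: the \<open>i\<close>-th iterates of two points of a cylinder of order
\<open>m\<close> lie in a common cylinder of order \<open>m - i\<close>.\<close>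
lemma sum_power_diff_le:
  fixes \<tau> :: real
  assumes "0 < \<tau>" "\<tau> < 1"
  shows "(\<Sum>i<m. \<tau> ^ (m - i)) \<le> 1 / (1 - \<tau>)"
proof -
  have "(\<Sum>i<m. \<tau> ^ (m - i)) = (\<Sum>i<m. \<tau> ^ Suc i)"
    by (rule sum.reindex_bij_witness[where i = "\<lambda>i. m - Suc i" and j = "\<lambda>i. m - Suc i"])
       (auto simp: Suc_diff_Suc)
  also have "\<dots> \<le> (\<Sum>i<m. \<tau> ^ i)"
    using assms by (intro sum_mono) (simp add: mult_le_cancel_right1)
  also have "\<dots> = (1 - \<tau> ^ m) / (1 - \<tau>)" using assms by (subst sum_gp_strict) auto
  also have "\<dots> \<le> 1 / (1 - \<tau>)" using assms by (intro divide_right_mono) auto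
  finally show ?thesis .
qed

section \<open>Cylinders of an expanding Markov map\<close>

locale expanding_markov_map =
  fixes f :: "real \<Rightarrow> real" and X :: "real set" and P :: "real set set" and \<mu> :: "real measure"
  assumes X_interval: "is_interval X" and X_bounded: "bounded X"
    and markov: "markov_partition f X P" and images: "big_images f P"
    and expanding: "uniformly_expanding f P"
    and distortion: "bounded_distortion f P"
    and acip: "unique_acip f X \<mu>"
begin

abbreviation L :: "real measure" where "L \<equiv> restrict_space lborel X"
abbreviation cyl :: "nat \<Rightarrow> real set set" where "cyl \<equiv> refined_partition f P"

lemma X_borel [measurable]: "X \<in> sets borel"
  using X_interval real_interval_borel_measurable by blast

lemma sets_L: "A \<in> sets L \<longleftrightarrow> A \<in> sets borel \<and> A \<subseteq> X"
  using sets_restrict_space_iff[of X lborel A] by auto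

lemma space_L: "space L = X" by (simp add: space_restrict_space)

lemma measure_L: "A \<in> sets L \<Longrightarrow> measure L A = measure lborel A"
  by (subst measure_restrict_space) (auto simp: sets_L)

lemma finite_L: "finite_measure L"
proof
  have "emeasure L (space L) = emeasure lborel X"
    by (subst emeasure_restrict_space) (auto simp: space_L)
  also have "\<dots> < \<infinity>" using X_bounded by (rule emeasure_bounded_finite)
  finally show "emeasure L (space L) \<noteq> \<infinity>" by simp
qed

lemma acip_facts: "prob_space \<mu>" "sets \<mu> = sets L" "f \<in> measurable \<mu> \<mu>" "distr \<mu> \<mu> f = \<mu>"
  "absolutely_continuous L \<mu>"
proof -
  have "sets (restrict_space borel X) = sets L" by (simp add: sets_restrict_space)
  then show "prob_space \<mu>" "sets \<mu> = sets L" "f \<in> measurable \<mu> \<mu>" "distr \<mu> \<mu> f = \<mu>"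
    "absolutely_continuous L \<mu>"
    using acip by (auto simp: unique_acip_def acip_def invariant_prob_def)
qed

lemma f_L [measurable]: "f \<in> measurable L L"
  using acip_facts(3) measurable_cong_sets[OF acip_facts(2) acip_facts(2)] by blast

lemma it_L [measurable]: "(f ^^ n) \<in> measurable L L"
  by (rule measurable_compose_n[OF f_L])

lemma it_X: "x \<in> X \<Longrightarrow> (f ^^ n) x \<in> X"
  using measurable_space[OF it_L, of x n] by (simp add: space_L)

lemma vimage_sets: "S \<in> sets L \<Longrightarrow> B \<in> sets L \<Longrightarrow> {x\<in>S. (f ^^ n) x \<in> B} \<in> sets L"
proof -
  assume [measurable]: "S \<in> sets L" "B \<in> sets L"
  have "{x\<in>S. (f ^^ n) x \<in> B} = {x\<in>space L. x \<in> S \<and> (f ^^ n) x \<in> B}"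
    using sets.sets_into_space[OF \<open>S \<in> sets L\<close>] by auto
  moreover have "\<dots> \<in> sets L" by measurable
  ultimately show ?thesis by simp
qed

lemma P_elem:
  assumes "I \<in> P"
  shows "open I" "is_interval I" "I \<noteq> {}" "I \<subseteq> X" "I \<in> sets L" "0 < measure lborel I" "bounded I"
    and "\<And>x. x \<in> I \<Longrightarrow> (f has_real_derivative deriv f x) (at x)" and "continuous_on I f"
proof -
  show *: "open I" "is_interval I" "I \<noteq> {}" "I \<subseteq> X"
    using markov assms unfolding markov_partition_def by auto
  then show "I \<in> sets L" by (simp add: sets_L)
  show b: "bounded I" using * X_bounded bounded_subset by blast
  obtain x e where "x \<in> I" "e > 0" "ball x e \<subseteq> I" using * by (metis all_not_in_conv openE)
  then have "measure lborel (ball x e) \<le> measure lborel I"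
    using * emeasure_bounded_finite[OF b] by (intro measure_mono_fmeasurable) (auto simp: fmeasurable_def)
  moreover have "ball x e = {x - e<..<x + e}" by (rule ball_eq_greaterThanLessThan)
  ultimately show "0 < measure lborel I" using \<open>e > 0\<close> by auto
  have diff: "f differentiable_on I" using markov assms unfolding markov_partition_def by auto
  then show "(f has_real_derivative deriv f x) (at x)" if "x \<in> I" for x
    using that *(1) DERIV_deriv_iff_real_differentiable at_within_open
    unfolding differentiable_on_def by metis
  show "continuous_on I f" using diff by (rule differentiable_imp_continuous_on)
qed

lemma P_disjoint: "I \<in> P \<Longrightarrow> J \<in> P \<Longrightarrow> x \<in> I \<Longrightarrow> x \<in> J \<Longrightarrow> I = J"
  using markov unfolding markov_partition_def disjoint_def by blast

text \<open>The cylinder coded by \<open>Y 0, ..., Y n\<close>. Working with codes rather than with the sets themselves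
makes the induction on the length possible.\<close>
definition word :: "(nat \<Rightarrow> real set) \<Rightarrow> nat \<Rightarrow> real set" where
  "word Y n = {x. \<forall>i\<le>n. (f ^^ i) x \<in> Y i}"

lemma cyl_word: "w \<in> cyl n \<longleftrightarrow> w \<noteq> {} \<and> (\<exists>Y. (\<forall>i\<le>n. Y i \<in> P) \<and> w = word Y n)"
  by (simp add: refined_partition_def word_def)

lemma word_Suc: "word Y (Suc n) = {x\<in>Y 0. f x \<in> word (\<lambda>i. Y (Suc i)) n}"
proof -
  have "(\<forall>i\<le>Suc n. (f ^^ i) x \<in> Y i) \<longleftrightarrow> x \<in> Y 0 \<and> (\<forall>i\<le>n. (f ^^ Suc i) x \<in> Y (Suc i))" for x
    by (metis (no_types, lifting) Suc_le_mono funpow_0 not0_implies_Suc zero_le)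
  then show ?thesis by (auto simp: word_def funpow_swap1)
qed

lemma cyl_0: "cyl 0 = P"
proof -
  have "w \<in> cyl 0 \<longleftrightarrow> w \<in> P" for w
  proof
    assume "w \<in> P"
    then show "w \<in> cyl 0" using P_elem(3) unfolding cyl_word word_def
      by (auto intro!: exI[of _ "\<lambda>_. w"])
  qed (auto simp: cyl_word word_def)
  then show ?thesis by auto
qed

lemma deriv_lower: "\<exists>\<rho>>1. \<exists>C>0. \<forall>n. \<forall>w\<in>cyl n. \<forall>x\<in>w. C * \<rho> ^ Suc n \<le> \<bar>deriv (f ^^ Suc n) x\<bar>"
proof -
  obtain \<rho> C where "\<rho> > 1" "C > 0" and
    *: "\<forall>n\<ge>1. \<forall>x\<in>\<Union>(cyl (n - 1)). \<bar>deriv (f ^^ n) x\<bar> \<ge> C * \<rho> ^ n"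
    using expanding unfolding uniformly_expanding_def by auto
  have "C * \<rho> ^ Suc n \<le> \<bar>deriv (f ^^ Suc n) x\<bar>" if "w \<in> cyl n" "x \<in> w" for n w x
    using *[rule_format, of "Suc n" x] that by auto
  then show ?thesis using \<open>\<rho> > 1\<close> \<open>C > 0\<close> by blast
qed

lemma P_deriv: "\<exists>a>0. \<forall>I\<in>P. \<forall>x\<in>I. a \<le> \<bar>deriv f x\<bar>"
proof -
  obtain \<rho> C where *: "\<rho> > 1" "C > 0" "\<forall>n. \<forall>w\<in>cyl n. \<forall>x\<in>w. C * \<rho> ^ Suc n \<le> \<bar>deriv (f ^^ Suc n) x\<bar>"
    using deriv_lower by auto
  from *(3)[rule_format, of _ 0] show ?thesis using *(1,2)
    by (intro exI[of _ "C * \<rho>"]) (auto simp: cyl_0)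
qed

lemma P_deriv_nz: "I \<in> P \<Longrightarrow> x \<in> I \<Longrightarrow> deriv f x \<noteq> 0"
  using P_deriv by fastforce

lemma P_inj: "I \<in> P \<Longrightarrow> inj_on f I"
  by (rule inj_on_deriv_nonzero[of I f "deriv f"]) (auto simp: P_elem P_deriv_nz)

lemma P_image: 
  assumes "I \<in> P" 
  shows "open (f ` I)" "is_interval (f ` I)" "f ` I \<subseteq> X" "f ` I \<in> sets L" "bounded (f ` I)"
proof -
  show o: "open (f ` I)"
    by (rule injective_into_1d_imp_open_map_UNIV[OF _ P_elem(9) P_inj]) (use assms P_elem in auto)
  show "is_interval (f ` I)"
    using P_elem[OF assms] by (metis connected_continuous_image is_interval_connected_1)
  show s: "f ` I \<subseteq> X" using it_X[of _ 1] P_elem(4)[OF assms] by auto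
  show "f ` I \<in> sets L" using o s by (simp add: sets_L)
  show "bounded (f ` I)" using s X_bounded bounded_subset by blast
qed

text \<open>The Markov property holds a priori only up to null sets. Since \<open>J \<inter> f ` I\<close> is open, it is not null
when it is nonempty, and so \<open>J\<close> has to be one of the elements that fill \<open>f ` I\<close>. Hence no null sets
occur in the description of the branches below.\<close>
lemma full_image:
  assumes "I \<in> P" "J \<in> P" "J \<inter> f ` I \<noteq> {}"
  shows "J \<subseteq> f ` I"
proof -
  obtain Q where Q: "Q \<subseteq> P" "\<Union>Q \<subseteq> f ` I" "f ` I - \<Union>Q \<in> null_sets lborel"
    using markov assms unfolding markov_partition_def by meson
  have "J \<inter> f ` I \<inter> \<Union>Q \<noteq> {}"
  proof
    assume "J \<inter> f ` I \<inter> \<Union>Q = {}"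
    then have "J \<inter> f ` I \<subseteq> f ` I - \<Union>Q" by auto
    moreover have op: "open (J \<inter> f ` I)" using P_elem(1) P_image(1) assms by auto
    ultimately have "J \<inter> f ` I \<in> null_sets lborel"
      using null_sets_subset[OF Q(3)] borel_open by auto
    then have "negligible (J \<inter> f ` I)"
      by (simp add: negligible_iff_null_sets null_sets_completionI)
    then show False using op assms(3) open_not_negligible by blast
  qed
  then obtain x K where "x \<in> J" "K \<in> Q" "x \<in> K" by auto
  then have "J = K" using P_disjoint assms Q by blast
  then show ?thesis using Q \<open>K \<in> Q\<close> by auto
qed

lemma word_structure:
  assumes "\<forall>i\<le>n. Y i \<in> P" "word Y n \<noteq> {}"
  shows "open (word Y n) \<and> is_interval (word Y n) \<and> word Y n \<subseteq> Y 0 \<and>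
    bij_betw (f ^^ n) (word Y n) (Y n)"
  using assms
proof (induction n arbitrary: Y)
  case 0
  then show ?case by (auto simp: word_def P_elem bij_betw_def)
next
  case (Suc n)
  let ?Y = "\<lambda>i. Y (Suc i)"
  have eq: "word Y (Suc n) = {x\<in>Y 0. f x \<in> word ?Y n}" by (rule word_Suc)
  have Y0: "Y 0 \<in> P" and Y1: "Y (Suc 0) \<in> P" and Y': "\<forall>i\<le>n. ?Y i \<in> P" using Suc by auto
  have ne: "word ?Y n \<noteq> {}" using Suc(3) unfolding eq by auto
  from Suc.IH[OF Y' ne] have IH: "open (word ?Y n)" "is_interval (word ?Y n)"
    "word ?Y n \<subseteq> Y (Suc 0)" "bij_betw (f ^^ n) (word ?Y n) (Y (Suc n))" by auto
  have "Y (Suc 0) \<inter> f ` Y 0 \<noteq> {}" using Suc(3) IH(3) unfolding eq by auto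
  then have full: "word ?Y n \<subseteq> f ` Y 0" using full_image[OF Y0 Y1] IH(3) by auto
  have 1: "open (word Y (Suc n))"
    unfolding eq using continuous_open_preimage[OF P_elem(9)[OF Y0] P_elem(1)[OF Y0] IH(1)]
    by (simp add: vimage_def Int_def)
  have 2: "is_interval (word Y (Suc n))"
    unfolding eq by (rule is_interval_preimage[OF P_elem(2)[OF Y0] P_elem(9)[OF Y0] P_inj[OF Y0] IH(2)])
  have "bij_betw f (word Y (Suc n)) (word ?Y n)"
  proof (rule bij_betw_imageI)
    show "inj_on f (word Y (Suc n))" using P_inj[OF Y0] by (rule inj_on_subset) (auto simp: eq)
    show "f ` word Y (Suc n) = word ?Y n" unfolding eq using full by auto
  qed
  from bij_betw_trans[OF this IH(4)] have "bij_betw (f ^^ Suc n) (word Y (Suc n)) (Y (Suc n))"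
    by (simp only: funpow_Suc_right)
  moreover have "word Y (Suc n) \<subseteq> Y 0" by (auto simp: eq)
  ultimately show ?case using 1 2 by (intro conjI)
qed

lemma word_deriv:
  assumes "\<forall>i<n. (f ^^ i) x \<in> \<Union>P"
  shows "((f ^^ n) has_real_derivative (\<Prod>i<n. deriv f ((f ^^ i) x))) (at x)"
  using assms
proof (induction n)
  case 0
  then show ?case by (simp add: id_def)
next
  case (Suc n)
  from Suc have 1: "((f ^^ n) has_real_derivative (\<Prod>i<n. deriv f ((f ^^ i) x))) (at x)" by simp
  obtain I where "I \<in> P" "(f ^^ n) x \<in> I" using Suc(2) by auto
  then have "(f has_real_derivative deriv f ((f ^^ n) x)) (at ((f ^^ n) x))" by (rule P_elem(8))
  from DERIV_chain[OF this 1] show ?case by (simp add: comp_def mult.commute)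
qed

lemma word_iterate:
  assumes "x \<in> word Y n" "i \<le> n"
  shows "(f ^^ i) x \<in> word (\<lambda>j. Y (i + j)) (n - i)"
  unfolding word_def
proof (intro CollectI allI impI)
  fix j assume "j \<le> n - i"
  then have "(f ^^ (j + i)) x \<in> Y (j + i)" using assms unfolding word_def by simp
  moreover have "(f ^^ j) ((f ^^ i) x) = (f ^^ (j + i)) x" by (simp add: funpow_add)
  ultimately show "(f ^^ j) ((f ^^ i) x) \<in> Y (i + j)" by (simp only: add.commute)
qed

lemma word_cyl: "\<forall>i\<le>n. Y i \<in> P \<Longrightarrow> x \<in> word Y n \<Longrightarrow> word Y n \<in> cyl n"
  using cyl_word[of "word Y n" n] by (metis empty_iff)

text \<open>The assumption on the logarithms is applied along the orbit: the \<open>i\<close>-th factors of the two products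
are compared on a cylinder of order \<open>n - i\<close>, and the exponents \<open>C * \<tau> ^ (n - i)\<close> have a bounded sum.\<close>
lemma distortion_const: "\<exists>D\<ge>1. \<forall>n Y x y. (\<forall>i\<le>n. Y i \<in> P) \<longrightarrow> x \<in> word Y n \<longrightarrow> y \<in> word Y n \<longrightarrow>
   \<bar>\<Prod>i<n. deriv f ((f ^^ i) x)\<bar> \<le> D * \<bar>\<Prod>i<n. deriv f ((f ^^ i) y)\<bar> \<and>
   \<bar>deriv f x\<bar> \<le> D * \<bar>deriv f y\<bar>"
proof -
  obtain \<tau> C where \<tau>: "0 < \<tau>" "\<tau> < 1" "C > 0" and
    dist: "\<forall>n. \<forall>w\<in>cyl n. \<forall>x\<in>w. \<forall>y\<in>w. \<bar>ln (\<bar>deriv f x\<bar> / \<bar>deriv f y\<bar>)\<bar> \<le> C * \<tau> ^ n"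
    using distortion unfolding bounded_distortion_def by (elim exE conjE) (rule that)
  have single: "\<bar>deriv f x\<bar> \<le> exp (C * \<tau> ^ n) * \<bar>deriv f y\<bar>"
    if Y: "\<forall>i\<le>n. Y i \<in> P" and xy: "x \<in> word Y n" "y \<in> word Y n" for n Y x y
  proof -
    have "word Y n \<in> cyl n" using Y xy(1) by (rule word_cyl)
    then have "\<bar>ln (\<bar>deriv f x\<bar> / \<bar>deriv f y\<bar>)\<bar> \<le> C * \<tau> ^ n" using dist xy by blast
    moreover have nz: "deriv f x \<noteq> 0" "deriv f y \<noteq> 0"
    proof -
      have "x \<in> Y 0" "y \<in> Y 0" using xy unfolding word_def by fastforce+
      then show "deriv f x \<noteq> 0" "deriv f y \<noteq> 0" using P_deriv_nz Y by blast+
    qed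
    ultimately have "\<bar>deriv f x\<bar> / \<bar>deriv f y\<bar> \<le> exp (C * \<tau> ^ n)"
      by (metis (no_types, opaque_lifting) abs_le_D1 divide_pos_pos exp_le_cancel_iff exp_ln zero_less_abs_iff)
    then show ?thesis using nz by (simp add: field_simps)
  qed
  define D where "D = exp (C * (1 / (1 - \<tau>)))"
  have prod: "\<bar>\<Prod>i<n. deriv f ((f ^^ i) x)\<bar> \<le> D * \<bar>\<Prod>i<n. deriv f ((f ^^ i) y)\<bar>"
    if Y: "\<forall>i\<le>n. Y i \<in> P" and xy: "x \<in> word Y n" "y \<in> word Y n" for n Y x y
  proof -
    have "\<bar>\<Prod>i<n. deriv f ((f ^^ i) x)\<bar> = (\<Prod>i<n. \<bar>deriv f ((f ^^ i) x)\<bar>)" by (rule abs_prod)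
    also have "\<dots> \<le> (\<Prod>i<n. exp (C * \<tau> ^ (n - i)) * \<bar>deriv f ((f ^^ i) y)\<bar>)"
    proof (rule prod_mono)
      fix i assume "i \<in> {..<n}"
      then have "(f ^^ i) x \<in> word (\<lambda>j. Y (i + j)) (n - i)" "(f ^^ i) y \<in> word (\<lambda>j. Y (i + j)) (n - i)"
        "\<forall>j\<le>n - i. Y (i + j) \<in> P"
        using word_iterate xy Y by auto
      from single[OF this(3,1,2)]
      show "0 \<le> \<bar>deriv f ((f ^^ i) x)\<bar> \<and>
        \<bar>deriv f ((f ^^ i) x)\<bar> \<le> exp (C * \<tau> ^ (n - i)) * \<bar>deriv f ((f ^^ i) y)\<bar>" by simp
    qed
    also have "\<dots> = exp (C * (\<Sum>i<n. \<tau> ^ (n - i))) * \<bar>\<Prod>i<n. deriv f ((f ^^ i) y)\<bar>"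
      by (simp add: prod.distrib abs_prod exp_sum[symmetric] sum_distrib_left)
    also have "\<dots> \<le> D * \<bar>\<Prod>i<n. deriv f ((f ^^ i) y)\<bar>"
      unfolding D_def using mult_left_mono[OF sum_power_diff_le[OF \<tau>(1,2), of n], of C] \<tau>(3)
      by (intro mult_right_mono) auto
    finally show ?thesis .
  qed
  have D1: "exp (C * \<tau> ^ n) \<le> D" for n
  proof -
    have "\<tau> ^ n \<le> 1" using \<tau> by (intro power_le_one) auto
    also have "1 \<le> 1 / (1 - \<tau>)" using \<tau> by simp
    finally have "C * \<tau> ^ n \<le> C * (1 / (1 - \<tau>))" using \<tau>(3) by (intro mult_left_mono) auto
    then show ?thesis unfolding D_def by simp
  qed
  have "\<bar>deriv f x\<bar> \<le> D * \<bar>deriv f y\<bar>"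
    if Y: "\<forall>i\<le>n. Y i \<in> P" and xy: "x \<in> word Y n" "y \<in> word Y n" for n Y x y
    using single[OF that] D1[of n] by (meson abs_ge_zero mult_right_mono order_trans)
  moreover have "D \<ge> 1" unfolding D_def using \<tau> by simp
  ultimately show ?thesis using prod by blast
qed

lemma cyl_structure:
  assumes "w \<in> cyl n"
  shows "open w" "is_interval w" "w \<subseteq> X" "w \<in> sets L" "bounded w" "inj_on (f ^^ n) w" "(f ^^ n) ` w \<in> P"
    "0 < measure lborel w" "w \<noteq> {}"
    "\<And>x. x \<in> w \<Longrightarrow> ((f ^^ n) has_real_derivative (\<Prod>i<n. deriv f ((f ^^ i) x))) (at x)"
    "\<And>x. x \<in> w \<Longrightarrow> ((f ^^ Suc n) has_real_derivative deriv (f ^^ Suc n) x) (at x)"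
    "\<And>x. x \<in> w \<Longrightarrow> (\<Prod>i<n. deriv f ((f ^^ i) x)) \<noteq> 0"
proof -
  obtain Y where Y: "\<forall>i\<le>n. Y i \<in> P" "w = word Y n" and ne: "w \<noteq> {}"
    using assms unfolding cyl_word by blast
  have st: "open w" "is_interval w" "w \<subseteq> Y 0" "bij_betw (f ^^ n) w (Y n)"
    using word_structure[OF Y(1)] ne Y(2) by auto
  show "open w" "is_interval w" "w \<noteq> {}" by fact+
  show sub: "w \<subseteq> X" using st Y P_elem(4) by blast
  show "w \<in> sets L" using st sub by (simp add: sets_L)
  show b: "bounded w" using sub X_bounded bounded_subset by blast
  show "inj_on (f ^^ n) w" using st by (simp add: bij_betw_def)
  show "(f ^^ n) ` w \<in> P" using st Y by (simp add: bij_betw_def)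
  obtain x e where "x \<in> w" "e > 0" "ball x e \<subseteq> w" using st ne by (metis all_not_in_conv openE)
  then have "measure lborel (ball x e) \<le> measure lborel w"
    using st emeasure_bounded_finite[OF b] by (intro measure_mono_fmeasurable) (auto simp: fmeasurable_def)
  moreover have "ball x e = {x - e<..<x + e}" by (rule ball_eq_greaterThanLessThan)
  ultimately show "0 < measure lborel w" using \<open>e > 0\<close> by auto
  have *: "(f ^^ i) x \<in> \<Union>P" if "x \<in> w" "i \<le> n" for i x
    using that Y unfolding word_def by blast
  show "((f ^^ n) has_real_derivative (\<Prod>i<n. deriv f ((f ^^ i) x))) (at x)" if "x \<in> w" for x
    by (rule word_deriv) (use * that in auto)
  show "((f ^^ Suc n) has_real_derivative deriv (f ^^ Suc n) x) (at x)" if "x \<in> w" for x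
  proof -
    have "((f ^^ Suc n) has_real_derivative (\<Prod>i<Suc n. deriv f ((f ^^ i) x))) (at x)"
      by (rule word_deriv) (use * that in \<open>auto simp: less_Suc_eq_le\<close>)
    then show ?thesis by (metis DERIV_imp_deriv)
  qed
  show "(\<Prod>i<n. deriv f ((f ^^ i) x)) \<noteq> 0" if "x \<in> w" for x
  proof -
    have "deriv f ((f ^^ i) x) \<noteq> 0" if "i < n" for i
      using *[OF \<open>x \<in> w\<close>, of i] that P_deriv_nz by auto
    then show ?thesis by simp
  qed
qed

text \<open>One constant for both kinds of branches: the \<open>n\<close>-th iterate maps a cylinder of order \<open>n\<close> onto a
partition element, and \<open>f\<close> maps a partition element onto its image, which is a large interval.\<close>
definition distortion_bound :: "real \<Rightarrow> bool" where
  "distortion_bound D \<longleftrightarrow>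
   (\<forall>n. \<forall>w\<in>cyl n. \<forall>E\<in>sets L. \<forall>E'\<in>sets L. E \<subseteq> (f ^^ n) ` w \<longrightarrow> E' \<subseteq> (f ^^ n) ` w \<longrightarrow>
     measure lborel {x\<in>w. (f ^^ n) x \<in> E} * measure lborel E'
       \<le> D * measure lborel {x\<in>w. (f ^^ n) x \<in> E'} * measure lborel E) \<and>
   (\<forall>I\<in>P. \<forall>E\<in>sets L. \<forall>E'\<in>sets L. E \<subseteq> f ` I \<longrightarrow> E' \<subseteq> f ` I \<longrightarrow>
     measure lborel {x\<in>I. f x \<in> E} * measure lborel E'
       \<le> D * measure lborel {x\<in>I. f x \<in> E'} * measure lborel E)"

lemma branch_distortion:
  assumes "distortion_bound D" "w \<in> cyl n" "E \<in> sets L" "E' \<in> sets L"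
    "E \<subseteq> (f ^^ n) ` w" "E' \<subseteq> (f ^^ n) ` w"
  shows "measure lborel {x\<in>w. (f ^^ n) x \<in> E} * measure lborel E'
       \<le> D * measure lborel {x\<in>w. (f ^^ n) x \<in> E'} * measure lborel E"
  using assms unfolding distortion_bound_def by simp

lemma image_distortion:
  assumes "distortion_bound D" "I \<in> P" "E \<in> sets L" "E' \<in> sets L" "E \<subseteq> f ` I" "E' \<subseteq> f ` I"
  shows "measure lborel {x\<in>I. f x \<in> E} * measure lborel E'
       \<le> D * measure lborel {x\<in>I. f x \<in> E'} * measure lborel E"
  using assms unfolding distortion_bound_def by simp

lemma distortion_bound_exists: "\<exists>D\<ge>1. distortion_bound D"
proof -
  obtain D where D: "D \<ge> 1" and dist: "\<And>n Y x y. (\<forall>i\<le>n. Y i \<in> P) \<Longrightarrow> x \<in> word Y n \<Longrightarrow> y \<in> word Y n \<Longrightarrow>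
   \<bar>\<Prod>i<n. deriv f ((f ^^ i) x)\<bar> \<le> D * \<bar>\<Prod>i<n. deriv f ((f ^^ i) y)\<bar> \<and>
   \<bar>deriv f x\<bar> \<le> D * \<bar>deriv f y\<bar>"
    using distortion_const by metis
  have "measure lborel {x\<in>w. (f ^^ n) x \<in> E} * measure lborel E'
       \<le> D\<^sup>2 * measure lborel {x\<in>w. (f ^^ n) x \<in> E'} * measure lborel E"
    if w: "w \<in> cyl n" and E: "E \<in> sets L" "E' \<in> sets L" "E \<subseteq> (f ^^ n) ` w" "E' \<subseteq> (f ^^ n) ` w" for n w E E'
  proof (rule bounded_distortion_cross[where g' = "\<lambda>x. \<Prod>i<n. deriv f ((f ^^ i) x)"])
    note st = cyl_structure[OF w]
    obtain Y where Y: "\<forall>i\<le>n. Y i \<in> P" "w = word Y n" using w unfolding cyl_word by blast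
    show "\<bar>\<Prod>i<n. deriv f ((f ^^ i) x)\<bar> \<le> D * \<bar>\<Prod>i<n. deriv f ((f ^^ i) y)\<bar>"
      if "x \<in> w" "y \<in> w" for x y using dist[OF Y(1)] that Y(2) by blast
    show "bounded ((f ^^ n) ` w)" by (rule P_elem(7)[OF st(7)])
    show "E \<in> sets borel" "E' \<in> sets borel" using E sets_L by auto
    show "{x\<in>w. (f ^^ n) x \<in> E} \<in> sets borel" using vimage_sets[OF st(4) E(1), of n] sets_L by auto
    show "{x\<in>w. (f ^^ n) x \<in> E'} \<in> sets borel" using vimage_sets[OF st(4) E(2), of n] sets_L by auto
  qed (use cyl_structure[OF w] E in auto)
  moreover have "measure lborel {x\<in>I. f x \<in> E} * measure lborel E'
       \<le> D\<^sup>2 * measure lborel {x\<in>I. f x \<in> E'} * measure lborel E"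
    if I: "I \<in> P" and E: "E \<in> sets L" "E' \<in> sets L" "E \<subseteq> f ` I" "E' \<subseteq> f ` I" for I E E'
  proof (rule bounded_distortion_cross[where g' = "deriv f"])
    show "\<bar>deriv f x\<bar> \<le> D * \<bar>deriv f y\<bar>" if "x \<in> I" "y \<in> I" for x y
      using dist[of 0 "\<lambda>_. I" x y] that I by (auto simp: word_def)
    show "E \<in> sets borel" "E' \<in> sets borel" using E sets_L by auto
    show "{x\<in>I. f x \<in> E} \<in> sets borel" using vimage_sets[OF P_elem(5)[OF I] E(1), of 1] sets_L by auto
    show "{x\<in>I. f x \<in> E'} \<in> sets borel" using vimage_sets[OF P_elem(5)[OF I] E(2), of 1] sets_L by auto
  qed (use I E P_elem P_inj P_deriv_nz P_image in auto)
  moreover have "D\<^sup>2 \<ge> 1" using D by (simp add: one_le_power)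
  ultimately show ?thesis unfolding distortion_bound_def by blast
qed

text \<open>One more iterate than the order of the cylinder is used, as this is the one whose derivative
is bounded below by the expansion; its image lies in the bounded set \<open>X\<close>.\<close>
lemma cyl_diam: "\<delta> > 0 \<Longrightarrow> \<exists>N. \<forall>n\<ge>N. \<forall>w\<in>cyl n. \<forall>x\<in>w. \<forall>y\<in>w. \<bar>x - y\<bar> < \<delta>"
proof -
  assume "\<delta> > 0"
  obtain \<rho> C where \<rho>: "\<rho> > 1" "C > 0" and
    low: "\<And>n w x. w \<in> cyl n \<Longrightarrow> x \<in> w \<Longrightarrow> C * \<rho> ^ Suc n \<le> \<bar>deriv (f ^^ Suc n) x\<bar>"
    using deriv_lower by blast
  obtain B where B: "B > 0" "\<And>x. x \<in> X \<Longrightarrow> \<bar>x\<bar> \<le> B" using X_bounded bounded_pos[of X] by auto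
  obtain N where N: "2 * B / (C * \<delta>) < \<rho> ^ N" using real_arch_pow[OF \<rho>(1)] by blast
  have "\<bar>x - y\<bar> < \<delta>" if n: "n \<ge> N" and w: "w \<in> cyl n" and xy: "x \<in> w" "y \<in> w" "x < y" for n w x y
  proof -
    note st = cyl_structure[OF w]
    have sub: "z \<in> w" if "x \<le> z" "z \<le> y" for z
      using st(2) xy that unfolding is_interval_1 by blast
    obtain z where z: "x < z" "z < y"
      "(f ^^ Suc n) y - (f ^^ Suc n) x = (y - x) * deriv (f ^^ Suc n) z"
      using MVT2[OF xy(3), of "f ^^ Suc n" "deriv (f ^^ Suc n)"] st(11) sub by auto
    have "(f ^^ Suc n) y \<in> X" "(f ^^ Suc n) x \<in> X" using it_X st(3) xy by blast+
    then have "\<bar>(f ^^ Suc n) y - (f ^^ Suc n) x\<bar> \<le> 2 * B" using B(2)[of "(f ^^ Suc n) y"] B(2)[of "(f ^^ Suc n) x"] by linarith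
    then have "(y - x) * \<bar>deriv (f ^^ Suc n) z\<bar> \<le> 2 * B" using z(3) xy(3) by (simp add: abs_mult)
    moreover have "(y - x) * (C * \<rho> ^ Suc n) \<le> (y - x) * \<bar>deriv (f ^^ Suc n) z\<bar>"
      using low[OF w sub[of z]] z xy by (intro mult_left_mono) auto
    moreover have "\<rho> ^ N \<le> \<rho> ^ Suc n" using \<rho> n by (intro power_increasing) auto
    then have "2 * B / (C * \<delta>) < \<rho> ^ Suc n" using N by linarith
    then have "2 * B < \<delta> * (C * \<rho> ^ Suc n)" using \<rho> \<open>\<delta> > 0\<close> by (simp add: field_simps)
    ultimately have "(y - x) * (C * \<rho> ^ Suc n) < \<delta> * (C * \<rho> ^ Suc n)" by linarith
    moreover have "C * \<rho> ^ Suc n > 0" using \<rho> by simp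
    ultimately have "y - x < \<delta>" by (simp only: mult_less_cancel_right_pos)
    then show ?thesis using xy by simp
  qed
  then have "\<forall>n\<ge>N. \<forall>w\<in>cyl n. \<forall>x\<in>w. \<forall>y\<in>w. \<bar>x - y\<bar> < \<delta>"
    using \<open>\<delta> > 0\<close> by (metis abs_minus_commute abs_zero diff_self linorder_neqE_linordered_idom)
  then show ?thesis by blast
qed

lemma cyl_Suc:
  assumes I: "I \<in> P" and v: "v \<in> cyl n" and x: "x \<in> I" "f x \<in> v"
  shows "\<exists>w\<in>cyl (Suc n). x \<in> w"
proof -
  obtain Y where Y: "\<forall>i\<le>n. Y i \<in> P" "v = word Y n" using v unfolding cyl_word by blast
  define Z where "Z i = (case i of 0 \<Rightarrow> I | Suc j \<Rightarrow> Y j)" for i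
  have "word Z (Suc n) = {x\<in>I. f x \<in> v}" unfolding word_Suc by (simp add: Z_def Y)
  then have "x \<in> word Z (Suc n)" using x by simp
  moreover have "Z i \<in> P" if "i \<le> Suc n" for i
    using I Y(1) that by (cases i) (simp_all add: Z_def)
  ultimately show ?thesis using word_cyl[of "Suc n" Z x] by blast
qed

lemma cyl_nested: "w \<in> cyl n \<Longrightarrow> m \<le> n \<Longrightarrow> \<exists>w'\<in>cyl m. w \<subseteq> w'"
proof -
  assume w: "w \<in> cyl n" and "m \<le> n"
  obtain Y where Y: "\<forall>i\<le>n. Y i \<in> P" "w = word Y n" and ne: "w \<noteq> {}" using w unfolding cyl_word by blast
  have sub: "w \<subseteq> word Y m" using Y \<open>m \<le> n\<close> unfolding word_def by auto
  obtain x where "x \<in> word Y m" using sub ne by blast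
  then have "word Y m \<in> cyl m" using Y(1) \<open>m \<le> n\<close> by (intro word_cyl[of m Y x]) auto
  then show ?thesis using sub by blast
qed

lemma cyl_unique: "v \<in> cyl n \<Longrightarrow> w \<in> cyl n \<Longrightarrow> x \<in> v \<Longrightarrow> x \<in> w \<Longrightarrow> v = w"
proof -
  assume v: "v \<in> cyl n" and w: "w \<in> cyl n" and x: "x \<in> v" "x \<in> w"
  obtain Y where Y: "\<forall>i\<le>n. Y i \<in> P" "v = word Y n" using v unfolding cyl_word by blast
  obtain Z where Z: "\<forall>i\<le>n. Z i \<in> P" "w = word Z n" using w unfolding cyl_word by blast
  have "Y i = Z i" if "i \<le> n" for i
    using P_disjoint[of "Y i" "Z i" "(f ^^ i) x"] x that Y Z unfolding word_def by auto
  then show "v = w" unfolding Y Z word_def by auto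
qed

lemma cyl_disjoint: "disjoint (cyl n)"
  unfolding disjoint_def using cyl_unique by blast

lemma countable_cyl: "countable (cyl n)"
proof -
  have "countable {l. set l \<subseteq> P \<and> length l = Suc n}"
    using markov by (intro countable_subset[OF _ countable_lists[of P]]) (auto simp: markov_partition_def)
  moreover have "cyl n \<subseteq> (\<lambda>l. word (\<lambda>i. l ! i) n) ` {l. set l \<subseteq> P \<and> length l = Suc n}"
  proof
    fix w assume "w \<in> cyl n"
    then obtain Y where Y: "\<forall>i\<le>n. Y i \<in> P" "w = word Y n" unfolding cyl_word by blast
    have "w = word (\<lambda>i. map Y [0..<Suc n] ! i) n"
      unfolding Y word_def by (auto simp del: upt_Suc simp: less_Suc_eq_le)
    moreover have "set (map Y [0..<Suc n]) \<subseteq> P" "length (map Y [0..<Suc n]) = Suc n"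
      using Y by (auto simp del: upt_Suc simp: less_Suc_eq_le)
    ultimately show "w \<in> (\<lambda>l. word (\<lambda>i. l ! i) n) ` {l. set l \<subseteq> P \<and> length l = Suc n}" by blast
  qed
  ultimately show ?thesis by (meson countable_image countable_subset)
qed

lemma UN_cyl_sets: "\<U> \<subseteq> cyl n \<Longrightarrow> \<Union>\<U> \<in> sets L"
  using countable_cyl[of n] cyl_structure(4) by (intro sets.countable_Union) (auto intro: countable_subset)

lemma null_L: "N \<in> null_sets L \<longleftrightarrow> N \<in> sets L \<and> measure lborel N = 0"
proof -
  interpret finite_measure L by (rule finite_L)
  show ?thesis using measure_L by (auto simp: null_sets_def emeasure_eq_measure)
qed

text \<open>The exceptional set of order \<open>n + 1\<close> consists of points outside all elements and of preimages of the
exceptional set of order \<open>n\<close>. A preimage of a null set under a branch is null by the distortion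
bound.\<close>
lemma cyl_cover: "X - \<Union>(cyl n) \<in> null_sets L"
proof (induction n)
  case 0
  have "X - \<Union>P \<in> null_sets lborel" using markov unfolding markov_partition_def by auto
  then show ?case unfolding null_L sets_L cyl_0 by (auto simp: null_sets_def measure_def)
next
  case (Suc n)
  let ?N = "X - \<Union>(cyl n)"
  obtain a where a: "a > 0" "\<And>I x. I \<in> P \<Longrightarrow> x \<in> I \<Longrightarrow> a \<le> \<bar>deriv f x\<bar>" using P_deriv by blast
  have N: "?N \<in> sets L" "measure lborel ?N = 0" using Suc null_L by auto
  have pre: "{x\<in>I. f x \<in> ?N} \<in> null_sets L" if I: "I \<in> P" for I
  proof -
    let ?E = "{x\<in>I. f x \<in> ?N}"
    have E: "?E \<in> sets L" using vimage_sets[OF P_elem(5)[OF I] N(1), of 1] by simp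
    have fE: "f ` ?E = f ` I \<inter> ?N" by auto
    have fE': "f ` I \<inter> ?N \<in> sets L" using P_image(4)[OF I] N(1) by (rule sets.Int)
    obtain D where D: "D \<ge> 1" and bnd: "distortion_bound D" using distortion_bound_exists by blast
    have "measure lborel {x\<in>I. f x \<in> f ` I \<inter> ?N} * measure lborel (f ` I)
      \<le> D * measure lborel {x\<in>I. f x \<in> f ` I} * measure lborel (f ` I \<inter> ?N)"
      using image_distortion[OF bnd I fE' P_image(4)[OF I]] by simp
    moreover have "{x\<in>I. f x \<in> f ` I \<inter> ?N} = ?E" by auto
    moreover have "measure lborel (f ` I \<inter> ?N) = 0"
    proof -
      have "f ` I \<inter> ?N \<in> null_sets L" by (rule null_sets_subset[OF Suc fE']) auto
      then show ?thesis using null_L by blast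
    qed
    moreover have "measure lborel (f ` I) > 0" using images I unfolding big_images_def by fastforce
    ultimately have "measure lborel ?E \<le> 0" by (simp add: mult_le_0_iff)
    then show ?thesis using E null_L measure_le_0_iff by blast
  qed
  have "(X - \<Union>P) \<union> (\<Union>I\<in>P. {x\<in>I. f x \<in> ?N}) \<in> null_sets L"
  proof (rule null_sets.Un)
    have "X - \<Union>P \<in> null_sets lborel" using markov unfolding markov_partition_def by auto
    then show "X - \<Union>P \<in> null_sets L" unfolding null_L sets_L by (auto simp: null_sets_def measure_def)
    show "(\<Union>I\<in>P. {x\<in>I. f x \<in> ?N}) \<in> null_sets L"
      using markov pre by (intro null_sets_UN') (auto simp: markov_partition_def)
  qed
  moreover have "X - \<Union>(cyl (Suc n)) \<in> sets L"
    using UN_cyl_sets[of "cyl (Suc n)" "Suc n"] sets.compl_sets[of _ L] by (auto simp: space_L)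
  moreover have "X - \<Union>(cyl (Suc n)) \<subseteq> (X - \<Union>P) \<union> (\<Union>I\<in>P. {x\<in>I. f x \<in> ?N})"
  proof
    fix x assume x: "x \<in> X - \<Union>(cyl (Suc n))"
    have "f x \<in> X" using it_X[of x 1] x by simp
    show "x \<in> (X - \<Union>P) \<union> (\<Union>I\<in>P. {x\<in>I. f x \<in> ?N})"
    proof (cases "x \<in> \<Union>P")
      case True
      then obtain I where I: "I \<in> P" "x \<in> I" by auto
      have "f x \<notin> v" if "v \<in> cyl n" for v using cyl_Suc[OF I(1) that I(2)] x by auto
      then show ?thesis using I \<open>f x \<in> X\<close> by auto
    qed (use x in auto)
  qed
  ultimately show ?case by (rule null_sets_subset)
qed

lemma AE_cyl: "AE x in L. x \<in> \<Union>(cyl n)"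
  by (rule AE_I'[OF cyl_cover[of n]]) (auto simp: space_L)

section \<open>From cylinders to the invariant measure\<close>
lemma space_mu: "space \<mu> = X"
  using sets_eq_imp_space_eq[OF acip_facts(2)] by (simp add: space_L)

lemma mu_preimage: "A \<in> sets L \<Longrightarrow> measure \<mu> {x\<in>X. (f ^^ n) x \<in> A} = measure \<mu> A"
proof -
  interpret prob_space \<mu> by (rule acip_facts(1))
  show "A \<in> sets L \<Longrightarrow> measure \<mu> {x\<in>X. (f ^^ n) x \<in> A} = measure \<mu> A"
    using measure_iterate_preimage[OF acip_facts(3,4)] acip_facts(2) by (simp add: space_mu)
qed

lemma preimage_sets: "A \<in> sets L \<Longrightarrow> {x\<in>X. (f ^^ n) x \<in> A} \<in> sets L"
  by (rule vimage_sets) (auto simp: sets_L)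

text \<open>Approximate \<open>E\<close> from outside by an open set \<open>U\<close>. Because the diameters of the cylinders shrink, almost
every point of \<open>U\<close> eventually lies in a cylinder that is contained in \<open>U\<close>, so \<open>U\<close> is exhausted by
unions of cylinders, on which the inequality can be summed. Approximation from one side
is enough, for the passage from \<open>U\<close> back to \<open>E\<close> costs at most \<open>\<eta>\<close> times the measure of the
difference.\<close>
lemma domination_set:
  assumes B: "\<And>n. B n \<in> sets L" and C: "\<And>n. C n \<in> sets L" and "0 \<le> \<eta>"
    and le: "\<And>n w. w \<in> cyl n \<Longrightarrow> measure lborel (w \<inter> B n) \<le> \<eta> * measure lborel (w \<inter> C n)"
    and E: "E \<in> sets L" and "\<epsilon> > 0"
  shows "\<forall>\<^sub>F n in sequentially. measure L (E \<inter> B n) \<le> \<eta> * measure L (E \<inter> C n) + \<epsilon>"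
proof -
  interpret L: finite_measure L by (rule finite_L)
  define \<delta> where "\<delta> = \<epsilon> / (2 * (\<eta> + 1))"
  have \<delta>: "\<delta> > 0" "\<eta> * \<delta> \<le> \<epsilon> / 2" using \<open>\<epsilon> > 0\<close> \<open>0 \<le> \<eta>\<close> by (auto simp: \<delta>_def field_simps)
  have Eb: "E \<in> sets borel" "E \<subseteq> X" using E sets_L by auto
  obtain U where U: "open U" "E \<subseteq> U" "emeasure lborel (U - E) < \<delta>"
    using outer_regular_lborel[OF Eb(1) \<delta>(1)] .
  define V where "V = U \<inter> X"
  have V: "V \<in> sets L" "E \<subseteq> V" using U Eb by (auto simp: V_def sets_L)
  have VE: "measure L (V - E) \<le> \<delta>"
  proof -
    have VE_sets: "V - E \<in> sets L" using V(1) E by (rule sets.Diff)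
    have "emeasure L (V - E) = emeasure lborel (V - E)"
      using VE_sets by (intro emeasure_restrict_space) (auto simp: V_def)
    also have "\<dots> \<le> emeasure lborel (U - E)"
      using U(1) Eb by (intro emeasure_mono) (auto simp: V_def)
    finally have "emeasure L (V - E) \<le> ennreal \<delta>" using U(3) by simp
    then show ?thesis using \<delta>(1) by (simp add: L.emeasure_eq_measure)
  qed
  define W where "W n = \<Union>{w\<in>cyl n. w \<subseteq> U}" for n
  have W: "W n \<in> sets L" for n unfolding W_def by (rule UN_cyl_sets[of _ n]) auto
  \<comment> \<open>The points of \<open>V\<close> that, for some order \<open>n \<ge> N\<close>, lie in no cylinder contained in \<open>U\<close>.\<close>
  define T where "T N = (\<Union>n\<in>{N..}. V - W n)" for N
  have T: "T N \<in> sets L" for N unfolding T_def using V W by (intro sets.countable_UN') auto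
  have "decseq T" unfolding decseq_def T_def by (intro allI impI UN_mono) auto
  then have lim: "(\<lambda>N. measure L (T N)) \<longlonglongrightarrow> measure L (\<Inter>N. T N)"
    using T by (intro L.finite_Lim_measure_decseq) auto
  have "(\<Union>n. X - \<Union>(cyl n)) \<in> null_sets L" by (rule null_sets_UN) (rule cyl_cover)
  moreover have "(\<Inter>N. T N) \<subseteq> (\<Union>n. X - \<Union>(cyl n))"
  proof
    fix x assume x: "x \<in> (\<Inter>N. T N)"
    then have "x \<in> T 0" by blast
    then have xV: "x \<in> U" "x \<in> X" by (auto simp: T_def V_def)
    obtain e where e: "e > 0" "ball x e \<subseteq> U" using U(1) xV(1) openE by blast
    obtain N where N: "\<forall>n\<ge>N. \<forall>w\<in>cyl n. \<forall>x\<in>w. \<forall>y\<in>w. \<bar>x - y\<bar> < e" using cyl_diam[OF e(1)] by blast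
    have "x \<in> T N" using x by blast
    then obtain n where n: "n \<ge> N" "x \<notin> W n" unfolding T_def by auto
    have "x \<notin> \<Union>(cyl n)"
    proof
      assume "x \<in> \<Union>(cyl n)"
      then obtain w where w: "w \<in> cyl n" "x \<in> w" by auto
      have "w \<subseteq> ball x e"
      proof
        fix y assume "y \<in> w"
        then have "\<bar>x - y\<bar> < e" using N n(1) w by blast
        then show "y \<in> ball x e" by (simp add: dist_real_def)
      qed
      then show False using n(2) w e(2) unfolding W_def by auto
    qed
    then show "x \<in> (\<Union>n. X - \<Union>(cyl n))" using xV by auto
  qed
  moreover have "(\<Inter>N. T N) \<in> sets L" using T by (intro sets.countable_INT) auto
  ultimately have "(\<Inter>N. T N) \<in> null_sets L" by (meson null_sets_subset)
  then have "measure L (\<Inter>N. T N) = 0" by (rule measure_eq_0_null_sets)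
  then have "\<forall>\<^sub>F n in sequentially. measure L (T n) < \<epsilon> / 2"
    using order_tendstoD(2)[OF lim, of "\<epsilon> / 2"] \<open>\<epsilon> > 0\<close> by simp
  then show ?thesis
  proof eventually_elim
    case (elim n)
    have sets: "W n \<inter> B n \<in> sets L" "W n \<inter> C n \<in> sets L" "V - W n \<in> sets L" "E \<inter> C n \<in> sets L" "V - E \<in> sets L"
      using W B C V E by auto
    have cells: "measure L {x\<in>space L. x \<in> W n \<inter> B n} \<le> \<eta> * measure L {x\<in>space L. x \<in> W n \<inter> C n}"
    proof (rule L.measure_le_by_cells[OF countable_cyl cyl_disjoint cyl_structure(4) AE_cyl])
      note [measurable] = W[of n] B[of n] C[of n]
      show "Measurable.pred L (\<lambda>x. x \<in> W n \<inter> B n)" "Measurable.pred L (\<lambda>x. x \<in> W n \<inter> C n)"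
        by measurable
      fix w assume w: "w \<in> cyl n"
      note ws = cyl_structure(4)[OF w]
      show "measure L {x\<in>w. x \<in> W n \<inter> B n} \<le> \<eta> * measure L {x\<in>w. x \<in> W n \<inter> C n}"
      proof (cases "w \<subseteq> U")
        case True
        then have "{x\<in>w. x \<in> W n \<inter> S} = w \<inter> S" for S using w unfolding W_def by blast
        then show ?thesis using le[OF w] measure_L[of "w \<inter> B n"] measure_L[of "w \<inter> C n"] ws B C by simp
      next
        case False
        have "x \<notin> W n" if x: "x \<in> w" for x
        proof
          assume "x \<in> W n"
          then obtain v where "v \<in> cyl n" "v \<subseteq> U" "x \<in> v" unfolding W_def by blast
          then show False using cyl_unique[OF w _ x] False by blast
        qed
        then have "{x\<in>w. x \<in> W n \<inter> S} = {}" for S by auto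
        then show ?thesis by (simp only: measure_empty)
      qed
    qed (assumption | rule \<open>0 \<le> \<eta>\<close>)+
    have eqs: "{x\<in>space L. x \<in> W n \<inter> B n} = W n \<inter> B n" "{x\<in>space L. x \<in> W n \<inter> C n} = W n \<inter> C n"
      using sets(1,2)[THEN sets.sets_into_space] by auto
    have "measure L (E \<inter> B n) \<le> measure L ((W n \<inter> B n) \<union> (V - W n))"
      using sets V(2) by (intro L.finite_measure_mono) auto
    also have "\<dots> \<le> measure L (W n \<inter> B n) + measure L (V - W n)"
      by (rule measure_Un_le[OF sets(1,3)])
    also have "measure L (V - W n) \<le> measure L (T n)"
      using T by (intro L.finite_measure_mono) (auto simp: T_def)
    also have "measure L (W n \<inter> B n) \<le> \<eta> * measure L (W n \<inter> C n)"
      using cells unfolding eqs .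
    also have "measure L (W n \<inter> C n) \<le> measure L ((E \<inter> C n) \<union> (V - E))"
    proof (rule L.finite_measure_mono)
      show "W n \<inter> C n \<subseteq> (E \<inter> C n) \<union> (V - E)"
        using cyl_structure(3) unfolding W_def V_def by blast
    qed (use sets in auto)
    also have "\<dots> \<le> measure L (E \<inter> C n) + measure L (V - E)"
      by (rule measure_Un_le[OF sets(4,5)])
    finally have "measure L (E \<inter> B n) \<le> \<eta> * (measure L (E \<inter> C n) + measure L (V - E)) + measure L (T n)"
      using \<open>0 \<le> \<eta>\<close> by (simp add: mult_left_mono)
    also have "\<dots> \<le> \<eta> * (measure L (E \<inter> C n) + \<delta>) + \<epsilon> / 2"
      using VE elim \<open>0 \<le> \<eta>\<close> by (intro add_mono mult_left_mono) auto
    finally show ?case using \<delta>(2) by (simp add: algebra_simps)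
  qed
qed

text \<open>The property is stable under all the steps by which a nonnegative integrable function is built from
indicators; in the limit of an increasing sequence the remainder has small integral, uniformly in
\<open>n\<close>.\<close>
lemma domination_fun:
  assumes B: "\<And>n. B n \<in> sets L" and C: "\<And>n. C n \<in> sets L" and "0 \<le> \<eta>"
    and le: "\<And>n w. w \<in> cyl n \<Longrightarrow> measure lborel (w \<inter> B n) \<le> \<eta> * measure lborel (w \<inter> C n)"
    and h: "h \<in> borel_measurable L" 
  shows "(\<integral>\<^sup>+x. h x \<partial>L) < \<infinity> \<Longrightarrow> \<epsilon> > 0 \<Longrightarrow> \<forall>\<^sub>F n in sequentially. (\<integral>\<^sup>+x. h x * indicator (B n) x \<partial>L)
      \<le> ennreal \<eta> * (\<integral>\<^sup>+x. h x * indicator (C n) x \<partial>L) + ennreal \<epsilon>"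
  using h
proof (induction h arbitrary: \<epsilon> rule: borel_measurable_induct)
  case (cong g h)
  have eq: "(\<integral>\<^sup>+x. g x * F x \<partial>L) = (\<integral>\<^sup>+x. h x * F x \<partial>L)" for F
    using cong(3) by (intro nn_integral_cong) simp
  have "(\<integral>\<^sup>+x. h x \<partial>L) < \<infinity>" using cong(5) eq[of "\<lambda>_. 1"] by simp
  from cong(4)[OF this cong(6)] show ?case unfolding eq .
next
  case (set E)
  interpret L: finite_measure L by (rule finite_L)
  have eq: "(\<integral>\<^sup>+x. indicator E x * indicator S x \<partial>L) = ennreal (measure L (E \<inter> S))" if "S \<in> sets L" for S
  proof -
    have "(\<integral>\<^sup>+x. indicator E x * indicator S x \<partial>L) = (\<integral>\<^sup>+x. indicator (E \<inter> S) x \<partial>L)"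
      by (intro nn_integral_cong) (simp add: indicator_inter_arith)
    also have "\<dots> = emeasure L (E \<inter> S)" using set(1) that by (intro nn_integral_indicator) auto
    finally show ?thesis by (simp add: L.emeasure_eq_measure)
  qed
  have "\<forall>\<^sub>F n in sequentially. measure L (E \<inter> B n) \<le> \<eta> * measure L (E \<inter> C n) + \<epsilon>"
    by (rule domination_set[OF B C \<open>0 \<le> \<eta>\<close> _ set(1) set(3)]) (rule le)
  then show ?case
  proof eventually_elim
    case (elim n)
    have "ennreal (measure L (E \<inter> B n)) \<le> ennreal (\<eta> * measure L (E \<inter> C n) + \<epsilon>)"
      using elim by (rule ennreal_leI)
    also have "\<dots> = ennreal \<eta> * ennreal (measure L (E \<inter> C n)) + ennreal \<epsilon>"
      using \<open>0 \<le> \<eta>\<close> set(3) by (simp add: ennreal_mult)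
    finally show ?case unfolding eq[OF B] eq[OF C] .
  qed
next
  case (mult u c)
  show ?case
  proof (cases "c = 0")
    case False
    define r where "r = enn2real c"
    have c: "c = ennreal r" using mult(1) by (simp add: r_def)
    have r: "r > 0" using False c by (metis ennreal_eq_0_iff not_le)
    have m: "(\<integral>\<^sup>+x. c * u x * F x \<partial>L) = c * (\<integral>\<^sup>+x. u x * F x \<partial>L)" if "F \<in> borel_measurable L" for F
    proof -
      have "(\<lambda>x. u x * F x) \<in> borel_measurable L" by (rule borel_measurable_times_ennreal[OF mult(2) that])
      from nn_integral_cmult[OF this, of c] show ?thesis by (simp add: mult.assoc)
    qed
    have "c * (\<integral>\<^sup>+x. u x \<partial>L) < \<infinity>" using mult(5) m[of "\<lambda>_. 1"] by simp
    then have fin: "(\<integral>\<^sup>+x. u x \<partial>L) < \<infinity>" using False by (auto simp: ennreal_mult_less_top)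
    have "\<epsilon> / r > 0" using mult(6) r by simp
    from mult(4)[OF fin this] show ?thesis
    proof eventually_elim
      case (elim n)
      have "c * (\<integral>\<^sup>+x. u x * indicator (B n) x \<partial>L)
         \<le> c * (ennreal \<eta> * (\<integral>\<^sup>+x. u x * indicator (C n) x \<partial>L) + ennreal (\<epsilon> / r))"
        using elim by (rule mult_left_mono) simp
      also have "\<dots> = ennreal \<eta> * (c * (\<integral>\<^sup>+x. u x * indicator (C n) x \<partial>L)) + c * ennreal (\<epsilon> / r)"
        by (simp add: algebra_simps)
      also have "c * ennreal (\<epsilon> / r) = ennreal \<epsilon>" using r mult(6) by (simp add: c ennreal_mult'[symmetric])
      finally show ?case using B[of n] C[of n] by (subst (1 2) m) auto
    qed
  qed simp
next
  case (add u v)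
  have split: "(\<integral>\<^sup>+x. (v x + u x) * F x \<partial>L) = (\<integral>\<^sup>+x. v x * F x \<partial>L) + (\<integral>\<^sup>+x. u x * F x \<partial>L)"
    if "F \<in> borel_measurable L" for F
  proof -
    have "(\<lambda>x. v x * F x) \<in> borel_measurable L" "(\<lambda>x. u x * F x) \<in> borel_measurable L"
      by (rule borel_measurable_times_ennreal[OF add.hyps(3) that] borel_measurable_times_ennreal[OF add.hyps(1) that])+
    from nn_integral_add[OF this] show ?thesis by (simp add: distrib_right)
  qed
  have fin: "(\<integral>\<^sup>+x. v x \<partial>L) < \<infinity>" "(\<integral>\<^sup>+x. u x \<partial>L) < \<infinity>"
    using add.prems(1) split[of "\<lambda>_. 1"] by (auto simp: less_top)
  have e: "\<epsilon> / 2 > 0" using add.prems(2) by simp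
  from add.IH(1)[OF fin(2) e] add.IH(2)[OF fin(1) e] show ?case
  proof eventually_elim
    case (elim n)
    have ind: "indicator (B n) \<in> borel_measurable L" "indicator (C n) \<in> borel_measurable L" using B C by auto
    have half: "ennreal (\<epsilon> / 2) + ennreal (\<epsilon> / 2) = ennreal \<epsilon>"
      using add.prems(2) by (subst ennreal_plus[symmetric]) auto
    have "a * b + e + (a * c + e) = a * (b + c) + (e + e)" for a b c e :: ennreal
      by (simp add: algebra_simps)
    then show ?case unfolding split[OF ind(1)] split[OF ind(2)]
      using add_mono[OF elim(2,1)] by (simp only: half)
  qed
next
  case (seq U)
  define u where "u x = (SUP i. U i x)" for x
  have u_eq: "(SUP i. U i) = u" by (rule ext) (simp add: u_def image_comp)
  note fin = seq.prems(1)[unfolded u_eq]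
  have u_meas: "u \<in> borel_measurable L"
    unfolding u_def[abs_def] using seq.hyps(1) by (intro borel_measurable_SUP) auto
  have le_u: "U i x \<le> u x" for i x unfolding u_def by (rule SUP_upper) simp
  have lim: "(\<integral>\<^sup>+x. u x \<partial>L) = (SUP i. (\<integral>\<^sup>+x. U i x \<partial>L))"
    unfolding u_def by (rule nn_integral_monotone_convergence_SUP[OF seq.hyps(3) seq.hyps(1)])
  have e: "\<epsilon> / 2 > 0" using seq.prems(2) by simp
  obtain i where i: "(\<integral>\<^sup>+x. u x \<partial>L) < (\<integral>\<^sup>+x. U i x \<partial>L) + ennreal (\<epsilon> / 2)"
  proof -
    have "\<exists>i\<in>UNIV. (\<integral>\<^sup>+x. u x \<partial>L) < (\<integral>\<^sup>+x. U i x \<partial>L) + ennreal (\<epsilon> / 2)"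
      using fin e by (intro SUP_approx_ennreal[OF _ _ lim]) auto
    then show ?thesis using that by blast
  qed
  have finU: "(\<integral>\<^sup>+x. U i x \<partial>L) < \<infinity>"
    using fin le_u by (meson nn_integral_mono order.strict_trans1)
  have diff: "(\<integral>\<^sup>+x. (u x - U i x) \<partial>L) \<le> ennreal (\<epsilon> / 2)"
  proof -
    have "(\<integral>\<^sup>+x. (u x - U i x) \<partial>L) = (\<integral>\<^sup>+x. u x \<partial>L) - (\<integral>\<^sup>+x. U i x \<partial>L)"
      using u_meas seq.hyps(1)[of i] finU le_u by (intro nn_integral_diff) auto
    also have "\<dots> \<le> ennreal (\<epsilon> / 2)"
      using i finU fin by (auto simp: ennreal_minus_le_iff add.commute less_imp_le)
    finally show ?thesis .
  qed
  from seq.IH[OF finU e] show ?case unfolding u_eq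
  proof eventually_elim
    case (elim n)
    have ms: "(\<lambda>x. U i x * indicator (B n) x) \<in> borel_measurable L" "(\<lambda>x. u x - U i x) \<in> borel_measurable L"
      by (rule borel_measurable_times_ennreal[OF seq.hyps(1) borel_measurable_indicator[OF B]]
          borel_measurable_minus_ennreal[OF u_meas seq.hyps(1)])+
    have "(\<integral>\<^sup>+x. u x * indicator (B n) x \<partial>L) \<le> (\<integral>\<^sup>+x. U i x * indicator (B n) x + (u x - U i x) \<partial>L)"
    proof (rule nn_integral_mono)
      fix x
      have "u x = U i x + (u x - U i x)" using le_u[of i x] by (simp add: add_diff_inverse_ennreal)
      then show "u x * indicator (B n) x \<le> U i x * indicator (B n) x + (u x - U i x)"
        by (cases "x \<in> B n") auto
    qed
    also have "\<dots> = (\<integral>\<^sup>+x. U i x * indicator (B n) x \<partial>L) + (\<integral>\<^sup>+x. (u x - U i x) \<partial>L)"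
      by (rule nn_integral_add[OF ms])
    also have "\<dots> \<le> (ennreal \<eta> * (\<integral>\<^sup>+x. U i x * indicator (C n) x \<partial>L) + ennreal (\<epsilon> / 2)) + ennreal (\<epsilon> / 2)"
      by (rule add_mono[OF elim diff])
    also have "\<dots> = ennreal \<eta> * (\<integral>\<^sup>+x. U i x * indicator (C n) x \<partial>L) + ennreal \<epsilon>"
      using seq.prems(2) by (simp add: add.assoc ennreal_plus[symmetric] del: ennreal_plus)
    also have "\<dots> \<le> ennreal \<eta> * (\<integral>\<^sup>+x. u x * indicator (C n) x \<partial>L) + ennreal \<epsilon>"
      by (intro add_right_mono mult_left_mono nn_integral_mono mult_right_mono le_u) auto
    finally show ?case .
  qed
qed

text \<open>Absolutely continuous measures inherit cylinderwise inequalities in the limit, with the same \<open>\<eta>\<close>. Since the measure of a preimage does not depend on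
\<open>n\<close>, such a limit statement yields inequalities for \<open>\<mu>\<close> itself.\<close>
lemma domination:
  assumes B: "\<And>n. B n \<in> sets L" and C: "\<And>n. C n \<in> sets L" and "0 \<le> \<eta>"
    and le: "\<And>n w. w \<in> cyl n \<Longrightarrow> measure lborel (w \<inter> B n) \<le> \<eta> * measure lborel (w \<inter> C n)"
    and "\<epsilon> > 0"
  shows "\<forall>\<^sub>F n in sequentially. measure \<mu> (B n) \<le> \<eta> * measure \<mu> (C n) + \<epsilon>"
proof -
  interpret L: finite_measure L by (rule finite_L)
  interpret mu: prob_space \<mu> by (rule acip_facts(1))
  define h where "h = RN_deriv L \<mu>"
  have h: "h \<in> borel_measurable L" "density L h = \<mu>"
    unfolding h_def using L.density_RN_deriv[OF acip_facts(5) acip_facts(2)] by auto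
  have em: "(\<integral>\<^sup>+x. h x * indicator S x \<partial>L) = ennreal (measure \<mu> S)" if "S \<in> sets L" for S
    using emeasure_density[OF h(1) that] h(2) by (simp add: mu.emeasure_eq_measure)
  have "X \<in> sets L" by (simp add: sets_L)
  have "(\<integral>\<^sup>+x. h x \<partial>L) = (\<integral>\<^sup>+x. h x * indicator X x \<partial>L)"
    by (intro nn_integral_cong) (simp add: space_L)
  also have "\<dots> < \<infinity>" unfolding em[OF \<open>X \<in> sets L\<close>] by simp
  finally have fin: "(\<integral>\<^sup>+x. h x \<partial>L) < \<infinity>" .
  have "\<forall>\<^sub>F n in sequentially. (\<integral>\<^sup>+x. h x * indicator (B n) x \<partial>L)
      \<le> ennreal \<eta> * (\<integral>\<^sup>+x. h x * indicator (C n) x \<partial>L) + ennreal \<epsilon>"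
    by (rule domination_fun[OF B C \<open>0 \<le> \<eta>\<close> _ h(1) fin \<open>\<epsilon> > 0\<close>]) (rule le)
  then show ?thesis
  proof eventually_elim
    case (elim n)
    have "ennreal \<eta> * ennreal (measure \<mu> (C n)) + ennreal \<epsilon> = ennreal (\<eta> * measure \<mu> (C n) + \<epsilon>)"
      using \<open>0 \<le> \<eta>\<close> \<open>\<epsilon> > 0\<close> by (simp add: ennreal_mult)
    then have "ennreal (measure \<mu> (B n)) \<le> ennreal (\<eta> * measure \<mu> (C n) + \<epsilon>)"
      using elim unfolding em[OF B] em[OF C] by (simp only:)
    moreover have "0 \<le> \<eta> * measure \<mu> (C n) + \<epsilon>" using \<open>0 \<le> \<eta>\<close> \<open>\<epsilon> > 0\<close> by simp
    ultimately show ?case by (simp only: ennreal_le_iff)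
  qed
qed

text \<open>In every cylinder of order \<open>n\<close> the preimage of \<open>A\<close> under \<open>f^(n+1)\<close> has relative size at most a constant
times the Lebesgue measure of \<open>A\<close>, because \<open>f^(n+1)\<close> maps the cylinder onto a set of size at least
\<open>c0\<close>. Now let \<open>n\<close> tend to infinity.\<close>
lemma mu_le_lebesgue: "\<exists>C>0. \<forall>A\<in>sets L. measure \<mu> A \<le> C * measure lborel A"
proof -
  interpret L: finite_measure L by (rule finite_L)
  interpret mu: prob_space \<mu> by (rule acip_facts(1))
  obtain D where D: "D \<ge> 1" and bnd: "distortion_bound D" using distortion_bound_exists by blast
  obtain c0 where c0: "c0 > 0" "\<forall>I\<in>P. measure lborel (f ` I) > c0"
    using images unfolding big_images_def by auto
  have "measure \<mu> A \<le> D\<^sup>2 / c0 * measure lborel A" if A: "A \<in> sets L" for A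
  proof (rule field_le_epsilon)
    fix e :: real assume "e > 0"
    let ?B = "\<lambda>n. {x\<in>X. (f ^^ Suc n) x \<in> A}"
    have XL: "X \<in> sets L" by (simp add: sets_L)
    have "\<forall>\<^sub>F n in sequentially. measure \<mu> (?B n) \<le> (D\<^sup>2 / c0 * measure lborel A) * measure \<mu> X + e"
    proof (rule domination[where B = ?B])
      show "?B n \<in> sets L" for n by (rule preimage_sets[OF A])
      show "0 \<le> D\<^sup>2 / c0 * measure lborel A" using c0 by simp
      fix n w assume w: "w \<in> cyl n"
      note st = cyl_structure[OF w]
      let ?I = "(f ^^ n) ` w"
      note I = P_elem[OF st(7)]
      define E where "E = {x\<in>?I. f x \<in> A}"
      have E: "E \<in> sets L" "E \<subseteq> ?I" unfolding E_def using vimage_sets[OF I(5) A, of 1] by auto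
      have "f ` ?I \<inter> A \<in> sets L" using P_image(4)[OF st(7)] A by (rule sets.Int)
      from image_distortion[OF bnd st(7) this P_image(4)[OF st(7)]]
      have "measure lborel {x\<in>?I. f x \<in> f ` ?I \<inter> A} * measure lborel (f ` ?I)
        \<le> D * measure lborel {x\<in>?I. f x \<in> f ` ?I} * measure lborel (f ` ?I \<inter> A)" by simp
      moreover have "{x\<in>?I. f x \<in> f ` ?I \<inter> A} = E" "{x\<in>?I. f x \<in> f ` ?I} = ?I" unfolding E_def by auto
      ultimately have 1: "measure lborel E * measure lborel (f ` ?I)
        \<le> D * measure lborel ?I * measure lborel (f ` ?I \<inter> A)" by (simp only:)
      have "measure lborel (f ` ?I \<inter> A) \<le> measure lborel A"
        using measure_L[OF A] measure_L[OF \<open>f ` ?I \<inter> A \<in> sets L\<close>] L.finite_measure_mono[of "f ` ?I \<inter> A" A] A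
        by simp
      then have "D * measure lborel ?I * measure lborel (f ` ?I \<inter> A) \<le> D * measure lborel ?I * measure lborel A"
        using D by (intro mult_left_mono) auto
      moreover have "measure lborel E * c0 \<le> measure lborel E * measure lborel (f ` ?I)"
        using c0 st(7) by (intro mult_left_mono) (auto intro: less_imp_le)
      ultimately have 2: "measure lborel E * c0 \<le> D * measure lborel ?I * measure lborel A"
        using 1 by linarith
      have "measure lborel {x\<in>w. (f ^^ n) x \<in> E} * measure lborel ?I
        \<le> D * measure lborel {x\<in>w. (f ^^ n) x \<in> ?I} * measure lborel E"
        by (rule branch_distortion[OF bnd]) (use w E I in auto)
      moreover have "{x\<in>w. (f ^^ n) x \<in> E} = w \<inter> ?B n" "{x\<in>w. (f ^^ n) x \<in> ?I} = w"
        unfolding E_def using st(3) by auto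
      ultimately have "measure lborel (w \<inter> ?B n) * measure lborel ?I \<le> D * measure lborel w * measure lborel E"
        by (simp only:)
      then have "c0 * (measure lborel (w \<inter> ?B n) * measure lborel ?I) \<le> c0 * (D * measure lborel w * measure lborel E)"
        using c0 by simp
      also have "\<dots> = D * measure lborel w * (measure lborel E * c0)" by simp
      also have "\<dots> \<le> D * measure lborel w * (D * measure lborel ?I * measure lborel A)"
        using 2 D by (intro mult_left_mono) auto
      finally have "(c0 * measure lborel (w \<inter> ?B n)) * measure lborel ?I
         \<le> (D\<^sup>2 * measure lborel A * measure lborel w) * measure lborel ?I"
        by (simp add: power2_eq_square mult_ac)
      then have "c0 * measure lborel (w \<inter> ?B n) \<le> D\<^sup>2 * measure lborel A * measure lborel w"
        using I(6) by (simp only: mult_le_cancel_right_pos)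
      moreover have "w \<inter> X = w" using st(3) by auto
      ultimately show "measure lborel (w \<inter> ?B n) \<le> D\<^sup>2 / c0 * measure lborel A * measure lborel (w \<inter> X)"
        using c0 by (simp add: field_simps)
    qed (use XL \<open>e > 0\<close> in auto)
    then obtain n where "measure \<mu> (?B n) \<le> (D\<^sup>2 / c0 * measure lborel A) * measure \<mu> X + e"
      by (meson eventually_happens' sequentially_bot)
    moreover have "measure \<mu> (?B n) = measure \<mu> A" by (rule mu_preimage[OF A])
    moreover have "measure \<mu> X = 1" using mu.prob_space by (simp add: space_mu)
    ultimately show "measure \<mu> A \<le> D\<^sup>2 / c0 * measure lborel A + e" by simp
  qed
  moreover have "D\<^sup>2 / c0 > 0" using D c0 by simp
  ultimately show ?thesis by blast
qed

text \<open>Elements of measure zero may be transient, and nothing is known about how orbits leave them. The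
renewal argument is therefore run on the charged elements, which form a closed system.\<close>
definition charged :: "real set set" where "charged = {I\<in>P. measure \<mu> I > 0}"

lemma charged_P: "I \<in> charged \<Longrightarrow> I \<in> P" by (simp add: charged_def)

text \<open>A fixed fraction of each cylinder ending in \<open>I\<close> is mapped to \<open>A\<close> in one more step. Hence, in the limit,
the measure of \<open>A\<close> is at least a positive multiple of the measure of \<open>I\<close>.\<close>
lemma charged_image_positive:
  assumes I: "I \<in> charged" and A: "A \<in> sets L" "A \<subseteq> f ` I" "measure lborel A > 0"
  shows "measure \<mu> A > 0"
proof (rule ccontr)
  interpret L: finite_measure L by (rule finite_L)
  interpret mu: prob_space \<mu> by (rule acip_facts(1))
  assume "\<not> measure \<mu> A > 0"
  then have A0: "measure \<mu> A = 0" using zero_less_measure_iff by blast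
  have IP: "I \<in> P" using I charged_P by auto
  note Ip = P_elem[OF IP]
  obtain D where D: "D \<ge> 1" and bnd: "distortion_bound D" using distortion_bound_exists by blast
  define E where "E = {x\<in>I. f x \<in> A}"
  have E: "E \<in> sets L" "E \<subseteq> I" unfolding E_def using vimage_sets[OF Ip(5) A(1), of 1] by auto
  have "measure lborel {x\<in>I. f x \<in> f ` I} * measure lborel A
        \<le> D * measure lborel {x\<in>I. f x \<in> A} * measure lborel (f ` I)"
    by (rule image_distortion[OF bnd]) (use IP A P_image(4) in auto)
  moreover have "{x\<in>I. f x \<in> f ` I} = I" by auto
  ultimately have "measure lborel I * measure lborel A \<le> D * measure lborel E * measure lborel (f ` I)"
    unfolding E_def by (simp only:)
  moreover have "measure lborel I * measure lborel A > 0" using Ip(6) A(3) by simp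
  ultimately have "measure lborel E \<noteq> 0" by auto
  then have Epos: "measure lborel E > 0" using zero_less_measure_iff by blast
  \<comment> \<open>The inverse of the fraction of a cylinder ending in \<open>I\<close> that passes through \<open>E\<close>.\<close>
  define \<eta> where "\<eta> = D * measure lborel I / measure lborel E"
  have \<eta>: "\<eta> \<ge> 0" using D Epos by (simp add: \<eta>_def)
  let ?B = "\<lambda>n. {x\<in>X. (f ^^ n) x \<in> I}" and ?C = "\<lambda>n. {x\<in>X. (f ^^ n) x \<in> E}"
  have "\<forall>\<^sub>F n in sequentially. measure \<mu> (?B n) \<le> \<eta> * measure \<mu> (?C n) + measure \<mu> I / 2"
  proof (rule domination[OF preimage_sets[OF Ip(5)] preimage_sets[OF E(1)] \<eta>])
    fix n w assume w: "w \<in> cyl n"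
    note st = cyl_structure[OF w]
    show "measure lborel (w \<inter> ?B n) \<le> \<eta> * measure lborel (w \<inter> ?C n)"
    proof (cases "(f ^^ n) ` w = I")
      case True
      have "measure lborel {x\<in>w. (f ^^ n) x \<in> I} * measure lborel E
        \<le> D * measure lborel {x\<in>w. (f ^^ n) x \<in> E} * measure lborel I"
        by (rule branch_distortion[OF bnd]) (use w True E Ip in auto)
      moreover have "{x\<in>w. (f ^^ n) x \<in> S} = w \<inter> {x\<in>X. (f ^^ n) x \<in> S}" for S using st(3) by auto
      ultimately have "measure lborel (w \<inter> ?B n) * measure lborel E
        \<le> D * measure lborel (w \<inter> ?C n) * measure lborel I" by (simp only:)
      then show ?thesis unfolding \<eta>_def using Epos by (simp add: field_simps)
    next
      case False
      have "w \<inter> ?B n = {}"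
      proof (rule ccontr)
        assume "w \<inter> ?B n \<noteq> {}"
        then obtain x where "x \<in> w" "(f ^^ n) x \<in> I" by auto
        then have "(f ^^ n) ` w = I" using P_disjoint[OF st(7) IP] by blast
        then show False using False by simp
      qed
      then show ?thesis using \<eta> by (simp only: measure_empty) simp
    qed
  qed (use I in \<open>simp add: charged_def\<close>)
  then obtain n where "measure \<mu> (?B n) \<le> \<eta> * measure \<mu> (?C n) + measure \<mu> I / 2"
    by (meson eventually_happens' sequentially_bot)
  moreover have "measure \<mu> (?B n) = measure \<mu> I" by (rule mu_preimage[OF Ip(5)])
  moreover have "measure \<mu> (?C n) = measure \<mu> E" by (rule mu_preimage[OF E(1)])
  moreover have "measure \<mu> E \<le> measure \<mu> {x\<in>X. (f ^^ 1) x \<in> A}"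
    using preimage_sets[OF A(1), of 1] Ip(4) acip_facts(2)
    by (intro mu.finite_measure_mono) (auto simp: E_def)
  moreover have "measure \<mu> {x\<in>X. (f ^^ 1) x \<in> A} = 0" using mu_preimage[OF A(1), of 1] A0 by simp
  moreover have "measure \<mu> E \<ge> 0" by simp
  ultimately have "measure \<mu> I \<le> measure \<mu> I / 2" by (smt (verit) mult_eq_0_iff)
  then show False using I by (simp add: charged_def)
qed

text \<open>The set of points that visit \<open>K\<close> infinitely often is strictly invariant, and it has positive measure
by invariance of \<open>\<mu>\<close>. Conditioning \<open>\<mu>\<close> on it produces an absolutely continuous invariant
probability, which equals \<open>\<mu>\<close> by uniqueness; so the set has full measure.\<close>
lemma AE_returns:
  assumes K: "K \<in> sets L" "measure \<mu> K > 0"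
  shows "AE x in \<mu>. \<exists>k\<ge>1. (f ^^ k) x \<in> K"
proof -
  interpret mu: prob_space \<mu> by (rule acip_facts(1))
  note acip_facts(2)[measurable_cong]
  define T where "T N = {x\<in>X. \<exists>n\<ge>N. (f ^^ n) x \<in> K}" for N
  define B where "B = {x\<in>X. \<forall>N. \<exists>n\<ge>N. (f ^^ n) x \<in> K}"
  have T: "T N \<in> sets L" for N
  proof -
    have "T N = (\<Union>n\<in>{N..}. {x\<in>X. (f ^^ n) x \<in> K})" unfolding T_def by auto
    also have "\<dots> \<in> sets L" using preimage_sets[OF K(1)] by (intro sets.countable_UN') auto
    finally show ?thesis .
  qed
  have BT: "B = (\<Inter>N. T N)" unfolding B_def T_def by auto
  have B: "B \<in> sets L" unfolding BT using T by (intro sets.countable_INT) auto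
  have "decseq T" unfolding decseq_def T_def by (auto intro: order_trans)
  then have lim: "(\<lambda>N. measure \<mu> (T N)) \<longlonglongrightarrow> measure \<mu> B"
    unfolding BT using T acip_facts(2) by (intro mu.finite_Lim_measure_decseq) auto
  have "measure \<mu> K \<le> measure \<mu> (T N)" for N
  proof -
    have "measure \<mu> K = measure \<mu> {x\<in>X. (f ^^ N) x \<in> K}" by (rule mu_preimage[OF K(1), symmetric])
    also have "\<dots> \<le> measure \<mu> (T N)"
    proof (rule mu.finite_measure_mono)
      show "{x\<in>X. (f ^^ N) x \<in> K} \<subseteq> T N"
      proof
        fix x assume x: "x \<in> {x\<in>X. (f ^^ N) x \<in> K}"
        then have "N \<le> N \<and> (f ^^ N) x \<in> K" by simp
        then have "\<exists>n\<ge>N. (f ^^ n) x \<in> K" by (rule exI)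
        then show "x \<in> T N" using x by (simp add: T_def)
      qed
    qed (use T acip_facts(2) in auto)
    finally show ?thesis .
  qed
  then have "measure \<mu> K \<le> measure \<mu> B" by (intro LIMSEQ_le_const[OF lim]) auto
  then have Bpos: "measure \<mu> B > 0" using K(2) by linarith
  have Binv: "f x \<in> B \<longleftrightarrow> x \<in> B" if x: "x \<in> X" for x
  proof -
    have fx: "f x \<in> X" using it_X[OF x, of 1] by simp
    have sh: "(f ^^ n) (f x) = (f ^^ Suc n) x" for n by (simp only: funpow_Suc_right comp_apply)
    show ?thesis
    proof
      assume "f x \<in> B"
      then have fB: "\<forall>N. \<exists>n\<ge>N. (f ^^ Suc n) x \<in> K" by (simp add: B_def sh del: funpow.simps)
      have "\<exists>n\<ge>N. (f ^^ n) x \<in> K" for N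
      proof -
        obtain n where "n \<ge> N" "(f ^^ Suc n) x \<in> K" using fB by (elim allE exE conjE) (rule that)
        then show ?thesis by (intro exI[of _ "Suc n"]) simp
      qed
      then show "x \<in> B" using x by (simp add: B_def)
    next
      assume "x \<in> B"
      then have xB: "\<forall>N. \<exists>n\<ge>N. (f ^^ n) x \<in> K" by (simp add: B_def)
      have "\<exists>n\<ge>N. (f ^^ Suc n) x \<in> K" for N
      proof -
        obtain n where n: "n \<ge> Suc N" "(f ^^ n) x \<in> K"
          using xB[rule_format, of "Suc N"] by (elim exE conjE) (rule that)
        obtain m where "n = Suc m" using n(1) by (cases n) simp_all
        then show ?thesis using n by (intro exI[of _ m]) simp
      qed
      then show "f x \<in> B" using fx by (simp add: B_def sh del: funpow.simps)
    qed
  qed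
  define \<nu> where "\<nu> = uniform_measure \<mu> B"
  have Bem: "emeasure \<mu> B \<noteq> 0" "emeasure \<mu> B \<noteq> \<infinity>" using Bpos by (simp_all add: mu.emeasure_eq_measure)
  have sets_nu: "sets \<nu> = sets \<mu>" by (simp add: \<nu>_def)
  have f_mu: "f \<in> measurable \<mu> \<mu>" by (rule acip_facts(3))
  have f_nu: "f \<in> measurable \<nu> \<nu>" using f_mu measurable_cong_sets[OF sets_nu sets_nu] by blast
  have em_nu: "emeasure \<nu> A = emeasure \<mu> (B \<inter> A) / emeasure \<mu> B" if "A \<in> sets \<mu>" for A
    unfolding \<nu>_def using B that acip_facts(2) by (intro emeasure_uniform_measure) auto
  have "distr \<nu> \<nu> f = \<nu>"
  proof (rule measure_eqI)
    fix A assume "A \<in> sets (distr \<nu> \<nu> f)"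
    then have A: "A \<in> sets \<mu>" by (simp add: sets_nu)
    have pre: "f -` A \<inter> X \<in> sets \<mu>" using measurable_sets[OF f_mu A] by (simp add: space_mu)
    have BA: "B \<inter> A \<in> sets \<mu>" using B A acip_facts(2) by auto
    have "emeasure (distr \<nu> \<nu> f) A = emeasure \<nu> (f -` A \<inter> X)"
      using f_nu A by (subst emeasure_distr) (auto simp: sets_nu \<nu>_def space_mu)
    also have "\<dots> = emeasure \<mu> (B \<inter> (f -` A \<inter> X)) / emeasure \<mu> B" by (rule em_nu[OF pre])
    also have "B \<inter> (f -` A \<inter> X) = f -` (B \<inter> A) \<inter> space \<mu>"
      using Binv unfolding space_mu by auto
    also have "emeasure \<mu> (f -` (B \<inter> A) \<inter> space \<mu>) = emeasure (distr \<mu> \<mu> f) (B \<inter> A)"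
      by (rule emeasure_distr[OF f_mu BA, symmetric])
    also have "distr \<mu> \<mu> f = \<mu>" by (rule acip_facts(4))
    also have "emeasure \<mu> (B \<inter> A) / emeasure \<mu> B = emeasure \<nu> A" by (rule em_nu[OF A, symmetric])
    finally show "emeasure (distr \<nu> \<nu> f) A = emeasure \<nu> A" .
  qed simp
  moreover have "prob_space \<nu>" unfolding \<nu>_def using Bem by (intro prob_space_uniform_measure)
  moreover have "absolutely_continuous L \<nu>"
    unfolding absolutely_continuous_def
  proof
    fix A assume A: "A \<in> null_sets L"
    then have A\<mu>: "A \<in> null_sets \<mu>" using acip_facts(5) unfolding absolutely_continuous_def by blast
    then have "B \<inter> A \<in> null_sets \<mu>" using B acip_facts(2) by (intro null_set_Int1) auto
    then show "A \<in> null_sets \<nu>"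
      using em_nu[of A] A\<mu> by (auto simp: null_sets_def sets_nu)
  qed
  moreover have "sets \<nu> = sets (restrict_space borel X)"
    unfolding sets_nu acip_facts(2) by (simp add: sets_restrict_space)
  ultimately have "acip f X \<nu>" using f_nu unfolding acip_def invariant_prob_def by blast
  then have "\<nu> = \<mu>" using acip unfolding unique_acip_def by blast
  then have "emeasure \<mu> B = emeasure \<mu> (B \<inter> B) / emeasure \<mu> B" using em_nu[of B] B acip_facts(2) by simp
  also have "\<dots> = 1" using Bem by (simp only: Int_absorb) (rule ennreal_divide_self, simp_all add: less_top[symmetric])
  finally have "measure \<mu> B = 1" by (simp add: mu.emeasure_eq_measure)
  then have "AE x in \<mu>. x \<in> B" using B acip_facts(2) by (simp add: mu.prob_eq_1)
  then show ?thesis by eventually_elim (auto simp: B_def)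
qed

text \<open>An element inside the image of a charged one is open, hence of positive Lebesgue measure, hence
charged.\<close>
lemma charged_forward:
  assumes I: "I \<in> charged" and J: "J \<in> P" "J \<inter> f ` I \<noteq> {}"
  shows "J \<in> charged" "J \<subseteq> f ` I"
proof -
  show "J \<subseteq> f ` I" by (rule full_image[OF charged_P[OF I] J])
  from charged_image_positive[OF I P_elem(5)[OF J(1)] this P_elem(6)[OF J(1)]] J(1)
  show "J \<in> charged" by (simp add: charged_def)
qed

lemma charged_iterate:
  assumes "x \<in> \<Union>charged" "\<forall>i\<le>m. (f ^^ i) x \<in> \<Union>P" "i \<le> m"
  shows "(f ^^ i) x \<in> \<Union>charged"
  using assms(3)
proof (induction i)
  case (Suc i)
  then obtain I where I: "I \<in> charged" "(f ^^ i) x \<in> I" by auto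
  obtain J where J: "J \<in> P" "(f ^^ Suc i) x \<in> J" using assms(2) Suc(2) by blast
  have "J \<inter> f ` I \<noteq> {}" using I J by auto
  then show ?case using charged_forward(1)[OF I(1) J(1)] J(2) by blast
qed (use assms in simp)

lemma cyl_charged:
  assumes w: "w \<in> cyl n" and x: "x \<in> w" "x \<in> \<Union>charged"
  shows "w \<subseteq> \<Union>charged"
proof -
  obtain I where I: "I \<in> P" "w \<subseteq> I" using cyl_nested[OF w, of 0] cyl_0 by auto
  obtain J where J: "J \<in> charged" "x \<in> J" using x by auto
  have "I = J" using P_disjoint[OF I(1) charged_P[OF J(1)]] I x J by blast
  then show ?thesis using I J by auto
qed

lemma cyl_image_charged:
  assumes w: "w \<in> cyl n" "w \<subseteq> \<Union>charged"
  shows "(f ^^ n) ` w \<in> charged"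
proof -
  obtain Y where Y: "\<forall>i\<le>n. Y i \<in> P" "w = word Y n" using w unfolding cyl_word by blast
  obtain x where x: "x \<in> w" using cyl_structure(9)[OF w(1)] by auto
  have "\<forall>i\<le>n. (f ^^ i) x \<in> \<Union>P" using x Y unfolding word_def by blast
  from charged_iterate[OF _ this, of n] obtain J where J: "J \<in> charged" "(f ^^ n) x \<in> J"
    using x w(2) by auto
  have "(f ^^ n) ` w = J"
    using P_disjoint[OF cyl_structure(7)[OF w(1)] charged_P[OF J(1)]] x J by blast
  then show ?thesis using J by simp
qed

lemma AE_charged: "AE x in \<mu>. x \<in> \<Union>charged"
proof -
  interpret mu: prob_space \<mu> by (rule acip_facts(1))
  have "X - \<Union>P \<in> null_sets L" using cyl_cover[of 0] cyl_0 by simp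
  then have 1: "X - \<Union>P \<in> null_sets \<mu>" using acip_facts(5) unfolding absolutely_continuous_def by blast
  have 2: "(\<Union>I\<in>P - charged. I) \<in> null_sets \<mu>"
  proof (rule null_sets_UN')
    show "countable (P - charged)" using markov unfolding markov_partition_def by auto
    show "I \<in> null_sets \<mu>" if "I \<in> P - charged" for I
    proof -
      have "measure \<mu> I = 0" using that zero_less_measure_iff unfolding charged_def by blast
      then show ?thesis using P_elem(5)[of I] that acip_facts(2)
        by (auto simp: null_sets_def mu.emeasure_eq_measure)
    qed
  qed
  show ?thesis by (rule AE_I'[OF null_sets.Un[OF 1 2]]) (auto simp: space_mu)
qed

lemma charged_nonempty: "\<exists>K. K \<in> charged"
proof -
  interpret mu: prob_space \<mu> by (rule acip_facts(1))
  show ?thesis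
  proof (rule ccontr)
    assume "\<not> ?thesis"
    then have none: "x \<notin> \<Union>charged" for x by auto
    have "AE x in \<mu>. False" using AE_charged by eventually_elim (use none in simp)
    then show False by simp
  qed
qed

section \<open>Uniform access to a core element\<close>

text \<open>Divide the line into intervals of length \<open>\<delta>\<close>, with \<open>\<delta>\<close> small compared with the images and \<open>n\<close> so
large that cylinders of order \<open>n\<close> are shorter than \<open>\<delta>\<close>. Each image contains three consecutive
grid intervals, hence every cylinder that meets the middle one. For each of the finitely many grid
intervals that occur, one such cylinder is selected; lying in the image of a charged element, it is
charged.\<close>
lemma finite_cylinders_in_images:
  "\<exists>\<W> n. finite \<W> \<and> \<W> \<subseteq> cyl n \<and> (\<forall>w\<in>\<W>. measure \<mu> w > 0) \<and>
    (\<forall>I\<in>charged. \<exists>w\<in>\<W>. w \<subseteq> f ` I)"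
proof -
  obtain c0 where c0: "c0 > 0" "\<And>I. I \<in> P \<Longrightarrow> measure lborel (f ` I) > c0"
    using images unfolding big_images_def by auto
  \<comment> \<open>A set in which all distances are below \<open>4 * \<delta>\<close> has measure at most \<open>8 * \<delta>\<close>.\<close>
  define \<delta> where "\<delta> = c0 / 8"
  have \<delta>: "\<delta> > 0" using c0 by (simp add: \<delta>_def)
  obtain n where diam: "\<And>w x y. w \<in> cyl n \<Longrightarrow> x \<in> w \<Longrightarrow> y \<in> w \<Longrightarrow> \<bar>x - y\<bar> < \<delta>"
    using cyl_diam[OF \<delta>] by (meson order_refl)
  define G where "G z = {real_of_int z * \<delta><..<(real_of_int z + 1) * \<delta>}" for z
  define good where "good z w \<longleftrightarrow> w \<in> cyl n \<and> (\<exists>I\<in>charged. w \<subseteq> f ` I) \<and> w \<inter> G z \<noteq> {}" for z w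
  define Z where "Z = {z. \<exists>w. good z w}"
  define W where "W z = (SOME w. good z w)" for z
  have W: "good z (W z)" if "z \<in> Z" for z using that unfolding Z_def W_def by (auto intro: someI_ex)
  obtain B where B: "B > 0" "\<And>x. x \<in> X \<Longrightarrow> \<bar>x\<bar> \<le> B" using X_bounded bounded_pos[of X] by auto
  have "Z \<subseteq> {- \<lceil>B / \<delta>\<rceil> - 1..\<lceil>B / \<delta>\<rceil>}"
  proof
    fix z assume "z \<in> Z"
    then obtain w x where "w \<in> cyl n" "x \<in> w" and xG: "x \<in> G z" unfolding Z_def good_def by blast
    then have "x \<in> X" using cyl_structure(3) by blast
    then have "- B \<le> x" "x \<le> B" using B(2)[of x] by auto
    then have "real_of_int z * \<delta> < B" "- B < (real_of_int z + 1) * \<delta>" using xG unfolding G_def by auto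
    then have "real_of_int z < B / \<delta>" "- (B / \<delta>) < real_of_int z + 1" using \<delta> by (simp_all add: field_simps)
    then show "z \<in> {- \<lceil>B / \<delta>\<rceil> - 1..\<lceil>B / \<delta>\<rceil>}" by (simp, linarith)
  qed
  then have finZ: "finite Z" by (rule finite_subset) simp
  show ?thesis
  proof (intro exI[of _ "W ` Z"] exI[of _ n] conjI ballI)
    show "finite (W ` Z)" using finZ by simp
    show "W ` Z \<subseteq> cyl n" using W unfolding good_def by blast
    show "measure \<mu> w > 0" if "w \<in> W ` Z" for w
    proof -
      have "w \<in> cyl n" "\<exists>I\<in>charged. w \<subseteq> f ` I" using that W unfolding good_def by blast+
      then obtain I where I: "I \<in> charged" "w \<subseteq> f ` I" by blast
      show ?thesis using charged_image_positive[OF I(1) _ I(2)] cyl_structure(4,8)[OF \<open>w \<in> cyl n\<close>] by blast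
    qed
    fix I assume I: "I \<in> charged"
    let ?J = "f ` I"
    note IP = charged_P[OF I]
    note J = P_image[OF IP]
    have "\<exists>x\<in>?J. \<exists>y\<in>?J. x + 4 * \<delta> \<le> y"
    proof (rule ccontr)
      assume *: "\<not> ?thesis"
      obtain x where x: "x \<in> ?J" using P_elem(3)[OF IP] by auto
      have "?J \<subseteq> {x - 4 * \<delta>..x + 4 * \<delta>}"
      proof
        fix y assume "y \<in> ?J"
        then have "\<not> x + 4 * \<delta> \<le> y" "\<not> y + 4 * \<delta> \<le> x" using * x by blast+
        then show "y \<in> {x - 4 * \<delta>..x + 4 * \<delta>}" by auto
      qed
      then have "measure lborel ?J \<le> measure lborel {x - 4 * \<delta>..x + 4 * \<delta>}"
        using J(4) sets_L emeasure_bounded_finite[OF bounded_closed_interval, of "x - 4 * \<delta>" "x + 4 * \<delta>"]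
        by (intro measure_mono_fmeasurable) (auto simp: fmeasurable_def)
      also have "\<dots> = c0" using \<delta> by (simp add: \<delta>_def)
      finally show False using c0(2)[OF IP] by simp
    qed
    then obtain x y where xy: "x \<in> ?J" "y \<in> ?J" "x + 4 * \<delta> \<le> y" by blast
    have sub: "u \<in> ?J" if "x \<le> u" "u \<le> y" for u
      using J(2) xy that unfolding is_interval_1 by blast
    \<comment> \<open>The neighbours \<open>z - 1\<close> and \<open>z + 1\<close> of this grid interval still lie between \<open>x\<close> and \<open>x + 4 * \<delta>\<close>.\<close>
    define z where "z = \<lfloor>x / \<delta>\<rfloor> + 2"
    have "of_int \<lfloor>x / \<delta>\<rfloor> \<le> x / \<delta>" "x / \<delta> < of_int \<lfloor>x / \<delta>\<rfloor> + 1" by linarith+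
    then have "of_int \<lfloor>x / \<delta>\<rfloor> * \<delta> \<le> x" "x < (of_int \<lfloor>x / \<delta>\<rfloor> + 1) * \<delta>"
      using \<delta> by (simp_all only: pos_le_divide_eq pos_divide_less_eq)
    then have zx: "x < (real_of_int z - 1) * \<delta>" "(real_of_int z - 2) * \<delta> \<le> x"
    proof -
      have "real_of_int z - 1 = of_int \<lfloor>x / \<delta>\<rfloor> + 1" "real_of_int z - 2 = of_int \<lfloor>x / \<delta>\<rfloor>"
        by (simp_all add: z_def)
      then show "x < (real_of_int z - 1) * \<delta>" "(real_of_int z - 2) * \<delta> \<le> x"
        using \<open>of_int \<lfloor>x / \<delta>\<rfloor> * \<delta> \<le> x\<close> \<open>x < (of_int \<lfloor>x / \<delta>\<rfloor> + 1) * \<delta>\<close> by (simp_all only:)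
    qed
    have near: "w \<subseteq> ?J" if w: "w \<in> cyl n" "w \<inter> G z \<noteq> {}" for w
    proof
      fix v assume v: "v \<in> w"
      obtain u where u: "u \<in> w" "u \<in> G z" using w by auto
      have "\<bar>v - u\<bar> < \<delta>" using diam[OF w(1) v u(1)] .
      then show "v \<in> ?J" using u(2) zx xy(3) by (intro sub) (auto simp: G_def algebra_simps)
    qed
    have "\<exists>w\<in>cyl n. w \<inter> G z \<noteq> {}"
    proof (rule ccontr)
      assume no: "\<not> ?thesis"
      have "G z \<subseteq> ?J" using zx xy(3) sub by (auto simp: G_def algebra_simps)
      then have GX: "G z \<subseteq> X" using J(3) by auto
      have "G z \<subseteq> X - \<Union>(cyl n)" using GX no by blast
      moreover have "G z \<in> sets L" using GX by (simp add: sets_L G_def)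
      ultimately have "G z \<in> null_sets L" using null_sets_subset[OF cyl_cover] by blast
      then have "measure lborel (G z) = 0" using null_L by blast
      moreover have "measure lborel (G z) = \<delta>" using \<delta> by (simp add: G_def algebra_simps)
      ultimately show False using \<delta> by simp
    qed
    then obtain w where w: "w \<in> cyl n" "w \<inter> G z \<noteq> {}" by blast
    then have "good z w" using near[OF w] I unfolding good_def by blast
    then have zZ: "z \<in> Z" unfolding Z_def by blast
    from W[OF zZ] have "W z \<in> cyl n" "W z \<inter> G z \<noteq> {}" unfolding good_def by simp_all
    then have "W z \<subseteq> ?J" by (rule near)
    then show "\<exists>w\<in>W ` Z. w \<subseteq> ?J" using zZ by blast
  qed
qed

text \<open>By recurrence each of the finitely many cylinders above contains a set of positive Lebesgue measure
from which \<open>K\<close> is reached in bounded time. Every image of a charged element contains one of these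
sets, and by bounded distortion a fixed fraction of the element is mapped into it.\<close>
lemma uniform_hitting:
  assumes K: "K \<in> charged"
  shows "\<exists>N\<ge>1. \<exists>c>0. \<forall>I\<in>charged.
    c * measure lborel I \<le> measure lborel {x\<in>I. \<exists>k\<in>{1..N}. (f ^^ k) x \<in> K}"
proof -
  interpret L: finite_measure L by (rule finite_L)
  interpret mu: prob_space \<mu> by (rule acip_facts(1))
  obtain \<W> n where \<W>: "finite \<W>" "\<W> \<subseteq> cyl n" "\<forall>w\<in>\<W>. measure \<mu> w > 0"
    "\<forall>I\<in>charged. \<exists>w\<in>\<W>. w \<subseteq> f ` I"
    using finite_cylinders_in_images by (elim exE conjE) (rule that)
  have KL: "K \<in> sets L" using P_elem(5) charged_P[OF K] by blast
  define H where "H w N = {x\<in>w. \<exists>k\<in>{1..N}. (f ^^ k) x \<in> K}" for w and N :: nat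
  have H: "H w N \<in> sets L" if "w \<in> sets L" for w N
  proof -
    have "H w N = (\<Union>k\<in>{1..N}. {x\<in>w. (f ^^ k) x \<in> K})" unfolding H_def by auto
    also have "\<dots> \<in> sets L" using vimage_sets[OF that KL] by (intro sets.finite_UN) auto
    finally show ?thesis .
  qed
  have Hmono: "measure lborel (H w M) \<le> measure lborel (H w N)" if "w \<in> sets L" "M \<le> N" for w M N
  proof -
    have "{1..M} \<subseteq> {1..N}" using that(2) by auto
    then have "H w M \<subseteq> H w N" unfolding H_def by blast
    from L.finite_measure_mono[OF this H[OF that(1)]] show ?thesis
      by (simp only: measure_L[OF H[OF that(1)]])
  qed
  obtain C where C: "C > 0" "\<forall>A\<in>sets L. measure \<mu> A \<le> C * measure lborel A"
    using mu_le_lebesgue by blast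
  have ex: "\<exists>N. measure lborel (H w N) > 0" if w: "w \<in> \<W>" for w
  proof (rule ccontr)
    assume *: "\<not> ?thesis"
    have wL: "w \<in> sets L" using w \<W>(2) cyl_structure(4) by blast
    have "H w N \<in> null_sets \<mu>" for N
    proof -
      have "measure lborel (H w N) = 0" using * zero_less_measure_iff by blast
      then have "measure \<mu> (H w N) \<le> 0" using C(2) H[OF wL, of N] by fastforce
      then show ?thesis using H[OF wL, of N] acip_facts(2) measure_le_0_iff
        by (auto simp: null_sets_def mu.emeasure_eq_measure)
    qed
    then have "(\<Union>N. H w N) \<in> null_sets \<mu>" by (rule null_sets_UN)
    then have "AE x in \<mu>. x \<notin> (\<Union>N. H w N)" by (rule AE_not_in)
    moreover have "AE x in \<mu>. \<exists>k\<ge>1. (f ^^ k) x \<in> K"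
      by (rule AE_returns[OF KL]) (use K in \<open>simp add: charged_def\<close>)
    ultimately have "AE x in \<mu>. x \<notin> w"
    proof eventually_elim
      case (elim x)
      obtain k where "k \<ge> 1" "(f ^^ k) x \<in> K" using elim(2) by blast
      then have "x \<in> H w k" if "x \<in> w" using that unfolding H_def by auto
      then show ?case using elim(1) by blast
    qed
    then have "measure \<mu> w = 0" using wL acip_facts(2) by (simp add: mu.prob_eq_0)
    then show False using \<W>(3) w by auto
  qed
  define N1 where "N1 w = (SOME N. measure lborel (H w N) > 0)" for w
  have N1: "measure lborel (H w (N1 w)) > 0" if "w \<in> \<W>" for w
    unfolding N1_def using ex[OF that] by (rule someI_ex)
  define N where "N = Max (insert 0 (N1 ` \<W>))"
  have NN: "N1 w \<le> N" if "w \<in> \<W>" for w unfolding N_def using \<W>(1) that by (intro Max_ge) auto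
  define c1 where "c1 = Min (insert 1 ((\<lambda>w. measure lborel (H w N)) ` \<W>))"
  have "measure lborel (H w N) > 0" if "w \<in> \<W>" for w
    using N1[OF that] Hmono[OF _ NN[OF that]] that \<W>(2) cyl_structure(4) by (meson less_le_trans subsetD)
  then have c1: "c1 > 0" unfolding c1_def using \<W>(1) by (subst Min_gr_iff) auto
  have c1_le: "c1 \<le> measure lborel (H w N)" if "w \<in> \<W>" for w
    unfolding c1_def using \<W>(1) that by (intro Min_le) auto
  obtain D where D: "D \<ge> 1" and bnd: "distortion_bound D" using distortion_bound_exists by blast
  have XL: "X \<in> sets L" by (simp add: sets_L)
  have Xpos: "measure lborel X > 0"
    using mu.prob_space C(2)[rule_format, OF XL] C(1) by (metis less_numeral_extra(1) not_less space_mu zero_less_measure_iff mult_zero_right)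
  define c where "c = c1 / (D * measure lborel X)"
  show ?thesis
  proof (intro exI[of _ "Suc N"] exI[of _ c] conjI ballI)
    show "c > 0" using c1 D Xpos by (simp add: c_def)
    fix I assume I: "I \<in> charged"
    note IP = charged_P[OF I]
    obtain w where w: "w \<in> \<W>" "w \<subseteq> f ` I" using \<W>(4) I by blast
    have wL: "w \<in> sets L" using w \<W>(2) cyl_structure(4) by blast
    let ?V = "H w N"
    have V: "?V \<in> sets L" "?V \<subseteq> f ` I" using H[OF wL] w(2) unfolding H_def by auto
    have "measure lborel {x\<in>I. f x \<in> f ` I} * measure lborel ?V
       \<le> D * measure lborel {x\<in>I. f x \<in> ?V} * measure lborel (f ` I)"
      by (rule image_distortion[OF bnd]) (use IP V P_image(4) in auto)
    moreover have "{x\<in>I. f x \<in> f ` I} = I" by auto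
    ultimately have 1: "measure lborel I * measure lborel ?V
       \<le> D * measure lborel {x\<in>I. f x \<in> ?V} * measure lborel (f ` I)" by (simp only:)
    have fX: "measure lborel (f ` I) \<le> measure lborel X"
      using measure_L[OF XL] measure_L[OF P_image(4)[OF IP]] L.finite_measure_mono[OF P_image(3)[OF IP] XL] by simp
    have "measure lborel I * c1 \<le> measure lborel I * measure lborel ?V"
      by (intro mult_left_mono c1_le w) simp
    also note 1
    also have "D * measure lborel {x\<in>I. f x \<in> ?V} * measure lborel (f ` I)
        \<le> D * measure lborel {x\<in>I. f x \<in> ?V} * measure lborel X"
      using D by (intro mult_left_mono fX) auto
    finally have "c * measure lborel I \<le> measure lborel {x\<in>I. f x \<in> ?V}"
      using D Xpos by (simp add: c_def field_simps)
    also have "\<dots> \<le> measure lborel (H I (Suc N))"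
    proof -
      have 2: "{x\<in>I. f x \<in> ?V} \<in> sets L" using vimage_sets[OF P_elem(5)[OF IP] V(1), of 1] by simp
      have 3: "H I (Suc N) \<in> sets L" by (rule H[OF P_elem(5)[OF IP]])
      have "{x\<in>I. f x \<in> ?V} \<subseteq> H I (Suc N)"
      proof
        fix x assume "x \<in> {x\<in>I. f x \<in> ?V}"
        then obtain k where k: "x \<in> I" "k \<in> {1..N}" "(f ^^ k) (f x) \<in> K" unfolding H_def by auto
        then have "(f ^^ Suc k) x \<in> K" by (simp only: funpow_Suc_right comp_apply)
        moreover have "Suc k \<in> {1..Suc N}" using k by auto
        ultimately show "x \<in> H I (Suc N)" using k(1) unfolding H_def by blast
      qed
      from L.finite_measure_mono[OF this 3] show ?thesis by (simp only: measure_L[OF 2] measure_L[OF 3])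
    qed
    finally show "c * measure lborel I \<le> measure lborel {x\<in>I. \<exists>k\<in>{1..Suc N}. (f ^^ k) x \<in> K}"
      unfolding H_def .
  qed simp
qed

text \<open>The system of charged elements satisfies the hypotheses of \<open>recurrent_core\<close>, with Lebesgue
measure restricted to their union as reference measure. As \<open>f\<close> maps this union into itself only up to a
null set, the restriction is by a density, which leaves the underlying space as it is.\<close>
lemma survival_estimate:
  "\<exists>N::nat. \<exists>a b c \<theta>::real. N \<ge> 1 \<and> a > 0 \<and> b > 0 \<and> c > 0 \<and> 0 \<le> \<theta> \<and> \<theta> < 1 \<and>
    (\<forall>A\<in>sets L. \<forall>g j. (\<forall>I\<in>P. I \<subseteq> A \<or> I \<inter> A = {}) \<longrightarrow> 0 < measure \<mu> A \<longrightarrow>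
       a * \<theta> ^ (g div N) \<le> measure \<mu> A \<longrightarrow>
       measure \<mu> {x\<in>X. \<forall>k\<in>{1..j * (N + g)}. (f ^^ k) x \<notin> A} \<le> b * exp (- c * measure \<mu> A * j))"
proof -
  interpret L: finite_measure L by (rule finite_L)
  interpret mu: prob_space \<mu> by (rule acip_facts(1))
  obtain K where K: "K \<in> charged" using charged_nonempty by blast
  obtain N c where N: "N \<ge> 1" and c: "c > 0" and hit:
    "\<forall>I\<in>charged. c * measure lborel I \<le> measure lborel {x\<in>I. \<exists>k\<in>{1..N}. (f ^^ k) x \<in> K}"
    using uniform_hitting[OF K] by (elim exE conjE) (rule that)
  obtain C where C: "C > 0" "\<forall>A\<in>sets L. measure \<mu> A \<le> C * measure lborel A"
    using mu_le_lebesgue by blast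
  obtain D where D: "D \<ge> 1" and bnd: "distortion_bound D" using distortion_bound_exists by blast
  define Y where "Y = \<Union>charged"
  have Y: "Y \<in> sets L" unfolding Y_def
  proof (rule UN_cyl_sets)
    show "charged \<subseteq> cyl 0" using charged_P cyl_0 by auto
  qed
  define L' where "L' = density L (indicator Y)"
  define cyl' where "cyl' n = {w\<in>cyl n. w \<subseteq> Y}" for n
  have sets_L': "sets L' = sets L" and space_L': "space L' = X" by (simp_all add: L'_def space_L)
  have em: "emeasure L' A = emeasure L (A \<inter> Y)" if "A \<in> sets L" for A
  proof -
    have "emeasure L' A = (\<integral>\<^sup>+x. indicator Y x * indicator A x \<partial>L)"
      unfolding L'_def using Y that by (intro emeasure_density) auto
    also have "\<dots> = (\<integral>\<^sup>+x. indicator (A \<inter> Y) x \<partial>L)"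
      by (intro nn_integral_cong) (simp add: indicator_inter_arith mult.commute)
    also have "\<dots> = emeasure L (A \<inter> Y)" using Y that by (intro nn_integral_indicator) auto
    finally show ?thesis .
  qed
  have meas: "measure L' A = measure lborel (A \<inter> Y)" if "A \<in> sets L" for A
    using em[OF that] measure_L[of "A \<inter> Y"] Y that by (simp add: measure_def)
  have sub_meas: "measure L' A = measure lborel A" if "A \<in> sets L" "A \<subseteq> Y" for A
    using meas[OF that(1)] that(2) by (simp add: Int_absorb2)
  have cyl'_0: "cyl' 0 = charged"
  proof -
    have "w \<in> charged" if w: "w \<in> P" "w \<subseteq> Y" for w
    proof -
      obtain x where x: "x \<in> w" using P_elem(3)[OF w(1)] by auto
      then obtain I where I: "I \<in> charged" "x \<in> I" using w(2) unfolding Y_def by blast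
      have "w = I" by (rule P_disjoint[OF w(1) charged_P[OF I(1)] x I(2)])
      then show ?thesis using I(1) by simp
    qed
    then show ?thesis unfolding cyl'_def cyl_0 using charged_P unfolding Y_def by auto
  qed
  have XL: "X \<in> sets L" by (simp add: sets_L)
  have finL': "finite_measure L'"
    by (rule finite_measureI) (simp add: space_L' em[OF XL] L.emeasure_eq_measure)
  interpret R: recurrent_core L' f cyl' D K N c
  proof (intro recurrent_core.intro quasi_markov.intro quasi_markov_axioms.intro recurrent_core_axioms.intro)
    show "finite_measure L'" by (rule finL')
    show "f \<in> measurable L' L'" using f_L measurable_cong_sets[OF sets_L' sets_L'] by blast
    show "countable (cyl' m)" for m using countable_cyl[of m] by (rule countable_subset[rotated]) (auto simp: cyl'_def)
    show "disjoint (cyl' m)" for m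
      unfolding disjoint_def cyl'_def using cyl_disjoint[of m] unfolding disjoint_def by simp
    show "w \<in> sets L'" if "w \<in> cyl' m" for w m
      using that cyl_structure(4) unfolding sets_L' cyl'_def by blast
    show "AE x in L'. x \<in> \<Union>(cyl' m)" for m
    proof -
      have "AE x in L. 0 < (indicator Y x :: ennreal) \<longrightarrow> x \<in> \<Union>(cyl' m)"
        using AE_cyl[of m]
      proof eventually_elim
        case (elim x)
        then obtain w where w: "w \<in> cyl m" "x \<in> w" by blast
        show ?case
        proof
          assume "0 < (indicator Y x :: ennreal)"
          then have "x \<in> Y" by (simp split: split_indicator_asm)
          then have "w \<in> cyl' m" using cyl_charged[OF w] w(1) unfolding cyl'_def Y_def by blast
          then show "x \<in> \<Union>(cyl' m)" using w(2) by blast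
        qed
      qed
      then show ?thesis unfolding L'_def using Y by (subst AE_density) auto
    qed
    show "\<exists>w'\<in>cyl' m. w \<subseteq> w'" if w': "w \<in> cyl' n" and mn: "m \<le> n" for w m n
    proof -
      have w: "w \<in> cyl n" "w \<subseteq> Y" using w' unfolding cyl'_def by auto
      obtain v where v: "v \<in> cyl m" "w \<subseteq> v" using cyl_nested[OF w(1) mn] by blast
      obtain x where "x \<in> w" using cyl_structure(9)[OF w(1)] by blast
      then have "v \<subseteq> Y" using cyl_charged[OF v(1)] w v(2) unfolding Y_def by blast
      then show ?thesis using v unfolding cyl'_def by blast
    qed
    show "0 < measure L' w" if "w \<in> cyl' 0" for w
      using that sub_meas[of w] cyl_structure(4,8)[of w 0] unfolding cyl'_def by auto
    show "0 < D" using D by simp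
    show "\<exists>I\<in>cyl' 0. (f ^^ m) ` w \<subseteq> I \<and> (\<forall>E\<in>sets L'. \<forall>E'\<in>sets L'. E \<subseteq> I \<longrightarrow> E' \<subseteq> I \<longrightarrow>
        measure L' {x\<in>w. (f ^^ m) x \<in> E} * measure L' E'
          \<le> D * measure L' {x\<in>w. (f ^^ m) x \<in> E'} * measure L' E)" if w': "w \<in> cyl' m" for w m
    proof (intro bexI[of _ "(f ^^ m) ` w"] conjI ballI impI)
      have w: "w \<in> cyl m" "w \<subseteq> Y" using w' unfolding cyl'_def by auto
      have ch: "(f ^^ m) ` w \<in> charged" using cyl_image_charged w unfolding Y_def by blast
      then show "(f ^^ m) ` w \<in> cyl' 0" unfolding cyl'_0 .
      fix E E' assume "E \<in> sets L'" "E' \<in> sets L'" and sub: "E \<subseteq> (f ^^ m) ` w" "E' \<subseteq> (f ^^ m) ` w"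
      then have E: "E \<in> sets L" "E' \<in> sets L" unfolding sets_L' by auto
      have EY: "E \<subseteq> Y" "E' \<subseteq> Y" using ch sub unfolding Y_def by blast+
      have "measure L' {x\<in>w. (f ^^ m) x \<in> S} = measure lborel {x\<in>w. (f ^^ m) x \<in> S}" if "S \<in> sets L" for S
        using w(2) by (intro sub_meas vimage_sets cyl_structure(4)[OF w(1)] that) auto
      then show "measure L' {x\<in>w. (f ^^ m) x \<in> E} * measure L' E'
          \<le> D * measure L' {x\<in>w. (f ^^ m) x \<in> E'} * measure L' E"
        unfolding sub_meas[OF E(1) EY(1)] sub_meas[OF E(2) EY(2)]
        using branch_distortion[OF bnd w(1) E sub] E by simp
    qed simp
    show "K \<in> cyl' 0" unfolding cyl'_0 by (rule K)
    show "1 \<le> N" by (rule N)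
    show "0 < c" by (rule c)
    show "c * measure L' I \<le> measure L' {x\<in>I. \<exists>k\<in>{1..N}. (f ^^ k) x \<in> K}" if "I \<in> cyl' 0" for I
    proof -
      have I: "I \<in> charged" using that cyl'_0 by simp
      have KL: "K \<in> sets L" and IL: "I \<in> sets L" using P_elem(5) charged_P K I by blast+
      have IY: "I \<subseteq> Y" using I unfolding Y_def by blast
      have "{x\<in>I. \<exists>k\<in>{1..N}. (f ^^ k) x \<in> K} = (\<Union>k\<in>{1..N}. {x\<in>I. (f ^^ k) x \<in> K})" by auto
      also have "\<dots> \<in> sets L" using vimage_sets[OF IL KL] by (intro sets.finite_UN) auto
      finally have "measure L' {x\<in>I. \<exists>k\<in>{1..N}. (f ^^ k) x \<in> K} = measure lborel {x\<in>I. \<exists>k\<in>{1..N}. (f ^^ k) x \<in> K}"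
        using IY by (intro sub_meas) auto
      then show ?thesis using hit[rule_format, OF I] sub_meas[OF IL IY] by simp
    qed
  qed
  have muC: "measure \<mu> A \<le> C * measure L' A" if "A \<in> sets L" for A
  proof -
    have AY: "A \<inter> Y \<in> sets L" using that Y by auto
    have "measure \<mu> A = measure \<mu> (A \<inter> Y)"
      using AE_charged that AY acip_facts(2) unfolding Y_def[symmetric]
      by (intro mu.finite_measure_eq_AE) auto
    also have "\<dots> \<le> C * measure lborel (A \<inter> Y)" using C(2) AY by blast
    finally show ?thesis using meas[OF that] by simp
  qed
  define V where "V = measure L' X"
  have V1: "1 \<le> C * V" using muC[OF XL] mu.prob_space unfolding V_def space_mu by simp
  then have V: "V > 0" using C(1) by (metis V_def measure_nonneg mult_zero_right not_one_le_zero order_le_less)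
  define d where "d = c * (1 - R.\<theta>) / (2 * C * N * D\<^sup>2 * measure L' K)"
  have d: "d > 0"
    unfolding d_def using c R.\<theta>_bounds C(1) N D R.cyl_pos[OF R.K]
    by (intro divide_pos_pos mult_pos_pos) auto
  show ?thesis
  proof (rule exI[of _ N], rule exI[of _ "2 * C * V"], rule exI[of _ "C * V"], rule exI[of _ d],
      rule exI[of _ R.\<theta>], intro conjI ballI allI impI)
    show "N \<ge> 1" "2 * C * V > 0" "C * V > 0" "d > 0" "0 \<le> R.\<theta>" "R.\<theta> < 1"
      using N C(1) V d R.\<theta>_bounds by auto
    fix A g j assume A: "A \<in> sets L" "\<forall>I\<in>P. I \<subseteq> A \<or> I \<inter> A = {}" "0 < measure \<mu> A"
      "2 * C * V * R.\<theta> ^ (g div N) \<le> measure \<mu> A"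
    have dec: "R.decided 0 (\<lambda>x. x \<in> A)"
      unfolding R.decided_def cyl'_def cyl_0 using A(2) by blast
    define S where "S = {x\<in>X. \<forall>k\<in>{1..j * (N + g)}. (f ^^ k) x \<notin> A}"
    have A': "A \<in> sets L'" using A(1) sets_L' by simp
    have bd: "measure L' S \<le> (1 - d * measure \<mu> A) ^ j * V \<and> d * measure \<mu> A \<le> 1"
      using R.survival[OF _ mu.finite_measure_axioms acip_facts(4) _ C(1) A' dec, of g j]
      unfolding sets_L' space_L' S_def[symmetric] V_def[symmetric] d_def[symmetric]
      using acip_facts(2) muC A(3,4) by (simp add: mult_ac)
    have SL: "S \<in> sets L"
    proof -
      have "S = X - (\<Union>k\<in>{1..j * (N + g)}. {x\<in>X. (f ^^ k) x \<in> A})" unfolding S_def by auto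
      also have "\<dots> \<in> sets L" using preimage_sets[OF A(1)] XL by (intro sets.Diff sets.finite_UN) auto
      finally show ?thesis .
    qed
    have "measure \<mu> S \<le> C * measure L' S" by (rule muC[OF SL])
    also have "\<dots> \<le> C * ((1 - d * measure \<mu> A) ^ j * V)" using bd C(1) by (intro mult_left_mono) auto
    also have "\<dots> \<le> C * (exp (- d * measure \<mu> A) ^ j * V)"
    proof -
      have "1 - d * measure \<mu> A \<le> exp (- d * measure \<mu> A)" using exp_ge_add_one_self[of "- d * measure \<mu> A"] by simp
      then have "(1 - d * measure \<mu> A) ^ j \<le> exp (- d * measure \<mu> A) ^ j" using bd by (intro power_mono) auto
      then show ?thesis using C(1) V by (intro mult_left_mono mult_right_mono) auto
    qed
    also have "exp (- d * measure \<mu> A) ^ j = exp (- d * measure \<mu> A * j)"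
      by (simp add: exp_of_nat_mult[symmetric] mult_ac)
    finally show "measure \<mu> {x\<in>X. \<forall>k\<in>{1..j * (N + g)}. (f ^^ k) x \<notin> A} \<le> C * V * exp (- d * measure \<mu> A * j)"
      unfolding S_def by (simp add: mult_ac)
  qed
qed

end

section \<open>Tails of the observable and of its Birkhoff sums\<close>

lemma powr_le_telescope:
  fixes \<beta> :: real and n :: nat
  assumes "\<beta> > 0" "n \<ge> 1"
  shows "real (Suc n) powr (- \<beta> - 1) \<le> (real n powr - \<beta> - real (Suc n) powr - \<beta>) / \<beta>"
proof -
  have "\<exists>z. real n < z \<and> z < real (Suc n) \<and>
     real (Suc n) powr - \<beta> - real n powr - \<beta> = (real (Suc n) - real n) * (- \<beta> * z powr (- \<beta> - 1))"
    using assms by (intro MVT2) (auto intro!: derivative_eq_intros)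
  then obtain z where z: "real n < z" "z < real (Suc n)"
    "real (Suc n) powr - \<beta> - real n powr - \<beta> = - \<beta> * z powr (- \<beta> - 1)" by auto
  have "real (Suc n) powr (- \<beta> - 1) \<le> z powr (- \<beta> - 1)"
    using z assms by (intro powr_mono2') auto
  also have "\<dots> = (real n powr - \<beta> - real (Suc n) powr - \<beta>) / \<beta>"
    using z(3) assms by (simp add: field_simps)
  finally show ?thesis .
qed

lemma sum_powr_le:
  fixes \<beta> :: real
  assumes "0 < \<beta>" "\<beta> < 1" "m \<ge> 1"
  shows "(\<Sum>j=1..m. real j powr - \<beta>) \<le> real m powr (1 - \<beta>) / (1 - \<beta>)"
  using assms(3)
proof (induction m rule: dec_induct)
  case base
  then show ?case using assms by simp
next
  case (step n)
  have "\<exists>z. real n < z \<and> z < real (Suc n) \<and>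
     real (Suc n) powr (1 - \<beta>) - real n powr (1 - \<beta>) = (real (Suc n) - real n) * ((1 - \<beta>) * z powr - \<beta>)"
    using step(1) assms by (intro MVT2) (auto intro!: derivative_eq_intros)
  then obtain z where z: "real n < z" "z < real (Suc n)"
    "real (Suc n) powr (1 - \<beta>) - real n powr (1 - \<beta>) = (1 - \<beta>) * z powr - \<beta>" by auto
  have "real (Suc n) powr - \<beta> \<le> z powr - \<beta>"
    using z assms by (intro powr_mono2') auto
  also have "\<dots> = (real (Suc n) powr (1 - \<beta>) - real n powr (1 - \<beta>)) / (1 - \<beta>)"
    using z(3) assms by (simp add: field_simps)
  finally show ?case using step.IH by (simp add: diff_divide_distrib)
qed

lemma (in prob_space) AE_eventually_not:
  assumes "\<And>k. F k \<in> sets M" "summable (\<lambda>k. measure M (F k))"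
  shows "AE x in M. \<forall>\<^sub>F k in sequentially. x \<notin> F k"
  using borel_cantelli_AE1[of F M, OF assms(1) _ assms(2)]
  by (auto simp: less_top[symmetric] elim!: eventually_mono AE_mp intro!: AE_I2)

lemma log_exponent_le:
  fixes k n :: nat
  assumes "2 ^ k \<le> n" "ln (real n) \<ge> 2"
  shows "real k + 2 \<le> 4 * ln (real n)"
proof -
  have n: "0 < real n" using assms by (metis gr0I ln_0 of_nat_0 of_nat_0_less_iff rel_simps(28) )
  have "ln ((2::real) ^ k) \<le> ln (real n)" using assms(1) n by (subst ln_le_cancel_iff) (simp_all flip: of_nat_power add: of_nat_le_iff)
  then have "real k * ln 2 \<le> ln (real n)" by (simp add: ln_realpow)
  moreover have "real k * (2 / 3) \<le> real k * ln 2" using ln2_ge_two_thirds by (intro mult_left_mono) auto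
  ultimately show ?thesis using assms(2) by linarith
qed
locale heavy_tailed_observable = expanding_markov_map f X P \<mu>
  for f :: "real \<Rightarrow> real" and X :: "real set" and P :: "real set set" and \<mu> :: "real measure" +
  fixes \<phi> :: "real \<Rightarrow> real" and \<beta> :: real
  assumes \<phi>_borel: "\<phi> \<in> borel_measurable \<mu>" and \<phi>_nonneg: "x \<in> X \<Longrightarrow> \<phi> x \<ge> 0"
    and \<phi>_const: "I \<in> P \<Longrightarrow> \<phi> constant_on I"
    and \<beta>: "0 < \<beta>" "\<beta> < 1" and tail: "regular_tail X \<mu> \<phi> \<beta>"
begin

sublocale mu: prob_space \<mu> by (rule acip_facts(1))

lemma \<phi>_L: "\<phi> \<in> borel_measurable L"
  using \<phi>_borel measurable_cong_sets[OF acip_facts(2) refl] by blast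

lemma pred_\<phi>: "Measurable.pred borel Q \<Longrightarrow> {x\<in>X. Q (\<phi> x)} \<in> sets L"
  using \<phi>_L measurable_sets[OF \<phi>_L, of "{y. Q y}"] by (simp add: vimage_def space_L Int_def conj_commute)

lemma tail_sets: "{x\<in>X. \<phi> x > t} \<in> sets L" "{x\<in>X. \<phi> x = t} \<in> sets L"
  using pred_\<phi>[of "\<lambda>y. y > t"] pred_\<phi>[of "\<lambda>y. y = t"] by auto

lemma point_masses:
  "\<exists>c>0. \<exists>n1\<ge>1. (\<forall>n\<ge>n1. measure \<mu> {x\<in>X. \<phi> x = real n} \<le> c * real n powr (- \<beta> - 1)) \<and>
    (\<forall>n\<ge>n1. inverse c * real n powr (- \<beta> - 1) \<le> measure \<mu> {x\<in>X. \<phi> x = real n})"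
proof -
  obtain c where c: "c > 0" and ev: "\<forall>\<^sub>F n in sequentially.
      inverse c \<le> measure \<mu> {x\<in>X. \<phi> x = real n} / real n powr (- \<beta> - 1) \<and>
      measure \<mu> {x\<in>X. \<phi> x = real n} / real n powr (- \<beta> - 1) \<le> c"
    using tail unfolding regular_tail_def comparable_def by blast
  obtain n0 where n0: "\<forall>n\<ge>n0.
      inverse c \<le> measure \<mu> {x\<in>X. \<phi> x = real n} / real n powr (- \<beta> - 1) \<and>
      measure \<mu> {x\<in>X. \<phi> x = real n} / real n powr (- \<beta> - 1) \<le> c"
    using ev unfolding eventually_sequentially by (elim exE) (rule that)
  show ?thesis
  proof (intro exI[of _ c] exI[of _ "max n0 1"] conjI allI impI)
    fix n assume n: "max n0 1 \<le> n"
    have p: "real n powr (- \<beta> - 1) > 0" using n by simp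
    show "measure \<mu> {x\<in>X. \<phi> x = real n} \<le> c * real n powr (- \<beta> - 1)"
      using n0[rule_format, of n] n p by (simp add: pos_divide_le_eq)
  next
    fix n assume n: "max n0 1 \<le> n"
    have p: "real n powr (- \<beta> - 1) > 0" using n by simp
    show "inverse c * real n powr (- \<beta> - 1) \<le> measure \<mu> {x\<in>X. \<phi> x = real n}"
      using n0[rule_format, of n] n p by (simp add: pos_le_divide_eq)
  qed (use c in auto)
qed

text \<open>With \<open>m\<close> the integer part of \<open>t\<close>, the \<open>m\<close> integers from \<open>m + 1\<close> to \<open>2 m\<close> exceed \<open>t\<close> and carry
mass of order at least \<open>m powr (- \<beta> - 1)\<close> each.\<close>
lemma tail_lower: "\<exists>b>0. \<exists>T\<ge>1. \<forall>t\<ge>T. b * t powr - \<beta> \<le> measure \<mu> {x\<in>X. \<phi> x > t}"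
proof -
  obtain c n1 where c: "c > 0" "n1 \<ge> 1" and
    low: "\<forall>n\<ge>n1. inverse c * real n powr (- \<beta> - 1) \<le> measure \<mu> {x\<in>X. \<phi> x = real n}"
    using point_masses by (elim exE conjE) (rule that)
  define b where "b = inverse c * 2 powr (- \<beta> - 1)"
  have "b * t powr - \<beta> \<le> measure \<mu> {x\<in>X. \<phi> x > t}" if t: "t \<ge> real n1" for t
  proof -
    define m where "m = nat \<lfloor>t\<rfloor>"
    have m: "real m \<le> t" "t < real m + 1" "m \<ge> n1" "m \<ge> 1"
      using t c(2) by (auto simp: m_def le_nat_floor of_nat_floor) 
    let ?q = "\<lambda>n. {x\<in>X. \<phi> x = real n}"
    have "b * t powr - \<beta> \<le> b * real m powr - \<beta>"
      using m \<beta> c by (intro mult_left_mono powr_mono2') (auto simp: b_def)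
    also have "\<dots> = (\<Sum>n=m+1..2*m. inverse c * real (2 * m) powr (- \<beta> - 1))"
      using m(4) by (simp add: b_def powr_mult powr_diff powr_minus field_simps)
    also have "\<dots> \<le> (\<Sum>n=m+1..2*m. measure \<mu> (?q n))"
    proof (rule sum_mono)
      fix n assume n: "n \<in> {m+1..2*m}"
      have "real (2 * m) powr (- \<beta> - 1) \<le> real n powr (- \<beta> - 1)"
        using n \<beta> by (intro powr_mono2') auto
      then have "inverse c * real (2 * m) powr (- \<beta> - 1) \<le> inverse c * real n powr (- \<beta> - 1)"
        using c by (intro mult_left_mono) auto
      also have "\<dots> \<le> measure \<mu> (?q n)" using n m(3) by (intro low[rule_format]) auto
      finally show "inverse c * real (2 * m) powr (- \<beta> - 1) \<le> measure \<mu> (?q n)" .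
    qed
    also have "\<dots> = measure \<mu> (\<Union>n\<in>{m+1..2*m}. ?q n)"
      using tail_sets(2) acip_facts(2)
      by (intro mu.finite_measure_finite_Union[symmetric]) (auto simp: disjoint_family_on_def)
    also have "\<dots> \<le> measure \<mu> {x\<in>X. \<phi> x > t}"
      using tail_sets(1) acip_facts(2) m(2) by (intro mu.finite_measure_mono) auto
    finally show ?thesis .
  qed
  moreover have "b > 0" using c by (simp add: b_def)
  ultimately show ?thesis using c(2) by (intro exI[of _ b] conjI exI[of _ "real n1"]) auto
qed

lemma tail_upper: "\<exists>B\<ge>1. \<forall>j::nat\<ge>1. measure \<mu> {x\<in>X. \<phi> x > real j} \<le> B * real j powr - \<beta>"
proof -
  obtain c n1 where c: "c > 0" "n1 \<ge> 1" and
    up: "\<forall>n\<ge>n1. measure \<mu> {x\<in>X. \<phi> x = real n} \<le> c * real n powr (- \<beta> - 1)"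
    using point_masses by (elim exE conjE) (rule that)
  have nat: "AE x in \<mu>. \<phi> x \<in> \<nat>" using tail unfolding regular_tail_def by auto
  define B where "B = max (c / \<beta>) (real n1 powr \<beta>)"
  have large: "measure \<mu> {x\<in>X. \<phi> x > real j} \<le> c / \<beta> * real j powr - \<beta>" if j: "j \<ge> n1" for j
  proof -
    let ?A = "\<lambda>i. {x\<in>X. \<phi> x = real (j + 1 + i)}"
    have A: "range ?A \<subseteq> sets \<mu>" using tail_sets(2) acip_facts(2) by auto
    have UA: "(\<Union>i. ?A i) \<in> sets \<mu>" using A by (intro sets.countable_UN) auto
    have "disjoint_family ?A" by (auto simp: disjoint_family_on_def)
    from mu.finite_measure_UNION[OF A this]
    have sums: "(\<lambda>i. measure \<mu> (?A i)) sums measure \<mu> (\<Union>i. ?A i)" .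
    have "(\<Sum>i<m. measure \<mu> (?A i)) \<le> c / \<beta> * (real j powr - \<beta> - real (j + m) powr - \<beta>)" for m
    proof (induction m)
      case (Suc m)
      have "measure \<mu> (?A m) \<le> c * real (Suc (j + m)) powr (- \<beta> - 1)" using up[rule_format, of "j + 1 + m"] j by simp
      also have "\<dots> \<le> c * ((real (j + m) powr - \<beta> - real (Suc (j + m)) powr - \<beta>) / \<beta>)"
        using c j \<beta> by (intro mult_left_mono powr_le_telescope) auto
      finally show ?case using Suc by (simp add: algebra_simps diff_divide_distrib)
    qed simp
    also have "c / \<beta> * (real j powr - \<beta> - real (j + m) powr - \<beta>) \<le> c / \<beta> * real j powr - \<beta>" for m
      using c \<beta> by (intro mult_left_mono) auto
    finally have part: "(\<Sum>i<m. measure \<mu> (?A i)) \<le> c / \<beta> * real j powr - \<beta>" for m .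
    have "measure \<mu> {x\<in>X. \<phi> x > real j} \<le> measure \<mu> (\<Union>i. ?A i)"
    proof (rule mu.finite_measure_mono_AE[OF _ UA])
      show "AE x in \<mu>. x \<in> {x\<in>X. \<phi> x > real j} \<longrightarrow> x \<in> (\<Union>i. ?A i)"
        using nat
      proof eventually_elim
        case (elim x)
        then obtain n where n: "\<phi> x = real n" by (auto elim: Nats_cases)
        show ?case
        proof
          assume x: "x \<in> {x\<in>X. \<phi> x > real j}"
          then have "x \<in> ?A (n - (j + 1))" using n by auto
          then show "x \<in> (\<Union>i. ?A i)" by blast
        qed
      qed
    qed
    also have "\<dots> \<le> c / \<beta> * real j powr - \<beta>"
      using sums part by (intro LIMSEQ_le_const2[of "\<lambda>m. \<Sum>i<m. measure \<mu> (?A i)"]) (auto simp: sums_def)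
    finally show ?thesis .
  qed
  have "measure \<mu> {x\<in>X. \<phi> x > real j} \<le> B * real j powr - \<beta>" if j: "j \<ge> 1" for j
  proof (cases "j \<ge> n1")
    case True
    have "c / \<beta> * real j powr - \<beta> \<le> B * real j powr - \<beta>" by (intro mult_right_mono) (auto simp: B_def)
    then show ?thesis using large[OF True] by linarith
  next
    case False
    have "1 = real j powr \<beta> * real j powr - \<beta>" using j by (simp add: powr_minus)
    also have "\<dots> \<le> B * real j powr - \<beta>"
    proof (rule mult_right_mono)
      have "real j powr \<beta> \<le> real n1 powr \<beta>" using False \<beta> by (intro powr_mono2) auto
      then show "real j powr \<beta> \<le> B" by (simp add: B_def)
    qed simp
    finally show ?thesis using mu.prob_le_1 order_trans by blast
  qed
  moreover have "B \<ge> 1" using c(2) \<beta> by (simp add: B_def ge_one_powr_ge_zero le_max_iff_disj)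
  ultimately show ?thesis by blast
qed

text \<open>If the sum reaches \<open>a\<close>, so does the sum of the terms truncated at \<open>a\<close>: either one term alone is at
least \<open>a\<close>, or truncation changes nothing. The truncated observable is at most the number of integers
\<open>0 \<le> j < m\<close> below the value of \<open>\<phi>\<close>, where \<open>m\<close> is \<open>a\<close> rounded up, and this bounds its mean by
a sum of tail probabilities of order \<open>a powr (1 - \<beta>)\<close>.\<close>
lemma birkhoff_sum_tail:
  "\<exists>C>0. \<forall>n a. a \<ge> 1 \<longrightarrow> {x\<in>X. a \<le> birkhoff_sum f \<phi> n x} \<in> sets L \<and>
     measure \<mu> {x\<in>X. a \<le> birkhoff_sum f \<phi> n x} \<le> C * real n * a powr - \<beta>"
proof -
  obtain B where B: "B \<ge> 1" "\<forall>j::nat\<ge>1. measure \<mu> {x\<in>X. \<phi> x > real j} \<le> B * real j powr - \<beta>"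
    using tail_upper by (elim exE conjE) (rule that)
  define C where "C = 1 + B / (1 - \<beta>)"
  have C: "C > 0" using B \<beta> by (simp add: C_def add_pos_nonneg)
  note [measurable] = \<phi>_borel acip_facts(3)
  have it [measurable]: "(f ^^ k) \<in> measurable \<mu> \<mu>" for k by (rule measurable_compose_n[OF acip_facts(3)])
  have "{x\<in>X. a \<le> birkhoff_sum f \<phi> n x} \<in> sets L \<and>
    measure \<mu> {x\<in>X. a \<le> birkhoff_sum f \<phi> n x} \<le> C * real n * a powr - \<beta>" if a: "a \<ge> 1" for n a
  proof
    have S: "{x\<in>space \<mu>. a \<le> birkhoff_sum f \<phi> n x} \<in> sets \<mu>"
      unfolding birkhoff_sum_def by measurable
    then show SL: "{x\<in>X. a \<le> birkhoff_sum f \<phi> n x} \<in> sets L" by (simp add: space_mu acip_facts(2))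
    define m where "m = nat \<lceil>a\<rceil>"
    have m: "m \<ge> 1" "a \<le> real m" "real m - 1 \<le> a" using a by (auto simp: m_def) linarith+
    define E where "E j = {x\<in>space \<mu>. \<phi> x > real j}" for j :: nat
    have E [measurable]: "E j \<in> sets \<mu>" for j unfolding E_def by measurable
    define g where "g x = (\<Sum>j<m. indicator (E j) x :: real)" for x
    have g_meas [measurable]: "g \<in> borel_measurable \<mu>" unfolding g_def[abs_def] by measurable
    have g_ge: "min (\<phi> x) a \<le> g x" if x: "x \<in> X" for x
    proof -
      define r where "r = min (nat \<lceil>\<phi> x\<rceil>) m"
      have "g x = (\<Sum>j<m. if real j < \<phi> x then 1 else 0)"
        unfolding g_def E_def space_mu using x by (intro sum.cong) (auto simp: indicator_def)
      also have "\<dots> = real (card {j\<in>{..<m}. real j < \<phi> x})"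
        by (simp add: sum.If_cases Int_def)
      also have "\<dots> \<ge> real (card {..<r})"
      proof (intro of_nat_mono card_mono subsetI)
        fix j assume "j \<in> {..<r}"
        then have "j < m" "j < nat \<lceil>\<phi> x\<rceil>" unfolding r_def by auto
        then show "j \<in> {j\<in>{..<m}. real j < \<phi> x}" by (simp, linarith)
      qed simp
      finally have "real r \<le> g x" by simp
      moreover have "min (\<phi> x) a \<le> real r"
      proof -
        have "\<phi> x \<le> real (nat \<lceil>\<phi> x\<rceil>)" by (rule real_nat_ceiling_ge)
        then show ?thesis unfolding r_def using m(2) by linarith
      qed
      ultimately show ?thesis by linarith
    qed
    have int_g: "integrable \<mu> (\<lambda>x. g ((f ^^ k) x))" for k
    proof (rule mu.integrable_const_bound[of _ "real m"])
      have "norm (g y) \<le> real m" for y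
      proof -
        have "g y \<le> (\<Sum>j<m. 1)" unfolding g_def by (intro sum_mono) (auto simp: indicator_def)
        moreover have "g y \<ge> 0" unfolding g_def by (intro sum_nonneg) auto
        ultimately show ?thesis by simp
      qed
      then show "AE x in \<mu>. norm (g ((f ^^ k) x)) \<le> real m" by simp
    qed measurable
    have E_meas: "measure \<mu> (E j) = measure \<mu> {x\<in>X. \<phi> x > real j}" for j by (simp add: E_def space_mu)
    have val: "(\<integral>x. g ((f ^^ k) x) \<partial>\<mu>) = (\<Sum>j<m. measure \<mu> (E j))" for k
    proof -
      have "(\<integral>x. g ((f ^^ k) x) \<partial>\<mu>) = (\<Sum>j<m. \<integral>x. indicator (E j) ((f ^^ k) x) \<partial>\<mu>)"
        unfolding g_def
        by (intro Bochner_Integration.integral_sum mu.integrable_const_bound[of _ 1]) (auto simp: indicator_def)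
      also have "\<dots> = (\<Sum>j<m. measure \<mu> (E j))"
      proof (rule sum.cong)
        fix j
        have "(\<integral>x. indicator (E j) ((f ^^ k) x) \<partial>\<mu>) = (\<integral>x. indicator {x\<in>space \<mu>. (f ^^ k) x \<in> E j} x \<partial>\<mu> :: real)"
          by (intro Bochner_Integration.integral_cong) (auto simp: indicator_def)
        also have "\<dots> = measure \<mu> {x\<in>space \<mu>. (f ^^ k) x \<in> E j}" by simp
        also have "\<dots> = measure \<mu> (E j)" using mu_preimage[of "E j" k] E acip_facts(2) by (simp add: space_mu)
        finally show "(\<integral>x. indicator (E j) ((f ^^ k) x) \<partial>\<mu>) = measure \<mu> (E j)" .
      qed simp
      finally show ?thesis .
    qed
    have "(\<Sum>j<m. measure \<mu> (E j)) \<le> C * a powr (1 - \<beta>)"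
    proof -
      have split: "{..<m} = insert 0 {1..m-1}" using m(1) by auto
      have "(\<Sum>j=1..m-1. real j powr - \<beta>) \<le> a powr (1 - \<beta>) / (1 - \<beta>)"
      proof (cases "m - 1 \<ge> 1")
        case True
        have "(\<Sum>j=1..m-1. real j powr - \<beta>) \<le> real (m - 1) powr (1 - \<beta>) / (1 - \<beta>)"
          by (rule sum_powr_le[OF \<beta> True])
        also have "\<dots> \<le> a powr (1 - \<beta>) / (1 - \<beta>)"
          using m True \<beta> by (intro divide_right_mono powr_mono2) (auto simp: of_nat_diff)
        finally show ?thesis .
      qed (use \<beta> in auto)
      then have "B * (\<Sum>j=1..m-1. real j powr - \<beta>) \<le> B * (a powr (1 - \<beta>) / (1 - \<beta>))"
        using B(1) by (intro mult_left_mono) auto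
      moreover have "(1 :: real) \<le> a powr (1 - \<beta>)" using a \<beta> by (intro ge_one_powr_ge_zero) auto
      moreover have "(\<Sum>j<m. measure \<mu> (E j)) = measure \<mu> (E 0) + (\<Sum>j=1..m-1. measure \<mu> (E j))"
        unfolding split by simp
      moreover have "(\<Sum>j=1..m-1. measure \<mu> (E j)) \<le> (\<Sum>j=1..m-1. B * real j powr - \<beta>)"
        by (intro sum_mono) (use B(2) in \<open>auto simp: E_meas\<close>)
      moreover have "(\<Sum>j=1..m-1. B * real j powr - \<beta>) = B * (\<Sum>j=1..m-1. real j powr - \<beta>)"
        by (simp add: sum_distrib_left)
      moreover have "measure \<mu> (E 0) \<le> 1" by (rule mu.prob_le_1)
      ultimately have "(\<Sum>j<m. measure \<mu> (E j)) \<le> a powr (1 - \<beta>) + B * (a powr (1 - \<beta>) / (1 - \<beta>))"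
        by linarith
      also have "\<dots> = C * a powr (1 - \<beta>)" by (simp add: C_def distrib_right)
      finally show ?thesis .
    qed
    then have total: "(\<integral>x. (\<Sum>k<n. g ((f ^^ k) x)) \<partial>\<mu>) \<le> real n * (C * a powr (1 - \<beta>))"
      using int_g by (simp add: Bochner_Integration.integral_sum val mult_left_mono)
    have sub: "{x\<in>X. a \<le> birkhoff_sum f \<phi> n x} \<subseteq> {x\<in>space \<mu>. a \<le> (\<Sum>k<n. g ((f ^^ k) x))}"
    proof
      fix x assume "x \<in> {x\<in>X. a \<le> birkhoff_sum f \<phi> n x}"
      then have x: "x \<in> X" "a \<le> birkhoff_sum f \<phi> n x" by auto
      have itx: "(f ^^ k) x \<in> X" for k by (rule it_X[OF x(1)])
      have "a \<le> (\<Sum>k<n. min (\<phi> ((f ^^ k) x)) a)"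
      proof (cases "\<exists>k<n. \<phi> ((f ^^ k) x) \<ge> a")
        case True
        then obtain k where k: "k < n" "\<phi> ((f ^^ k) x) \<ge> a" by blast
        have "min (\<phi> ((f ^^ k) x)) a \<le> (\<Sum>k<n. min (\<phi> ((f ^^ k) x)) a)"
          using k a \<phi>_nonneg[OF itx] by (intro member_le_sum) auto
        then show ?thesis using k by simp
      next
        case False
        then have "(\<Sum>k<n. min (\<phi> ((f ^^ k) x)) a) = birkhoff_sum f \<phi> n x"
          unfolding birkhoff_sum_def by (intro sum.cong) auto
        then show ?thesis using x by simp
      qed
      also have "\<dots> \<le> (\<Sum>k<n. g ((f ^^ k) x))" by (intro sum_mono g_ge itx)
      finally show "x \<in> {x\<in>space \<mu>. a \<le> (\<Sum>k<n. g ((f ^^ k) x))}" using x by (simp add: space_mu)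
    qed
    have "measure \<mu> {x\<in>X. a \<le> birkhoff_sum f \<phi> n x} \<le> measure \<mu> {x\<in>space \<mu>. a \<le> (\<Sum>k<n. g ((f ^^ k) x))}"
      by (rule mu.finite_measure_mono[OF sub]) measurable
    also have "\<dots> \<le> (\<integral>x. (\<Sum>k<n. g ((f ^^ k) x)) \<partial>\<mu>) / a"
    proof (rule integral_Markov_inequality_measure[where A = "{}"])
      show "AE x in \<mu>. 0 \<le> (\<Sum>k<n. g ((f ^^ k) x))"
        unfolding g_def by (intro AE_I2 sum_nonneg) auto
    qed (use int_g a in auto)
    also have "\<dots> \<le> real n * (C * a powr (1 - \<beta>)) / a"
      using total a by (intro divide_right_mono) auto
    also have "\<dots> = C * real n * a powr - \<beta>"
      using a by (simp add: powr_diff powr_minus field_simps)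
    finally show "measure \<mu> {x\<in>X. a \<le> birkhoff_sum f \<phi> n x} \<le> C * real n * a powr - \<beta>" .
  qed
  then show ?thesis using C by blast
qed

section \<open>Almost sure growth\<close>
lemma birkhoff_sum_mono: "x \<in> X \<Longrightarrow> m \<le> n \<Longrightarrow> birkhoff_sum f \<phi> m x \<le> birkhoff_sum f \<phi> n x"
  unfolding birkhoff_sum_def using \<phi>_nonneg it_X by (intro sum_mono2) auto

text \<open>Borel-Cantelli along the powers of two; for \<open>n\<close> between \<open>2^k\<close> and \<open>2^(k+1)\<close> the sum is compared
with the later power. Half of \<open>\<epsilon>\<close> pays for summability, the other half absorbs the constants.\<close>
lemma birkhoff_sum_upper:
  assumes "\<epsilon> > 0"
  shows "AE x in \<mu>. \<forall>\<^sub>F n in sequentially.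
    birkhoff_sum f \<phi> n x \<le> real n powr (1 / \<beta>) * ln (real n) powr (1 / \<beta> + \<epsilon>)"
proof -
  define \<delta> where "\<delta> = \<beta> * \<epsilon> / 2"
  have \<delta>: "\<delta> > 0" using assms \<beta> by (simp add: \<delta>_def)
  define a where "a k = (2 ^ k * (real k + 1) powr (1 + \<delta>)) powr (1 / \<beta>)" for k :: nat
  have base1: "1 \<le> 2 ^ k * (real k + 1) powr (1 + \<delta>)" for k :: nat
  proof -
    have "1 * 1 \<le> 2 ^ k * (real k + 1) powr (1 + \<delta>)"
      using \<delta> by (intro mult_mono ge_one_powr_ge_zero) auto
    then show ?thesis by simp
  qed
  have a1: "1 \<le> a k" for k unfolding a_def using base1[of k] \<beta> by (intro ge_one_powr_ge_zero) auto
  have a_inv: "a k powr - \<beta> = 1 / (2 ^ k * (real k + 1) powr (1 + \<delta>))" for k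
    unfolding a_def using \<beta> base1[of k] by (simp add: powr_powr powr_minus_divide)
  obtain C where C: "C > 0" "\<forall>n a. a \<ge> 1 \<longrightarrow> {x\<in>X. a \<le> birkhoff_sum f \<phi> n x} \<in> sets L \<and>
     measure \<mu> {x\<in>X. a \<le> birkhoff_sum f \<phi> n x} \<le> C * real n * a powr - \<beta>"
    using birkhoff_sum_tail by (elim exE conjE) (rule that)
  let ?F = "\<lambda>k. {x\<in>X. a k \<le> birkhoff_sum f \<phi> (2 ^ k) x}"
  have F: "?F k \<in> sets \<mu>" for k using C(2)[rule_format, OF a1] acip_facts(2) by simp
  have bound: "measure \<mu> (?F k) \<le> C * real (Suc k) powr - (1 + \<delta>)" for k
  proof -
    have "measure \<mu> (?F k) \<le> C * real (2 ^ k) * a k powr - \<beta>"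
      using C(2)[rule_format, OF a1[of k], of "2 ^ k"] by (rule conjunct2)
    also have "\<dots> = C * real (Suc k) powr - (1 + \<delta>)"
    proof -
      have "real (Suc k) powr - (1 + \<delta>) = 1 / (real k + 1) powr (1 + \<delta>)"
        by (subst powr_minus_divide) (simp add: add.commute)
      then show ?thesis unfolding a_inv by simp
    qed
    finally show ?thesis .
  qed
  have summ: "summable (\<lambda>k. C * real (Suc k) powr - (1 + \<delta>))"
  proof (rule summable_mult)
    have "summable (\<lambda>k. real k powr - (1 + \<delta>))" using \<delta> by (simp add: summable_real_powr_iff)
    then show "summable (\<lambda>k. real (Suc k) powr - (1 + \<delta>))" by (rule summable_Suc_iff[THEN iffD2])
  qed
  have "summable (\<lambda>k. measure \<mu> (?F k))"
    by (rule summable_comparison_test'[OF summ, of 0])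
       (simp only: real_norm_def abs_of_nonneg[OF measure_nonneg] bound)
  from mu.AE_eventually_not[OF F this] AE_space show ?thesis
  proof eventually_elim
    case (elim x)
    have x: "x \<in> X" using elim(2) by (simp add: space_mu)
    obtain k0 where k0: "\<And>k. k \<ge> k0 \<Longrightarrow> birkhoff_sum f \<phi> (2 ^ k) x < a k"
      using elim(1) x unfolding eventually_sequentially by (auto simp: not_le)
    define c where "c = (2 * 4 powr (1 + \<delta>)) powr (1 / \<beta>)"
    have "\<forall>\<^sub>F n in sequentially. c \<le> ln (real n) powr (\<epsilon> / 2)" using assms by real_asymp
    moreover have "\<forall>\<^sub>F n in sequentially. 2 \<le> ln (real n)" by real_asymp
    moreover have "\<forall>\<^sub>F n in sequentially. n \<ge> 2 ^ k0" by (rule eventually_ge_at_top)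
    ultimately show ?case
    proof eventually_elim
      case (elim n)
      have n: "n \<ge> 1" using elim(3) by (meson one_le_numeral one_le_power order_trans)
      obtain k where k: "2 ^ k \<le> n" "n < 2 ^ (k + 1)" using ex_power_ivl1[of 2 n] n by auto
      have "(2::nat) ^ k0 < 2 ^ (k + 1)" using elim(3) k(2) by linarith
      then have "k0 \<le> k + 1" using power_less_imp_less_exp[of "2::nat" k0 "k + 1"] by simp
      have kl: "real k + 2 \<le> 4 * ln (real n)" by (rule log_exponent_le[OF k(1) elim(2)])
      have lnn: "ln (real n) > 0" using elim(2) by linarith
      have "birkhoff_sum f \<phi> n x \<le> birkhoff_sum f \<phi> (2 ^ (k + 1)) x"
        using k(2) by (intro birkhoff_sum_mono x) auto
      also have "\<dots> \<le> a (k + 1)" using k0[OF \<open>k0 \<le> k + 1\<close>] by simp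
      also have "\<dots> \<le> (2 * real n * (4 * ln (real n)) powr (1 + \<delta>)) powr (1 / \<beta>)"
        unfolding a_def
      proof (intro powr_mono2 mult_mono)
        have "real (2 ^ k) \<le> real n" using k(1) by (rule of_nat_mono)
        then show "2 ^ (k + 1) \<le> 2 * real n" by simp
        show "real (k + 1) + 1 \<le> 4 * ln (real n)" using kl by simp
      qed (use \<beta> \<delta> in auto)
      also have "\<dots> = real n powr (1 / \<beta>) * (ln (real n) powr ((1 + \<delta>) / \<beta>) * c)"
        using lnn n \<beta> by (simp add: c_def powr_mult powr_powr mult_ac)
      also have "(1 + \<delta>) / \<beta> = 1 / \<beta> + \<epsilon> / 2" using \<beta> by (simp add: \<delta>_def field_simps)
      also have "real n powr (1 / \<beta>) * (ln (real n) powr (1 / \<beta> + \<epsilon> / 2) * c)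
         \<le> real n powr (1 / \<beta>) * (ln (real n) powr (1 / \<beta> + \<epsilon> / 2) * ln (real n) powr (\<epsilon> / 2))"
        using elim(1) by (intro mult_left_mono) auto
      also have "\<dots> = real n powr (1 / \<beta>) * ln (real n) powr (1 / \<beta> + \<epsilon>)"
      proof -
        have "1 / \<beta> + \<epsilon> / 2 + \<epsilon> / 2 = 1 / \<beta> + \<epsilon>" by simp
        then show ?thesis by (simp only: powr_add[symmetric])
      qed
      finally show ?case .
    qed
  qed
qed

lemma level_set_cells: "I \<in> P \<Longrightarrow> I \<subseteq> {x\<in>X. \<phi> x > t} \<or> I \<inter> {x\<in>X. \<phi> x > t} = {}"
  using \<phi>_const[of I] P_elem(4)[of I] unfolding constant_on_def by auto

text \<open>With \<open>g\<close> a multiple of \<open>k\<close> chosen so that \<open>\<theta> ^ (g div N) \<le> 2^-k\<close>, the hypothesis of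
\<open>survival_estimate\<close> holds for large \<open>k\<close>, and about \<open>2^k / k\<close> blocks fit before time \<open>2^k\<close>.
The expected number of successful blocks is of order \<open>k^\<delta>\<close>, so failure has summable probability.\<close>
lemma hits_within_powers:
  assumes \<delta>: "\<delta> > 0"
  defines "t \<equiv> \<lambda>k::nat. (2 ^ k / (real k + 1) powr (1 + \<delta>)) powr (1 / \<beta>)"
  shows "AE x in \<mu>. \<forall>\<^sub>F k in sequentially. \<exists>i\<in>{1..2 ^ k}. t k < \<phi> ((f ^^ i) x)"
proof -
  obtain b T where b: "b > 0" "T \<ge> 1" "\<forall>t\<ge>T. b * t powr - \<beta> \<le> measure \<mu> {x\<in>X. \<phi> x > t}"
    using tail_lower by (elim exE conjE) (rule that)
  obtain N :: nat and a B c \<theta> :: real where par: "N \<ge> 1" "a > 0" "B > 0" "c > 0" "0 \<le> \<theta>" "\<theta> < 1"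
    and surv: "\<forall>A\<in>sets L. \<forall>g j. (\<forall>I\<in>P. I \<subseteq> A \<or> I \<inter> A = {}) \<longrightarrow> 0 < measure \<mu> A \<longrightarrow>
       a * \<theta> ^ (g div N) \<le> measure \<mu> A \<longrightarrow>
       measure \<mu> {x\<in>X. \<forall>k\<in>{1..j * (N + g)}. (f ^^ k) x \<notin> A} \<le> B * exp (- c * measure \<mu> A * j)"
    using survival_estimate by (elim exE conjE) (rule that)
  obtain \<alpha> where \<alpha>: "\<theta> ^ \<alpha> < 1 / 2" using real_arch_pow_inv[of "1/2" \<theta>] par by auto
  define A where "A k = {x\<in>X. \<phi> x > t k}" for k
  have A: "A k \<in> sets L" for k unfolding A_def by (rule tail_sets)
  let ?F = "\<lambda>k. {x\<in>X. \<forall>i\<in>{1..2 ^ k}. (f ^^ i) x \<notin> A k}"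
  have F: "?F k \<in> sets L" for k
  proof -
    have "?F k = X - (\<Union>i\<in>{1..2 ^ k}. {x\<in>X. (f ^^ i) x \<in> A k})" by auto
    also have "\<dots> \<in> sets L"
      using preimage_sets[OF A] by (intro sets.Diff sets.finite_UN) (auto simp: sets_L)
    finally show ?thesis .
  qed
  \<comment> \<open>The block length \<open>N + \<alpha> * k * N\<close> is at most \<open>M * (k + 1)\<close>.\<close>
  define M where "M = real N * (1 + real \<alpha>)"
  have M: "M > 0" using par(1) by (simp add: M_def add_pos_nonneg)
  have t_inv: "t k powr - \<beta> = (1 / 2) ^ k * (real k + 1) powr (1 + \<delta>)" for k
    unfolding t_def using \<beta> by (simp add: powr_powr powr_minus_divide power_one_over field_simps)
  have ev1: "\<forall>\<^sub>F k in sequentially. T \<le> t k"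
    unfolding t_def using \<delta> \<beta> by real_asymp
  have ev2: "\<forall>\<^sub>F k in sequentially. a / b \<le> (real k + 1) powr (1 + \<delta>)"
    using \<delta> by real_asymp
  have ev3: "\<forall>\<^sub>F k in sequentially. (real k + 1) powr (1 + \<delta>) * (1 / 2) ^ k \<le> 1"
    using \<delta> by real_asymp
  have pos: "c * b / M > 0" "B * exp (c * b) > 0" using par b M by auto
  have ev4: "\<forall>\<^sub>F k in sequentially.
      (B * exp (c * b)) * exp (- (c * b / M) * (real k + 1) powr \<delta>) \<le> (real k + 1) powr - 2"
  proof -
    have "\<forall>\<^sub>F k in sequentially. v * exp (- u * (real k + 1) powr \<delta>) \<le> (real k + 1) powr - 2"
      if "u > 0" "v > 0" for u v :: real
      using that \<delta> by real_asymp
    from this[OF pos] show ?thesis .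
  qed
  have small: "\<forall>\<^sub>F k in sequentially. measure \<mu> (?F k) \<le> (real k + 1) powr - 2"
    using ev1 ev2 ev3 ev4
  proof eventually_elim
    case (elim k)
    define g where "g = \<alpha> * k * N"
    define j where "j = 2 ^ k div (N + g)"
    let ?p = "b * ((1 / 2) ^ k * (real k + 1) powr (1 + \<delta>))"
    have low: "?p \<le> measure \<mu> (A k)"
      using b(3)[rule_format, OF elim(1)] unfolding t_inv A_def .
    have p: "?p > 0" using b(1) by simp
    have "\<theta> ^ (g div N) = (\<theta> ^ \<alpha>) ^ k" using par(1) by (simp add: g_def power_mult)
    also have "\<dots> \<le> (1 / 2) ^ k" using \<alpha> par(5) by (intro power_mono) auto
    finally have "a * \<theta> ^ (g div N) \<le> a * (1 / 2) ^ k" using par(2) by (intro mult_left_mono) auto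
    also have "\<dots> \<le> (b * (real k + 1) powr (1 + \<delta>)) * (1 / 2) ^ k"
      using elim(2) b(1) by (intro mult_right_mono) (auto simp: field_simps)
    also have "\<dots> \<le> measure \<mu> (A k)" using low by (simp add: mult_ac)
    finally have "measure \<mu> {x\<in>X. \<forall>i\<in>{1..j * (N + g)}. (f ^^ i) x \<notin> A k} \<le> B * exp (- c * measure \<mu> (A k) * j)"
      using surv A[of k] p low level_set_cells[of _ "t k"] unfolding A_def by (simp del: mem_Collect_eq)
    moreover have "measure \<mu> (?F k) \<le> measure \<mu> {x\<in>X. \<forall>i\<in>{1..j * (N + g)}. (f ^^ i) x \<notin> A k}"
    proof (rule mu.finite_measure_mono)
      have "j * (N + g) \<le> 2 ^ k" unfolding j_def by simp
      then have "{1..j * (N + g)} \<subseteq> {1..2 ^ k}" by auto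
      then show "?F k \<subseteq> {x\<in>X. \<forall>i\<in>{1..j * (N + g)}. (f ^^ i) x \<notin> A k}" by blast
      have "{x\<in>X. \<forall>i\<in>{1..j * (N + g)}. (f ^^ i) x \<notin> A k} =
          X - (\<Union>i\<in>{1..j * (N + g)}. {x\<in>X. (f ^^ i) x \<in> A k})" by auto
      also have "\<dots> \<in> sets L"
        using preimage_sets[OF A] by (intro sets.Diff sets.finite_UN) (auto simp: sets_L)
      finally show "{x\<in>X. \<forall>i\<in>{1..j * (N + g)}. (f ^^ i) x \<notin> A k} \<in> sets \<mu>" using acip_facts(2) by simp
    qed
    moreover have "exp (- c * measure \<mu> (A k) * j) \<le> exp (c * b) * exp (- (c * b / M) * (real k + 1) powr \<delta>)"
    proof -
      have Ng: "real (N + g) \<le> M * (real k + 1)" by (simp add: g_def M_def algebra_simps)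
      have Ng0: "real (N + g) > 0" using par(1) by simp
      have "real (2 ^ k) / real (N + g) - 1 \<le> real j"
      proof -
        have "2 ^ k < (j + 1) * (N + g)"
          unfolding j_def using par(1) by (simp add: dividend_less_div_times)
        then have "real (2 ^ k) < (real j + 1) * real (N + g)"
          by (metis of_nat_1 of_nat_add of_nat_less_iff of_nat_mult)
        then show ?thesis using Ng0 by (simp add: field_simps)
      qed
      moreover have "2 ^ k / (M * (real k + 1)) \<le> real (2 ^ k) / real (N + g)"
        using Ng Ng0 by (simp add: frac_le)
      ultimately have j: "2 ^ k / (M * (real k + 1)) - 1 \<le> real j" by linarith
      have "b / M * (real k + 1) powr \<delta> - b \<le> ?p * (2 ^ k / (M * (real k + 1)) - 1)"
      proof -
        have "?p * (2 ^ k / (M * (real k + 1)) - 1) = b / M * (real k + 1) powr \<delta> - ?p"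
        proof -
          have u: "real k + 1 > 0" by simp
          have "(1 / 2 :: real) ^ k * 2 ^ k = 1" by (simp add: power_one_over)
          moreover have "(real k + 1) powr (1 + \<delta>) = (real k + 1) * (real k + 1) powr \<delta>"
            by (simp add: powr_add)
          moreover have "b * (h * (w * v)) * (s / (M * w)) = (h * s) * (b * v / M)" if "w > 0" for h w v s :: real
            using that M by (simp add: field_simps)
          ultimately have "?p * (2 ^ k / (M * (real k + 1))) = b * (real k + 1) powr \<delta> / M"
            using u by (simp only: mult_1)
          then show ?thesis by (simp only: right_diff_distrib mult_1_right times_divide_eq_left)
        qed
        moreover have "?p \<le> b * 1" using elim(3) b(1) by (intro mult_left_mono) (auto simp: mult.commute)
        ultimately show ?thesis by simp
      qed
      also have "\<dots> \<le> ?p * real j" using j p by (intro mult_left_mono) auto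
      also have "\<dots> \<le> measure \<mu> (A k) * real j" using low by (intro mult_right_mono) auto
      finally have "c * (b / M * (real k + 1) powr \<delta> - b) \<le> c * (measure \<mu> (A k) * real j)"
        using par(4) by (intro mult_left_mono) auto
      then have "- c * measure \<mu> (A k) * j \<le> c * b + - (c * b / M) * (real k + 1) powr \<delta>"
        by (simp add: algebra_simps)
      then show ?thesis by (simp only: exp_add[symmetric] exp_le_cancel_iff)
    qed
    then have "B * exp (- c * measure \<mu> (A k) * j) \<le> B * (exp (c * b) * exp (- (c * b / M) * (real k + 1) powr \<delta>))"
      using par(3) by (intro mult_left_mono) auto
    ultimately show ?case using elim(4) by (simp only: mult.assoc)
  qed
  have "summable (\<lambda>k. (real k + 1) powr - 2)"
  proof -
    have "summable (\<lambda>k. real k powr - 2)" by (simp only: summable_real_powr_iff)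
    then have "summable (\<lambda>k. real (Suc k) powr - 2)" by (rule summable_Suc_iff[THEN iffD2])
    then show ?thesis by (simp add: add.commute)
  qed
  then have "summable (\<lambda>k. measure \<mu> (?F k))"
    by (rule summable_comparison_test_ev[rotated]) (use small in \<open>auto elim: eventually_mono\<close>)
  from mu.AE_eventually_not[OF _ this] F acip_facts(2)
  have "AE x in \<mu>. \<forall>\<^sub>F k in sequentially. x \<notin> ?F k" by simp
  then show ?thesis using AE_space
  proof eventually_elim
    case (elim x)
    have x: "x \<in> X" using elim(2) by (simp add: space_mu)
    from elim(1) show ?case
    proof eventually_elim
      case (elim k)
      then obtain i where "i \<in> {1..2 ^ k}" "(f ^^ i) x \<in> A k" using x by auto
      then show ?case unfolding A_def by auto
    qed
  qed
qed

lemma birkhoff_max_ge: "i < n \<Longrightarrow> \<phi> ((f ^^ i) x) \<le> birkhoff_max f \<phi> n x"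
  unfolding birkhoff_max_def by (intro Max_ge) auto

text \<open>For \<open>n - 1\<close> between \<open>2^k\<close> and \<open>2^(k+1)\<close> the hit up to time \<open>2^k\<close> is among the first \<open>n\<close> terms; the
shift by one is needed because hits are counted up to and including time \<open>2^k\<close>.\<close>
lemma birkhoff_max_lower:
  assumes "\<epsilon> > 0"
  shows "AE x in \<mu>. \<forall>\<^sub>F n in sequentially.
    real n powr (1 / \<beta>) * ln (real n) powr (- 1 / \<beta> - \<epsilon>) \<le> birkhoff_max f \<phi> n x"
proof -
  define \<delta> where "\<delta> = \<beta> * \<epsilon> / 2"
  have \<delta>: "\<delta> > 0" using assms \<beta> by (simp add: \<delta>_def)
  define t where "t k = (2 ^ k / (real k + 1) powr (1 + \<delta>)) powr (1 / \<beta>)" for k :: nat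
  from hits_within_powers[OF \<delta>] show ?thesis
    unfolding t_def[symmetric]
  proof eventually_elim
    case (elim x)
    obtain k0 where k0: "\<And>k. k \<ge> k0 \<Longrightarrow> \<exists>i\<in>{1..2 ^ k}. t k < \<phi> ((f ^^ i) x)"
      using elim unfolding eventually_sequentially by blast
    define c where "c = (2 * 4 powr (1 + \<delta>)) powr (1 / \<beta>)"
    have c: "c > 0" by (simp add: c_def)
    have "\<forall>\<^sub>F n in sequentially. c \<le> ln (real n) powr (\<epsilon> / 2)" using assms by real_asymp
    moreover have "\<forall>\<^sub>F n in sequentially. 2 \<le> ln (real n)" by real_asymp
    moreover have "\<forall>\<^sub>F n in sequentially. n \<ge> 2 ^ k0 + 2" by (rule eventually_ge_at_top)
    ultimately show ?case
    proof eventually_elim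
      case (elim n)
      have n: "n - 1 \<ge> 1" using elim(3) by linarith
      obtain k where k: "2 ^ k \<le> n - 1" "n - 1 < 2 ^ (k + 1)" using ex_power_ivl1[of 2 "n - 1"] n by auto
      have "(2::nat) ^ k0 < 2 ^ (k + 1)" using elim(3) k(2) by linarith
      then have "k0 \<le> k" using power_less_imp_less_exp[of "2::nat" k0 "k + 1"] by simp
      then obtain i where i: "i \<in> {1..2 ^ k}" "t k < \<phi> ((f ^^ i) x)" using k0 by blast
      have "i < n" using i(1) k(1) n by simp linarith
      have "2 ^ k \<le> n" using k(1) by linarith
      then have kl: "real k + 2 \<le> 4 * ln (real n)" using elim(2) by (rule log_exponent_le)
      have lnn: "ln (real n) > 0" using elim(2) by linarith
      have "n \<le> 2 ^ (k + 1)" using k(2) by linarith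
      then have "real n \<le> real (2 ^ (k + 1))" by (rule of_nat_mono)
      then have n2: "real n / 2 \<le> 2 ^ k" by simp
      have "real n powr (1 / \<beta>) * ln (real n) powr (- 1 / \<beta> - \<epsilon>)
         = real n powr (1 / \<beta>) * ln (real n) powr (- 1 / \<beta> - \<epsilon> / 2) / ln (real n) powr (\<epsilon> / 2)"
      proof -
        have "(- 1 / \<beta> - \<epsilon> / 2) - \<epsilon> / 2 = - 1 / \<beta> - \<epsilon>" by simp
        from powr_diff[of "ln (real n)" "- 1 / \<beta> - \<epsilon> / 2" "\<epsilon> / 2", unfolded this] show ?thesis
          by (simp only: times_divide_eq_right)
      qed
      also have "\<dots> \<le> real n powr (1 / \<beta>) * ln (real n) powr (- 1 / \<beta> - \<epsilon> / 2) / c"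
        using elim(1) c lnn by (intro divide_left_mono mult_pos_pos) auto
      also have "- 1 / \<beta> - \<epsilon> / 2 = - ((1 + \<delta>) / \<beta>)" using \<beta> by (simp add: \<delta>_def field_simps)
      also have "real n powr (1 / \<beta>) * ln (real n) powr - ((1 + \<delta>) / \<beta>) / c
         = ((real n / 2) / (4 * ln (real n)) powr (1 + \<delta>)) powr (1 / \<beta>)"
        using lnn \<beta> by (simp add: c_def powr_mult powr_powr powr_divide powr_minus_divide field_simps)
      also have "\<dots> \<le> t k"
        unfolding t_def using n2 kl \<beta> \<delta> by (intro powr_mono2 frac_le) auto
      also have "\<dots> \<le> \<phi> ((f ^^ i) x)" using i(2) by simp
      also have "\<dots> \<le> birkhoff_max f \<phi> n x" by (rule birkhoff_max_ge[OF \<open>i < n\<close>])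
      finally show ?case .
    qed
  qed
qed

text \<open>The values along the orbit are unbounded, so two of them at different times are positive, and at
least one of these is not the term that realises the maximum.\<close>
lemma birkhoff_max_less_sum:
  "AE x in \<mu>. \<forall>\<^sub>F n in sequentially. birkhoff_max f \<phi> n x < birkhoff_sum f \<phi> n x"
  using hits_within_powers[OF zero_less_one] AE_space
proof eventually_elim
  case (elim x)
  let ?t = "\<lambda>k::nat. (2 ^ k / (real k + 1) powr (1 + 1)) powr (1 / \<beta>)"
  have x: "x \<in> X" using elim(2) by (simp add: space_mu)
  have nn: "0 \<le> \<phi> ((f ^^ i) x)" for i by (rule \<phi>_nonneg[OF it_X[OF x]])
  have unbounded: "\<exists>i. V < \<phi> ((f ^^ i) x)" for V
  proof -
    have "\<forall>\<^sub>F k in sequentially. V \<le> ?t k" using \<beta> by real_asymp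
    from eventually_happens'[OF sequentially_bot eventually_conj[OF this elim(1)]] obtain k where
      "V \<le> ?t k" "\<exists>i\<in>{1..2 ^ k}. ?t k < \<phi> ((f ^^ i) x)" by (elim exE conjE) (rule that)
    then show ?thesis by (meson order.strict_trans1)
  qed
  obtain i1 where i1: "0 < \<phi> ((f ^^ i1) x)" using unbounded by blast
  obtain i2 where i2: "\<phi> ((f ^^ i1) x) < \<phi> ((f ^^ i2) x)" using unbounded by blast
  have "\<forall>\<^sub>F n in sequentially. n \<ge> Suc (max i1 i2)" by (rule eventually_ge_at_top)
  then show ?case
  proof eventually_elim
    case (elim n)
    have "birkhoff_max f \<phi> n x \<in> (\<lambda>k. \<phi> ((f ^^ k) x)) ` {..<n}"
      unfolding birkhoff_max_def using elim by (intro Max_in) (auto simp: lessThan_empty_iff)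
    then obtain i where i: "i < n" "birkhoff_max f \<phi> n x = \<phi> ((f ^^ i) x)" by auto
    define j where "j = (if i = i1 then i2 else i1)"
    have j: "j < n" "j \<noteq> i" "0 < \<phi> ((f ^^ j) x)" using elim i1 i2 by (auto simp: j_def)
    have "\<phi> ((f ^^ i) x) + \<phi> ((f ^^ j) x) = (\<Sum>k\<in>{i, j}. \<phi> ((f ^^ k) x))" using j by simp
    also have "\<dots> \<le> birkhoff_sum f \<phi> n x"
      unfolding birkhoff_sum_def using i j nn by (intro sum_mono2) auto
    finally show ?case using i j by simp
  qed
qed

end

theorem proposition2p8:
  fixes f \<phi> :: "real \<Rightarrow> real" and X :: "real set" and P :: "real set set"
    and \<mu> :: "real measure" and \<beta> :: real
  assumes "is_interval X" and "bounded X"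
    and "markov_partition f X P" and "big_images f P"
    and "uniformly_expanding f P"
    and "bounded_distortion f P"
    and "unique_acip f X \<mu>"
    and "\<phi> \<in> borel_measurable \<mu>" and "\<forall>x\<in>X. \<phi> x \<ge> 0"
    and "(\<integral>\<^sup>+ x. ennreal (\<phi> x) \<partial>\<mu>) = \<infinity>"
    and "\<forall>I\<in>P. \<phi> constant_on I"
    and "0 < \<beta>" and "\<beta> < 1" and "regular_tail X \<mu> \<phi> \<beta>"
  shows "\<forall>\<epsilon>>0. AE x in \<mu>. \<exists>n\<^sub>0. \<forall>n>n\<^sub>0.
     real n powr (1 / \<beta>) * ln (real n) powr (- 1 / \<beta> - \<epsilon>) \<le> birkhoff_max f \<phi> n x \<and>
     birkhoff_max f \<phi> n x < birkhoff_sum f \<phi> n x \<and>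
     birkhoff_sum f \<phi> n x \<le> real n powr (1 / \<beta>) * ln (real n) powr (1 / \<beta> + \<epsilon>)"
proof (intro allI impI)
  fix \<epsilon> :: real assume \<epsilon>: "\<epsilon> > 0"
  interpret heavy_tailed_observable f X P \<mu> \<phi> \<beta>
    using assms by unfold_locales auto
  show "AE x in \<mu>. \<exists>n\<^sub>0. \<forall>n>n\<^sub>0.
     real n powr (1 / \<beta>) * ln (real n) powr (- 1 / \<beta> - \<epsilon>) \<le> birkhoff_max f \<phi> n x \<and>
     birkhoff_max f \<phi> n x < birkhoff_sum f \<phi> n x \<and>
     birkhoff_sum f \<phi> n x \<le> real n powr (1 / \<beta>) * ln (real n) powr (1 / \<beta> + \<epsilon>)"
    using birkhoff_max_lower[OF \<epsilon>] birkhoff_max_less_sum birkhoff_sum_upper[OF \<epsilon>]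
  proof eventually_elim
    case (elim x)
    from eventually_conj[OF elim(1) eventually_conj[OF elim(2,3)]] show ?case
      unfolding eventually_at_top_dense .
  qed
qed

end
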